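(* Let $T>0$, $\mathbf s\in\mathbb N^+$ and $u_0\in L^2(\mathbb T)$. There exists $\epsilon>0$ (depending on $T,\lambda,\mathbf s,\|u_0\|_{L^2}$) such that if $\|u_0\|_{\dot H^{\mathbf s}}\le\epsilon$, then for every $\delta\in[0,1)$, $R\in[1,+\infty]$ and $N\in\mathbb N^+\cup\{+\infty\}$ the Wong–Zakai equation with parameters $(\delta,R,N)$ has a unique mild solution $u^{\delta,R,N}\in\mathcal C([0,T];H^{\mathbf s})$, and almost surely $$\|u^{\delta,R,N}\|_{\mathcal C([0,T];H^{\mathbf s})}\le 2\|u_0\|_{H^{\mathbf s}}+2\epsilon,\qquad \|u^{\delta,R,N}(t)\|_{L^2}=\|\pi_Nu_0\|_{L^2}\ \ \forall t\in[0,T].$$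
   Context: $\mathbb T=\mathbb R/(2\pi\mathbb Z)$; $\hat f_m=\frac1{2\pi}\int_{\mathbb T}f(x)e^{-imx}dx$. For $r\ge0$, $\|f\|_{H^r}^2=\sum_{m\in\mathbb Z}(1+|m|^{2r})|\hat f_m|^2$ and $\|f\|_{\dot H^r}^2=\sum_{m\neq0}|m|^{2r}|\hat f_m|^2$. $\pi_N$ is the Fourier projection onto frequencies $|k|\le N$, $\pi_{+\infty}=I$. For real $a$, $e^{\mathbf i a\Delta}$ is the Fourier multiplier $\hat f_m\mapsto e^{-\mathbf i am^2}\hat f_m$. $B$ is a standard real Brownian motion; $B^R$ is $B(t)$ clipped to $[-R\sqrt t,R\sqrt t]$ ($B^{+\infty}=B$); for $\delta>0$, $B^{\delta,R}(t)=B^R(\lfloor t\rfloor_\delta)+\frac{t-\lfloor t\rfloor_\delta}{\delta}(B^R(\lfloor t\rfloor_\delta+\delta)-B^R(\lfloor t\rfloor_\delta))$ with $\lfloor t\rfloor_\delta=\delta\lfloor t/\delta\rfloor$; for $\delta=0$, $B^{0,R}:=B^R$. $\lambda\ne0$ is real. A mild solution of the Wong–Zakai equation $du=\mathbf i\Delta u\circ dB^{\delta,R}+\mathbf i\lambda\pi_N(|u|^2u)dt$, $u(0)=\pi_Nu_0$, is an $L^2$-valued process with, a.s. for each $t\in[0,T]$, $$u^{\delta,R,N}(t)=e^{\mathbf iB^{\delta,R}(t)\Delta}\pi_Nu_0+\mathbf i\lambda\int_0^te^{\mathbf i(B^{\delta,R}(t)-B^{\delta,R}(s))\Delta}\pi_N\big(|u^{\delta,R,N}(s)|^2u^{\delta,R,N}(s)\big)ds.$$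 For $\delta=0,R=N=+\infty$ this is the mild solution $u$ of the NLSE with white noise dispersion $du=\mathbf i\Delta u\circ dB+\mathbf i\lambda|u|^2u\,dt$, $u(0)=u_0$. *)

theory Defs
  imports "HOL-Probability.Probability"
begin

definition std_BM :: "'a measure \<Rightarrow> (real \<Rightarrow> 'a \<Rightarrow> real) \<Rightarrow> bool" where
  "std_BM M B \<longleftrightarrow>
     prob_space M \<and>
     (\<forall>t\<ge>0. B t \<in> borel_measurable M) \<and>
     (AE \<omega> in M. B 0 \<omega> = 0 \<and> continuous_on {0..} (\<lambda>t. B t \<omega>)) \<and>
     (\<forall>s t. 0 \<le> s \<and> s < t \<longrightarrow>
        distributed M lborel (\<lambda>\<omega>. B t \<omega> - B s \<omega>)
          (\<lambda>x. ennreal (normal_density 0 (sqrt (t - s)) x))) \<and>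
     (\<forall>(ts :: nat \<Rightarrow> real) n. 0 \<le> ts 0 \<and> (\<forall>i<n. ts i < ts (Suc i)) \<longrightarrow>
        prob_space.indep_vars M (\<lambda>_. borel) (\<lambda>i \<omega>. B (ts (Suc i)) \<omega> - B (ts i) \<omega>) {..<n})"

definition clipB :: "ereal \<Rightarrow> (real \<Rightarrow> 'a \<Rightarrow> real) \<Rightarrow> real \<Rightarrow> 'a \<Rightarrow> real" where
  "clipB R B t \<omega> =
     (if R = \<infinity> then B t \<omega>
      else max (- (real_of_ereal R * sqrt t)) (min (real_of_ereal R * sqrt t) (B t \<omega>)))"

definition floor_d :: "real \<Rightarrow> real \<Rightarrow> real" where
  "floor_d \<delta> t = \<delta> * of_int \<lfloor>t / \<delta>\<rfloor>"

definition WZ_B :: "real \<Rightarrow> ereal \<Rightarrow> (real \<Rightarrow> 'a \<Rightarrow> real) \<Rightarrow> real \<Rightarrow> 'a \<Rightarrow> real" where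
  "WZ_B \<delta> R B t \<omega> =
     (if \<delta> = 0 then clipB R B t \<omega>
      else clipB R B (floor_d \<delta> t) \<omega>
           + (t - floor_d \<delta> t) / \<delta> *
             (clipB R B (floor_d \<delta> t + \<delta>) \<omega> - clipB R B (floor_d \<delta> t) \<omega>))"

text \<open>Functions on T = R/(2 pi Z) are represented by their values on [0, 2 pi].\<close>

definition L2fun :: "(real \<Rightarrow> complex) \<Rightarrow> bool" where
  "L2fun f \<longleftrightarrow> f \<in> borel_measurable lborel \<and>
     set_integrable lborel {0..2*pi} (\<lambda>x. (cmod (f x))\<^sup>2)"

definition L2_norm :: "(real \<Rightarrow> complex) \<Rightarrow> real" where
  "L2_norm f = sqrt (set_lebesgue_integral lborel {0..2*pi} (\<lambda>x. (cmod (f x))\<^sup>2))"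

definition fc :: "(real \<Rightarrow> complex) \<Rightarrow> int \<Rightarrow> complex" where
  "fc f m = (1 / (2 * pi)) *
     set_lebesgue_integral lborel {0..2*pi} (\<lambda>x. f x * exp (- (\<i> * of_int m * of_real x)))"

definition Hs_sq :: "nat \<Rightarrow> (real \<Rightarrow> complex) \<Rightarrow> ennreal" where
  "Hs_sq s f = (\<integral>\<^sup>+ m. ennreal ((1 + real_of_int \<bar>m\<bar> ^ (2 * s)) * (cmod (fc f m))\<^sup>2)
                   \<partial>count_space UNIV)"

definition Hdot_sq :: "nat \<Rightarrow> (real \<Rightarrow> complex) \<Rightarrow> ennreal" where
  "Hdot_sq s f = (\<integral>\<^sup>+ m. ennreal (if m = 0 then 0 else real_of_int \<bar>m\<bar> ^ (2 * s) * (cmod (fc f m))\<^sup>2)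
                   \<partial>count_space UNIV)"

definition in_Hs :: "nat \<Rightarrow> (real \<Rightarrow> complex) \<Rightarrow> bool" where
  "in_Hs s f \<longleftrightarrow> L2fun f \<and> Hs_sq s f < \<infinity>"

definition Hs_norm :: "nat \<Rightarrow> (real \<Rightarrow> complex) \<Rightarrow> real" where
  "Hs_norm s f = sqrt (enn2real (Hs_sq s f))"

definition C_Hs :: "nat \<Rightarrow> real \<Rightarrow> (real \<Rightarrow> real \<Rightarrow> complex) \<Rightarrow> bool" where
  "C_Hs s T v \<longleftrightarrow> (\<forall>t\<in>{0..T}. in_Hs s (v t)) \<and>
     (\<forall>t\<in>{0..T}. \<forall>e>0. \<exists>d>0. \<forall>t'\<in>{0..T}. \<bar>t' - t\<bar> < d \<longrightarrow>
         Hs_norm s (\<lambda>x. v t' x - v t x) < e)"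

definition inN :: "enat \<Rightarrow> int \<Rightarrow> bool" where
  "inN N m \<longleftrightarrow> enat (nat \<bar>m\<bar>) \<le> N"

definition projN :: "enat \<Rightarrow> (real \<Rightarrow> complex) \<Rightarrow> (real \<Rightarrow> complex)" where
  "projN N f = (if N = \<infinity> then f
     else (\<lambda>x. \<Sum>k\<in>{- int (the_enat N) .. int (the_enat N)}. fc f k * exp (\<i> * of_int k * of_real x)))"

definition cubic :: "(real \<Rightarrow> complex) \<Rightarrow> (real \<Rightarrow> complex)" where
  "cubic f = (\<lambda>x. complex_of_real ((cmod (f x))\<^sup>2) * f x)"

text \<open>The L^2-valued mild formulation, tested against every Fourier mode m
  (e^{i a \<Delta>} multiplies the m-th coefficient by exp(-i a m^2); pi_N keeps |m| \<le> N;
  the Fourier coefficient of the Bochner integral is the integral of the coefficient).\<close>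
definition WZ_mild :: "'a measure \<Rightarrow> (real \<Rightarrow> 'a \<Rightarrow> real) \<Rightarrow> real \<Rightarrow> real \<Rightarrow> ereal \<Rightarrow> enat
    \<Rightarrow> (real \<Rightarrow> complex) \<Rightarrow> real \<Rightarrow> (real \<Rightarrow> 'a \<Rightarrow> real \<Rightarrow> complex) \<Rightarrow> bool" where
  "WZ_mild M B lam \<delta> R N u0 T u \<longleftrightarrow>
     (\<forall>t\<in>{0..T}. \<forall>\<omega>\<in>space M. L2fun (u t \<omega>)) \<and>
     (\<forall>t\<in>{0..T}. \<forall>m. (\<lambda>\<omega>. fc (u t \<omega>) m) \<in> borel_measurable M) \<and>
     (\<forall>t\<in>{0..T}. AE \<omega> in M. \<forall>m::int.
        fc (u t \<omega>) m =
          (if inN N m then exp (- (\<i> * of_real (WZ_B \<delta> R B t \<omega>) * of_int (m\<^sup>2))) * fc u0 m else 0)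
          + \<i> * of_real lam *
            set_lebesgue_integral lborel {0..t}
              (\<lambda>s. if inN N m
                   then exp (- (\<i> * of_real (WZ_B \<delta> R B t \<omega> - WZ_B \<delta> R B s \<omega>) * of_int (m\<^sup>2)))
                        * fc (cubic (u s \<omega>)) m
                   else 0))"

end

theory Submission
  imports Defs
begin

text \<open>
  The coefficients of \<open>w = e\<^bsup>-i\<beta>\<Delta>\<^esup> u\<close> along a path \<open>\<beta>\<close> solve an ordinary differential equation whose
  right-hand side is cubic in \<open>\<ell>\<^sup>1(\<int>)\<close>, because that space is a convolution algebra on which
  the phases act isometrically. A radial truncation of the nonlinearity makes it globally Lipschitz, so the
  Picard iteration converges on \<open>[0, T]\<close> for every continuous path. Radial truncation keeps the nonlinearity a real
  multiple of \<open>\<bar>u\<bar>\<^sup>2 u\<close>, hence the mass is conserved; Young's inequality bounds the homogeneous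
  Sobolev norm by a constant multiple of its initial value. Mass controls the zero mode and the small Sobolev norm
  controls the sum of the other modes, so for small data the truncation is never active.
\<close>

section \<open>Summable and weighted square-summable sequences\<close>

text \<open>The constant \<epsilon> has to be fixed before the probability space, the Brownian
  motion and \<delta>, R, N are known, so no estimate may depend on the driving path or on the
  projection. Both enter only through unimodular phases and a set of retained modes, which never
  increase the modulus of a coefficient. The constants do not run in a circle: conserved mass alone
  fixes the truncation radius, the radius fixes the growth factor of the Sobolev norm on
  \<open>[0, T]\<close>, and \<epsilon> is chosen last. The Sobolev estimate for the truncated
  equation is linear, so it holds on the whole interval at once and replaces a continuation
  argument. Probability contributes a null set of bad paths and measurability in \<omega>, for which
  explicit iterates are convenient. A competing solution has no a priori smallness; on each path its
  continuity gives some bound, and both solutions are compared in an equation truncated at a larger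
  radius. The mild equation holds almost surely at each fixed time, with a null set depending on
  that time; rational times and continuity remove this dependence.\<close>

abbreviation CZ :: "int measure" where
  "CZ \<equiv> count_space UNIV"

text \<open>Values in \<open>ennreal\<close> let the convolution inequalities be stated for all
  sequences. Finiteness is summability, and \<open>nrm\<close> is the real number used once it is
  known.\<close>

definition l1n :: "(int \<Rightarrow> complex) \<Rightarrow> ennreal" where
  "l1n a = (\<integral>\<^sup>+m. ennreal (cmod (a m)) \<partial>CZ)"

text \<open>Since \<open>0 ^ 0 = 1\<close>, the case \<open>s = 0\<close> is the full square sum,
  that is the mass up to a factor. For \<open>s \<ge> 1\<close> the weight annihilates the zero
  mode, which gives the squared homogeneous Sobolev seminorm.\<close>

definition wl2 :: "nat \<Rightarrow> (int \<Rightarrow> complex) \<Rightarrow> ennreal" where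
  "wl2 s a = (\<integral>\<^sup>+m. ennreal (real_of_int \<bar>m\<bar> ^ (2 * s) * (cmod (a m))\<^sup>2) \<partial>CZ)"

definition nrm :: "(int \<Rightarrow> complex) \<Rightarrow> real" where
  "nrm a = enn2real (l1n a)"

definition conv :: "(int \<Rightarrow> complex) \<Rightarrow> (int \<Rightarrow> complex) \<Rightarrow> int \<Rightarrow> complex" where
  "conv a b m = (\<integral>k. a k * b (m - k) \<partial>CZ)"

text \<open>These are the coefficients of the complex conjugate function.\<close>

definition star :: "(int \<Rightarrow> complex) \<Rightarrow> int \<Rightarrow> complex" where
  "star b k = cnj (b (- k))"

text \<open>The Fourier coefficients of \<open>f \<cdot> cnj g \<cdot> h\<close> in terms of those of \<open>f\<close>, \<open>g\<close>, \<open>h\<close>.\<close>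

definition tri :: "(int \<Rightarrow> complex) \<Rightarrow> (int \<Rightarrow> complex) \<Rightarrow> (int \<Rightarrow> complex) \<Rightarrow> int \<Rightarrow> complex" where
  "tri a b c = conv (conv a (star b)) c"

abbreviation cube :: "(int \<Rightarrow> complex) \<Rightarrow> int \<Rightarrow> complex" where
  "cube a \<equiv> tri a a a"

lemma l1n_finite_iff: "l1n a < \<infinity> \<longleftrightarrow> integrable CZ a"
  by (simp add: integrable_iff_bounded l1n_def)

lemma l1n_eq_integral: "integrable CZ a \<Longrightarrow> l1n a = ennreal (\<integral>m. cmod (a m) \<partial>CZ)"
  unfolding l1n_def by (subst nn_integral_eq_integral) auto

lemma nrm_eq_integral: "integrable CZ a \<Longrightarrow> nrm a = (\<integral>m. cmod (a m) \<partial>CZ)"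
  by (simp add: nrm_def l1n_eq_integral)

lemma l1n_eq_nrm: "integrable CZ a \<Longrightarrow> l1n a = ennreal (nrm a)"
  by (simp add: nrm_eq_integral l1n_eq_integral)

lemma nrm_nonneg [simp]: "0 \<le> nrm a"
  by (simp add: nrm_def)

lemma cmod_le_l1n: "ennreal (cmod (a m)) \<le> l1n a"
  unfolding l1n_def by (rule nn_integral_ge_point) auto

lemma l1n_mono: "(\<And>m. cmod (a m) \<le> cmod (b m)) \<Longrightarrow> l1n a \<le> l1n b"
  unfolding l1n_def by (intro nn_integral_mono ennreal_leI)

lemma wl2_mono: "(\<And>m. cmod (a m) \<le> cmod (b m)) \<Longrightarrow> wl2 s a \<le> wl2 s b"
  unfolding wl2_def by (intro nn_integral_mono ennreal_leI mult_left_mono power_mono) auto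

lemma l1n_add: "l1n (\<lambda>m. a m + b m) \<le> l1n a + l1n b"
proof -
  have "l1n (\<lambda>m. a m + b m) \<le> (\<integral>\<^sup>+m. ennreal (cmod (a m)) + ennreal (cmod (b m)) \<partial>CZ)"
    unfolding l1n_def by (intro nn_integral_mono) (simp add: norm_triangle_ineq flip: ennreal_plus)
  then show ?thesis
    by (simp add: l1n_def nn_integral_add)
qed

lemma l1n_uminus: "l1n (\<lambda>m. - a m) = l1n a"
  by (simp add: l1n_def)

lemma l1n_diff: "l1n (\<lambda>m. a m - b m) \<le> l1n a + l1n b"
  using l1n_add[of a "\<lambda>m. - b m"] by (simp add: l1n_uminus)

lemma l1n_cmult: "l1n (\<lambda>m. c * a m) = ennreal (cmod c) * l1n a"
  unfolding l1n_def by (simp add: norm_mult ennreal_mult nn_integral_cmult)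

lemma nrm_diff_abs:
  assumes "integrable CZ a" "integrable CZ b"
  shows "\<bar>nrm a - nrm b\<bar> \<le> nrm (\<lambda>m. a m - b m)"
proof -
  have d: "integrable CZ (\<lambda>m. a m - b m)" using assms by simp
  have "nrm a - nrm b = (\<integral>m. cmod (a m) - cmod (b m) \<partial>CZ)"
    using assms by (simp add: nrm_eq_integral)
  also have "\<bar>\<dots>\<bar> \<le> (\<integral>m. \<bar>cmod (a m) - cmod (b m)\<bar> \<partial>CZ)"
    by (rule integral_abs_bound)
  also have "\<dots> \<le> (\<integral>m. cmod (a m - b m) \<partial>CZ)"
    using assms d by (intro integral_mono integrable_abs Bochner_Integration.integrable_diff
        integrable_norm) (auto simp: norm_triangle_ineq3)
  finally show ?thesis using d by (simp add: nrm_eq_integral)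
qed

section \<open>Invariance of sums over the integers under reflection and translation\<close>

lemma nn_integral_CZ_reflect: "(\<integral>\<^sup>+k. f (m - k) \<partial>CZ) = (\<integral>\<^sup>+k. f k \<partial>CZ)" for m :: int
proof -
  have "bij (\<lambda>k. m - k)" by (rule bijI') (auto intro: exI[of _ "m - _"] simp: algebra_simps)
  then show ?thesis by (rule nn_integral_bij_count_space)
qed

lemma nn_integral_CZ_shift: "(\<integral>\<^sup>+m. f (m - k) \<partial>CZ) = (\<integral>\<^sup>+m. f m \<partial>CZ)" for k :: int
proof -
  have "bij (\<lambda>m. m - k)" by (rule bijI') (auto intro: exI[of _ "_ + k"] simp: algebra_simps)
  then show ?thesis by (rule nn_integral_bij_count_space)
qed

lemma nn_integral_CZ_uminus: "(\<integral>\<^sup>+m. f (- m) \<partial>CZ) = (\<integral>\<^sup>+m. f m \<partial>CZ)" for f :: "int \<Rightarrow> ennreal"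
  using nn_integral_CZ_reflect[of f 0] by simp

lemma nn_integral_CZ_swap:
  "(\<integral>\<^sup>+m. \<integral>\<^sup>+k. f m k \<partial>CZ \<partial>CZ) = (\<integral>\<^sup>+k. \<integral>\<^sup>+m. f m k \<partial>CZ \<partial>CZ)"
  using nn_integral_fst_count_space[of "\<lambda>(m, k). f m k"]
    nn_integral_snd_count_space[of "\<lambda>(m, k). f m k"] by simp

lemma l1n_star [simp]: "l1n (star b) = l1n b"
  unfolding l1n_def star_def using nn_integral_CZ_uminus[of "\<lambda>m. ennreal (cmod (b m))"] by simp

lemma wl2_star [simp]: "wl2 s (star b) = wl2 s b"
  unfolding wl2_def star_def
  using nn_integral_CZ_uminus[of "\<lambda>m. ennreal (real_of_int \<bar>m\<bar> ^ (2 * s) * (cmod (b m))\<^sup>2)"] by simp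

lemma integrable_star [simp]: "integrable CZ (star b) \<longleftrightarrow> integrable CZ b"
  by (simp flip: l1n_finite_iff)

text \<open>A convolution sum that is not absolutely convergent has the default value 0, so the
  estimate covers this case as well.\<close>

lemma cmod_conv_le: "ennreal (cmod (conv a b m)) \<le> (\<integral>\<^sup>+k. ennreal (cmod (a k) * cmod (b (m - k))) \<partial>CZ)"
proof (cases "integrable CZ (\<lambda>k. a k * b (m - k))")
  case True
  then show ?thesis
    unfolding conv_def using integral_norm_bound_ennreal[OF True] by (simp add: norm_mult)
qed (simp add: conv_def not_integrable_integral_eq)

text \<open>Tonelli exchanges the sums, and the inner sum over \<open>m\<close> does not see the
  shift by \<open>k\<close>. Both Young inequalities below and the summability behind the product
  formula for series rest on this.\<close>

lemma nn_integral_conv: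
  assumes "\<And>k. 0 \<le> f k"
  shows "(\<integral>\<^sup>+m. \<integral>\<^sup>+k. ennreal (f k * g (m - k)) \<partial>CZ \<partial>CZ)
    = (\<integral>\<^sup>+k. ennreal (f k) \<partial>CZ) * (\<integral>\<^sup>+k. ennreal (g k) \<partial>CZ)"
proof -
  have "(\<integral>\<^sup>+m. \<integral>\<^sup>+k. ennreal (f k * g (m - k)) \<partial>CZ \<partial>CZ)
     = (\<integral>\<^sup>+k. ennreal (f k) * (\<integral>\<^sup>+m. ennreal (g (m - k)) \<partial>CZ) \<partial>CZ)"
    by (subst nn_integral_CZ_swap) (simp add: ennreal_mult' assms nn_integral_cmult)
  also have "\<dots> = (\<integral>\<^sup>+k. ennreal (f k) * (\<integral>\<^sup>+m. ennreal (g m) \<partial>CZ) \<partial>CZ)"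
    using nn_integral_CZ_shift[of "\<lambda>m. ennreal (g m)"] by simp
  finally show ?thesis by (simp add: nn_integral_multc)
qed

lemma l1n_conv: "l1n (conv a b) \<le> l1n a * l1n b"
proof -
  have "l1n (conv a b) \<le> (\<integral>\<^sup>+m. \<integral>\<^sup>+k. ennreal (cmod (a k) * cmod (b (m - k))) \<partial>CZ \<partial>CZ)"
    unfolding l1n_def[of "conv a b"] by (intro nn_integral_mono cmod_conv_le)
  then show ?thesis
    using nn_integral_conv[of "\<lambda>k. cmod (a k)" "\<lambda>k. cmod (b k)"] by (simp add: l1n_def)
qed

lemma integrable_conv: "integrable CZ a \<Longrightarrow> integrable CZ b \<Longrightarrow> integrable CZ (conv a b)"
  using l1n_conv[of a b]
  by (simp add: ennreal_mult_less_top le_less_trans flip: l1n_finite_iff)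

lemma integrable_tri:
  "integrable CZ a \<Longrightarrow> integrable CZ b \<Longrightarrow> integrable CZ c \<Longrightarrow> integrable CZ (tri a b c)"
  by (simp add: tri_def integrable_conv)

lemma l1n_tri: "l1n (tri a b c) \<le> l1n a * l1n b * l1n c"
  unfolding tri_def
  by (metis l1n_conv l1n_star mult_right_mono order_trans zero_le)

lemma integrable_conv_kernel:
  fixes a b :: "int \<Rightarrow> complex"
  assumes "integrable CZ a" "integrable CZ b"
  shows "integrable CZ (\<lambda>k. a k * b (m - k))"
proof (rule Bochner_Integration.integrable_bound[of CZ "\<lambda>k. nrm b *\<^sub>R a k"])
  show "integrable CZ (\<lambda>k. nrm b *\<^sub>R a k)" using assms(1) by simp
  have "cmod (b j) \<le> nrm b" for j
    using cmod_le_l1n[of b j] assms(2) by (simp add: l1n_eq_nrm)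
  then show "AE k in CZ. norm (a k * b (m - k)) \<le> norm (nrm b *\<^sub>R a k)"
    by (intro AE_I2) (simp add: norm_mult mult.commute[of "nrm b"] mult_left_mono)
qed simp

lemma conv_diff_left:
  assumes "integrable CZ a" "integrable CZ a'" "integrable CZ b"
  shows "conv (\<lambda>k. a k - a' k) b m = conv a b m - conv a' b m"
  unfolding conv_def
  by (simp add: left_diff_distrib integrable_conv_kernel assms)

lemma conv_diff_right:
  assumes "integrable CZ a" "integrable CZ b" "integrable CZ b'"
  shows "conv a (\<lambda>k. b k - b' k) m = conv a b m - conv a b' m"
  unfolding conv_def
  by (simp add: right_diff_distrib integrable_conv_kernel assms)

lemma star_diff: "star (\<lambda>k. b k - b' k) = (\<lambda>k. star b k - star b' k)"
  by (auto simp: star_def)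

text \<open>The difference of two cubes telescopes by changing one slot at a time. Each of the three
  resulting terms contains \<open>a - b\<close> once and two factors bounded by \<open>r\<close>,
  whence the factor 3.\<close>

lemma l1n_tri_diff:
  assumes "integrable CZ a" "integrable CZ b" "l1n a \<le> r" "l1n b \<le> r"
  shows "l1n (\<lambda>m. tri a a a m - tri b b b m) \<le> 3 * r\<^sup>2 * l1n (\<lambda>m. a m - b m)"
proof -
  define d where "d = (\<lambda>m. a m - b m)"
  have d: "integrable CZ d" using assms by (simp add: d_def)
  have sd: "star d = (\<lambda>k. star a k - star b k)" by (simp add: d_def star_diff)
  have 1: "tri a a a m - tri b b b m = tri d a a m + tri b d a m + tri b b d m" for m
  proof -
    have "conv d (star a) = (\<lambda>m. conv a (star a) m - conv b (star a) m)"
      unfolding d_def using assms by (auto simp: conv_diff_left)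
    moreover have "conv b (star d) = (\<lambda>m. conv b (star a) m - conv b (star b) m)"
      unfolding sd using assms by (auto simp: conv_diff_right)
    ultimately show ?thesis
      unfolding tri_def using assms
      by (simp add: conv_diff_left conv_diff_right integrable_conv d_def)
  qed
  have "l1n (\<lambda>m. tri a a a m - tri b b b m) \<le> l1n (tri d a a) + l1n (tri b d a) + l1n (tri b b d)"
    unfolding 1
    using l1n_add[of "\<lambda>m. tri d a a m + tri b d a m" "tri b b d"] l1n_add[of "tri d a a" "tri b d a"]
    by (meson add_right_mono order_trans)
  also have "\<dots> \<le> l1n d * r * r + r * l1n d * r + r * r * l1n d"
    by (intro add_mono order_trans[OF l1n_tri] mult_mono assms) auto
  also have "\<dots> = 3 * r\<^sup>2 * l1n d"
  proof -
    have "x + x + x = 3 * x" for x :: ennreal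
      by (metis distrib_right mult_1 numeral_Bit1 numeral_One one_add_one)
    from this[of "r\<^sup>2 * l1n d"] show ?thesis by (simp add: power2_eq_square mult_ac)
  qed
  finally show ?thesis by (simp add: d_def)
qed

section \<open>Young's inequality and weighted estimates for convolutions\<close>

lemma ennreal_sum_power2: "(x + y)\<^sup>2 \<le> 2 * x\<^sup>2 + 2 * y\<^sup>2" for x y :: ennreal
proof (cases "x = \<top> \<or> y = \<top>")
  case True
  then show ?thesis by (auto simp: ennreal_top_mult ennreal_mult_top)
next
  case False
  then obtain p q where "x = ennreal p" "y = ennreal q" "0 \<le> p" "0 \<le> q"
    by (metis ennreal_cases)
  moreover have "(p + q)\<^sup>2 \<le> 2 * p\<^sup>2 + 2 * q\<^sup>2" for p q :: real
    using sum_squares_bound[of p q] by (simp add: power2_sum)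
  ultimately show ?thesis
    by (simp add: ennreal_power ennreal_leI flip: ennreal_plus ennreal_numeral ennreal_mult)
qed

text \<open>Young's inequality for an l1 and an l2 factor. Cauchy-Schwarz with \<open>f\<close>
  split as \<open>sqrt f * sqrt f\<close> bounds the inner square by the sum of \<open>f\<close>
  times the convolution of \<open>f\<close> with \<open>g\<^sup>2\<close>, whose total is a
  product.\<close>

lemma nn_integral_conv_power2:
  fixes f g :: "int \<Rightarrow> real"
  assumes f: "\<And>k. 0 \<le> f k" and g: "\<And>k. 0 \<le> g k"
  shows "(\<integral>\<^sup>+m. (\<integral>\<^sup>+k. ennreal (f k * g (m - k)) \<partial>CZ)\<^sup>2 \<partial>CZ)
    \<le> (\<integral>\<^sup>+k. ennreal (f k) \<partial>CZ)\<^sup>2 * (\<integral>\<^sup>+k. ennreal ((g k)\<^sup>2) \<partial>CZ)"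
proof -
  let ?F = "\<integral>\<^sup>+k. ennreal (f k) \<partial>CZ"
  have 1: "(\<integral>\<^sup>+k. ennreal (f k * g (m - k)) \<partial>CZ)\<^sup>2 \<le> ?F * (\<integral>\<^sup>+k. ennreal (f k * (g (m - k))\<^sup>2) \<partial>CZ)" for m
  proof -
    have e: "ennreal (f k * g (m - k)) = ennreal (sqrt (f k)) * ennreal (sqrt (f k) * g (m - k))" for k
      using f g by (simp flip: ennreal_mult' mult.assoc)
    show ?thesis
      unfolding e
      using Cauchy_Schwarz_nn_integral[of "\<lambda>k. ennreal (sqrt (f k))" CZ "\<lambda>k. ennreal (sqrt (f k) * g (m - k))"]
      by (simp add: ennreal_power f g power_mult_distrib)
  qed
  have "(\<integral>\<^sup>+m. (\<integral>\<^sup>+k. ennreal (f k * g (m - k)) \<partial>CZ)\<^sup>2 \<partial>CZ)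
     \<le> (\<integral>\<^sup>+m. ?F * (\<integral>\<^sup>+k. ennreal (f k * (g (m - k))\<^sup>2) \<partial>CZ) \<partial>CZ)"
    by (intro nn_integral_mono 1)
  also have "\<dots> = ?F * (?F * (\<integral>\<^sup>+k. ennreal ((g k)\<^sup>2) \<partial>CZ))"
    using nn_integral_conv[of f "\<lambda>k. (g k)\<^sup>2"] f by (simp add: nn_integral_cmult)
  finally show ?thesis by (simp add: power2_eq_square mult.assoc)
qed

text \<open>At least one of \<open>k\<close> and \<open>m - k\<close> has at least half the size of
  \<open>m\<close>, so a Sobolev weight on a convolution can be moved to its factors at the cost of
  \<open>2 ^ s\<close>.\<close>

lemma abs_power_le_split:
  fixes m k :: int
  shows "real_of_int \<bar>m\<bar> ^ s \<le> 2 ^ s * (real_of_int \<bar>k\<bar> ^ s + real_of_int \<bar>m - k\<bar> ^ s)"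
proof -
  let ?x = "real_of_int \<bar>k\<bar>" and ?y = "real_of_int \<bar>m - k\<bar>"
  have "real_of_int \<bar>m\<bar> \<le> 2 * max ?x ?y" by (simp add: max_def abs_if)
  then have "real_of_int \<bar>m\<bar> ^ s \<le> (2 * max ?x ?y) ^ s" by (intro power_mono) auto
  also have "\<dots> = 2 ^ s * max ?x ?y ^ s" by (simp add: power_mult_distrib)
  also have "\<dots> \<le> 2 ^ s * (?x ^ s + ?y ^ s)"
    by (intro mult_left_mono) (auto simp: max_def)
  finally show ?thesis .
qed

text \<open>The factor \<open>2 * 4 ^ s\<close> is the square of the \<open>2 ^ s\<close> lost in
  moving the weight, doubled by splitting the square of a sum. Each term keeps the weighted norm of
  one factor and only the l1 norm of the other.\<close>

lemma wl2_conv: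
  "wl2 s (conv a b) \<le> ennreal (2 * 4 ^ s) * ((l1n b)\<^sup>2 * wl2 s a + (l1n a)\<^sup>2 * wl2 s b)"
proof -
  define w where "w m = real_of_int \<bar>m\<bar> ^ s" for m
  have w0: "0 \<le> w m" for m by (simp add: w_def)
  have w2: "(w m)\<^sup>2 = real_of_int \<bar>m\<bar> ^ (2 * s)" for m
    by (simp add: w_def mult.commute flip: power_mult)
  \<comment> \<open>\<open>P\<close> carries the weight on \<open>a\<close>, \<open>Q\<close> on
    \<open>b\<close>. In both the unweighted factor stands unshifted, since Young's inequality has
    its l1 factor there; for \<open>P\<close> this takes the reflection
    \<open>k \<mapsto> m - k\<close>.\<close>
  define P where "P m = (\<integral>\<^sup>+k. ennreal (cmod (b k) * (w (m - k) * cmod (a (m - k)))) \<partial>CZ)" for m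
  define Q where "Q m = (\<integral>\<^sup>+k. ennreal (cmod (a k) * (w (m - k) * cmod (b (m - k)))) \<partial>CZ)" for m
  have 1: "ennreal (w m * cmod (conv a b m)) \<le> ennreal (2 ^ s) * (P m + Q m)" for m
  proof -
    have Pm: "P m = (\<integral>\<^sup>+k. ennreal (w k * cmod (a k) * cmod (b (m - k))) \<partial>CZ)"
      unfolding P_def
      using nn_integral_CZ_reflect[of "\<lambda>k. ennreal (w k * cmod (a k) * cmod (b (m - k)))" m]
      by (simp add: mult_ac)
    have "ennreal (w m * cmod (conv a b m)) \<le> ennreal (w m) * (\<integral>\<^sup>+k. ennreal (cmod (a k) * cmod (b (m - k))) \<partial>CZ)"
      unfolding ennreal_mult[OF w0 norm_ge_zero] by (intro mult_left_mono cmod_conv_le) auto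
    also have "\<dots> = (\<integral>\<^sup>+k. ennreal (w m * (cmod (a k) * cmod (b (m - k)))) \<partial>CZ)"
      by (simp add: ennreal_mult w0 nn_integral_cmult)
    also have "\<dots> \<le> (\<integral>\<^sup>+k. ennreal (2 ^ s) * (ennreal (w k * cmod (a k) * cmod (b (m - k)))
         + ennreal (cmod (a k) * (w (m - k) * cmod (b (m - k))))) \<partial>CZ)"
    proof (intro nn_integral_mono)
      fix k
      have "w m * (cmod (a k) * cmod (b (m - k)))
          \<le> (2 ^ s * (w k + w (m - k))) * (cmod (a k) * cmod (b (m - k)))"
        unfolding w_def by (intro mult_right_mono abs_power_le_split) auto
      also have "\<dots> = 2 ^ s * (w k * cmod (a k) * cmod (b (m - k)) + cmod (a k) * (w (m - k) * cmod (b (m - k))))"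
        by (simp add: algebra_simps)
      finally show "ennreal (w m * (cmod (a k) * cmod (b (m - k)))) \<le> ennreal (2 ^ s) * (ennreal (w k * cmod (a k) * cmod (b (m - k)))
         + ennreal (cmod (a k) * (w (m - k) * cmod (b (m - k)))))"
        using w0 by (simp add: ennreal_leI flip: ennreal_plus ennreal_mult)
    qed
    also have "\<dots> = ennreal (2 ^ s) * (P m + Q m)"
      unfolding Pm Q_def by (simp add: nn_integral_cmult nn_integral_add)
    finally show ?thesis .
  qed
  have 4: "2 * (ennreal (2 ^ s))\<^sup>2 = ennreal (2 * 4 ^ s)"
  proof -
    have "((2::real) ^ s)\<^sup>2 = 4 ^ s" by (simp add: power2_eq_square flip: power_mult_distrib)
    then show ?thesis by (simp add: ennreal_power ennreal_mult)
  qed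
  have "wl2 s (conv a b) = (\<integral>\<^sup>+m. (ennreal (w m * cmod (conv a b m)))\<^sup>2 \<partial>CZ)"
    unfolding wl2_def by (simp add: ennreal_power w0 power_mult_distrib w2)
  also have "\<dots> \<le> (\<integral>\<^sup>+m. ennreal (2 * 4 ^ s) * ((P m)\<^sup>2 + (Q m)\<^sup>2) \<partial>CZ)"
  proof (intro nn_integral_mono)
    fix m
    have "(ennreal (w m * cmod (conv a b m)))\<^sup>2 \<le> (ennreal (2 ^ s) * (P m + Q m))\<^sup>2"
      by (intro power_mono 1) auto
    also have "\<dots> \<le> (ennreal (2 ^ s))\<^sup>2 * (2 * (P m)\<^sup>2 + 2 * (Q m)\<^sup>2)"
      by (simp add: power_mult_distrib mult_left_mono ennreal_sum_power2)
    also have "\<dots> = ennreal (2 * 4 ^ s) * ((P m)\<^sup>2 + (Q m)\<^sup>2)"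
      unfolding 4[symmetric] by (simp add: distrib_left mult_ac)
    finally show "(ennreal (w m * cmod (conv a b m)))\<^sup>2 \<le> ennreal (2 * 4 ^ s) * ((P m)\<^sup>2 + (Q m)\<^sup>2)" .
  qed
  also have "\<dots> = ennreal (2 * 4 ^ s) * ((\<integral>\<^sup>+m. (P m)\<^sup>2 \<partial>CZ) + (\<integral>\<^sup>+m. (Q m)\<^sup>2 \<partial>CZ))"
    by (simp add: nn_integral_cmult nn_integral_add)
  also have "\<dots> \<le> ennreal (2 * 4 ^ s) * ((l1n b)\<^sup>2 * wl2 s a + (l1n a)\<^sup>2 * wl2 s b)"
  proof (intro mult_left_mono add_mono)
    show "(\<integral>\<^sup>+m. (P m)\<^sup>2 \<partial>CZ) \<le> (l1n b)\<^sup>2 * wl2 s a"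
      unfolding P_def using nn_integral_conv_power2[of "\<lambda>k. cmod (b k)" "\<lambda>k. w k * cmod (a k)"]
      by (simp add: w0 l1n_def wl2_def power_mult_distrib w2)
    show "(\<integral>\<^sup>+m. (Q m)\<^sup>2 \<partial>CZ) \<le> (l1n a)\<^sup>2 * wl2 s b"
      unfolding Q_def using nn_integral_conv_power2[of "\<lambda>k. cmod (a k)" "\<lambda>k. w k * cmod (b k)"]
      by (simp add: w0 l1n_def wl2_def power_mult_distrib w2)
  qed auto
  finally show ?thesis .
qed

text \<open>With \<open>A = 2 * 4 ^ s\<close>, the inner convolution costs
  \<open>2 * A * r\<^sup>2\<close>, and the outer one turns this into
  \<open>A * (2 * A + 1) * r ^ 4\<close>.\<close>

definition wl2_tri_const :: "nat \<Rightarrow> real" where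
  "wl2_tri_const s = (2 * 4 ^ s) * (2 * (2 * 4 ^ s) + 1)"

text \<open>The right-hand side is linear in \<open>wl2 s a\<close>, all nonlinearity being absorbed
  in the l1 bound \<open>r\<close>. Once a truncation guarantees that bound, the growth of the
  Sobolev norm obeys a linear Gronwall inequality.\<close>

lemma wl2_tri:
  assumes "l1n a \<le> ennreal r" "0 \<le> r"
  shows "wl2 s (tri a a a) \<le> ennreal (wl2_tri_const s * r ^ 4) * wl2 s a"
proof -
  let ?A = "2 * 4 ^ s :: real"
  have c: "wl2 s (conv a (star a)) \<le> ennreal (2 * ?A * r\<^sup>2) * wl2 s a"
  proof -
    have "wl2 s (conv a (star a)) \<le> ennreal ?A * ((l1n a)\<^sup>2 * wl2 s a + (l1n a)\<^sup>2 * wl2 s a)"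
      using wl2_conv[of s a "star a"] by simp
    also have "\<dots> \<le> ennreal ?A * ((ennreal r)\<^sup>2 * wl2 s a + (ennreal r)\<^sup>2 * wl2 s a)"
      by (intro mult_left_mono add_mono mult_right_mono power_mono assms) auto
    also have "\<dots> = ennreal (2 * ?A * r\<^sup>2) * wl2 s a"
      using assms(2) by (simp add: ennreal_power ennreal_mult mult_ac flip: mult_2)
    finally show ?thesis .
  qed
  have l: "l1n (conv a (star a)) \<le> ennreal (r\<^sup>2)"
  proof -
    have "l1n (conv a (star a)) \<le> l1n a * l1n a" using l1n_conv[of a "star a"] by simp
    also have "\<dots> \<le> ennreal r * ennreal r" by (intro mult_mono assms) auto
    finally show ?thesis using assms(2) by (simp add: power2_eq_square ennreal_mult)
  qed
  have "wl2 s (tri a a a) \<le> ennreal ?A * ((l1n a)\<^sup>2 * wl2 s (conv a (star a)) + (l1n (conv a (star a)))\<^sup>2 * wl2 s a)"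
    unfolding tri_def by (rule wl2_conv)
  also have "\<dots> \<le> ennreal ?A * ((ennreal r)\<^sup>2 * (ennreal (2 * ?A * r\<^sup>2) * wl2 s a) + (ennreal (r\<^sup>2))\<^sup>2 * wl2 s a)"
    by (intro mult_left_mono add_mono mult_mono power_mono assms c l) auto
  also have "\<dots> = ennreal (?A * (r\<^sup>2 * (2 * ?A * r\<^sup>2) + (r\<^sup>2)\<^sup>2)) * wl2 s a"
  proof -
    have *: "(ennreal r)\<^sup>2 * (ennreal c * w) + (ennreal (r\<^sup>2))\<^sup>2 * w = ennreal (r\<^sup>2 * c + (r\<^sup>2)\<^sup>2) * w"
      if "0 \<le> c" for c w
      using that assms(2) by (simp add: ennreal_power ennreal_mult distrib_right mult.assoc)
    show ?thesis
      using assms(2) by (subst *) (auto simp: ennreal_mult' mult.assoc)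
  qed
  also have "?A * (r\<^sup>2 * (2 * ?A * r\<^sup>2) + (r\<^sup>2)\<^sup>2) = wl2_tri_const s * r ^ 4"
    by (simp add: wl2_tri_const_def algebra_simps power2_eq_square power4_eq_xxxx)
  finally show ?thesis .
qed

section \<open>The truncated cubic nonlinearity\<close>

text \<open>The radial retraction onto the l1 ball of radius \<open>r\<close>. Its scalar depends on
  the norm only, so it commutes with multiplication by unimodular phases.\<close>

definition cut :: "real \<Rightarrow> (int \<Rightarrow> complex) \<Rightarrow> int \<Rightarrow> complex" where
  "cut r a k = of_real (r / max r (nrm a)) * a k"

definition trunc_cubic :: "real \<Rightarrow> (int \<Rightarrow> complex) \<Rightarrow> int \<Rightarrow> complex" where
  "trunc_cubic r a = cube (cut r a)"

lemma cmod_cut_le: "0 < r \<Longrightarrow> cmod (cut r a k) \<le> cmod (a k)"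
  unfolding cut_def norm_mult norm_of_real by (rule mult_left_le_one_le) auto

lemma integrable_cut [simp]: "integrable CZ a \<Longrightarrow> integrable CZ (cut r a)"
  unfolding cut_def by simp

lemma l1n_cut:
  assumes "integrable CZ a" "0 < r"
  shows "l1n (cut r a) \<le> ennreal r"
proof -
  have "l1n (cut r a) = ennreal (r / max r (nrm a)) * l1n a"
    unfolding cut_def by (subst l1n_cmult) (use assms in \<open>simp del: of_real_divide\<close>)
  also have "\<dots> = ennreal (r / max r (nrm a) * nrm a)"
    using assms by (simp add: l1n_eq_nrm flip: ennreal_mult')
  also have "\<dots> \<le> ennreal r"
    using assms by (intro ennreal_leI) (auto simp: field_simps max_def)
  finally show ?thesis .
qed

lemma cut_eq: "nrm a \<le> r \<Longrightarrow> 0 < r \<Longrightarrow> cut r a = a"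
  by (auto simp: cut_def max_def)

text \<open>With \<open>c\<close> and \<open>d\<close> the two radial factors,
  \<open>c a - d b = c (a - b) + (c - d) b\<close>, and each term is at most the norm of
  \<open>a - b\<close>; hence the Lipschitz constant 2.\<close>

lemma l1n_cut_diff:
  assumes a: "integrable CZ a" and b: "integrable CZ b" and r: "0 < r"
  shows "l1n (\<lambda>m. cut r a m - cut r b m) \<le> 2 * l1n (\<lambda>m. a m - b m)"
proof -
  define x y where "x = nrm a" and "y = nrm b"
  define c d where "c = r / max r x" and "d = r / max r y"
  have xy: "0 \<le> x" "0 \<le> y" by (auto simp: x_def y_def)
  have D: "integrable CZ (\<lambda>m. a m - b m)" using a b by simp
  have c1: "0 \<le> c" "c \<le> 1" using r by (auto simp: c_def)
  \<comment> \<open>The change of the radial factor is weighted by the size of \<open>b\<close>.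
    Apart from the difference of the maxima only the factors \<open>c \<le> 1\<close> and
    \<open>y / max r y \<le> 1\<close> remain, so no power of \<open>r\<close> is lost.\<close>
  have "\<bar>c - d\<bar> * y \<le> \<bar>x - y\<bar>"
  proof -
    have "c - d = (max r y - max r x) * (c / max r y)"
      using r by (simp add: c_def d_def field_simps)
    then have "\<bar>c - d\<bar> * y = \<bar>max r y - max r x\<bar> * (c * (y / max r y))"
      using r c1 xy by (simp add: abs_mult)
    also have "\<dots> \<le> \<bar>max r y - max r x\<bar> * 1"
      using r c1 xy by (intro mult_left_mono mult_le_one) auto
    also have "\<dots> \<le> \<bar>x - y\<bar>" by (auto simp: max_def)
    finally show ?thesis .
  qed
  also have "\<bar>x - y\<bar> \<le> nrm (\<lambda>m. a m - b m)"
    unfolding x_def y_def by (rule nrm_diff_abs[OF a b])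
  finally have 1: "\<bar>c - d\<bar> * y \<le> nrm (\<lambda>m. a m - b m)" .
  have "cut r a m - cut r b m = of_real c * (a m - b m) + of_real (c - d) * b m" for m
    unfolding cut_def x_def[symmetric] y_def[symmetric] c_def[symmetric] d_def[symmetric]
    by (simp add: algebra_simps)
  then have "l1n (\<lambda>m. cut r a m - cut r b m)
      \<le> l1n (\<lambda>m. of_real c * (a m - b m)) + l1n (\<lambda>m. of_real (c - d) * b m)"
    using l1n_add by simp
  also have "\<dots> = ennreal c * l1n (\<lambda>m. a m - b m) + ennreal (\<bar>c - d\<bar>) * l1n b"
    using c1 by (simp only: l1n_cmult norm_of_real) simp
  also have "ennreal (\<bar>c - d\<bar>) * l1n b = ennreal (\<bar>c - d\<bar> * y)"
    using b by (simp add: l1n_eq_nrm y_def ennreal_mult)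
  also have "\<dots> \<le> l1n (\<lambda>m. a m - b m)"
    using 1 D by (simp add: l1n_eq_nrm ennreal_leI)
  also have "ennreal c * l1n (\<lambda>m. a m - b m) \<le> 1 * l1n (\<lambda>m. a m - b m)"
    using c1 by (intro mult_right_mono) auto
  finally show ?thesis by (simp add: mult_2 add_right_mono)
qed

lemma integrable_trunc_cubic [simp]: "integrable CZ a \<Longrightarrow> integrable CZ (trunc_cubic r a)"
  by (simp add: trunc_cubic_def integrable_tri)

lemma l1n_trunc_cubic:
  assumes "integrable CZ a" "0 < r"
  shows "l1n (trunc_cubic r a) \<le> ennreal (r ^ 3)"
proof -
  have "l1n (trunc_cubic r a) \<le> ennreal r * ennreal r * ennreal r"
    unfolding trunc_cubic_def by (intro order_trans[OF l1n_tri] mult_mono l1n_cut assms) auto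
  then show ?thesis
    using assms(2) by (simp add: power3_eq_cube ennreal_mult)
qed

text \<open>The factor 6 is the trilinear constant 3 times the Lipschitz constant 2 of the
  retraction.\<close>

lemma l1n_trunc_cubic_diff:
  assumes "integrable CZ a" "integrable CZ b" "0 < r"
  shows "l1n (\<lambda>m. trunc_cubic r a m - trunc_cubic r b m) \<le> ennreal (6 * r\<^sup>2) * l1n (\<lambda>m. a m - b m)"
proof -
  have "l1n (\<lambda>m. trunc_cubic r a m - trunc_cubic r b m)
      \<le> 3 * (ennreal r)\<^sup>2 * l1n (\<lambda>m. cut r a m - cut r b m)"
    unfolding trunc_cubic_def by (intro l1n_tri_diff l1n_cut integrable_cut assms)
  also have "\<dots> \<le> 3 * (ennreal r)\<^sup>2 * (2 * l1n (\<lambda>m. a m - b m))"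
    by (intro mult_left_mono l1n_cut_diff assms) auto
  also have "\<dots> = ennreal (6 * r\<^sup>2) * l1n (\<lambda>m. a m - b m)"
  proof -
    have "(6::ennreal) = 3 * 2" by simp
    then show ?thesis using assms(3) by (simp add: ennreal_mult ennreal_power mult_ac)
  qed
  finally show ?thesis .
qed

lemma wl2_trunc_cubic:
  assumes "integrable CZ a" "0 < r"
  shows "wl2 s (trunc_cubic r a) \<le> ennreal (wl2_tri_const s * r ^ 4) * wl2 s a"
proof -
  have "wl2 s (trunc_cubic r a) \<le> ennreal (wl2_tri_const s * r ^ 4) * wl2 s (cut r a)"
    unfolding trunc_cubic_def using assms by (intro wl2_tri l1n_cut) auto
  also have "\<dots> \<le> ennreal (wl2_tri_const s * r ^ 4) * wl2 s a"
    using assms by (intro mult_left_mono wl2_mono cmod_cut_le) auto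
  finally show ?thesis .
qed

text \<open>A real scalar is unchanged by the conjugation in the middle slot, so it comes out as a
  cube. This also reduces measurability and continuity of \<open>trunc_cubic\<close> to those of
  \<open>nrm\<close> and \<open>cube\<close>.\<close>

lemma tri_scale:
  "cube (\<lambda>k. of_real c * a k) m = of_real (c ^ 3) * tri a a a m"
proof -
  have 1: "conv (\<lambda>k. of_real x * p k) (\<lambda>k. of_real y * q k) = (\<lambda>m. of_real (x * y) * conv p q m)" for x y p q
  proof
    fix m
    have "(\<lambda>k. of_real x * p k * (of_real y * q (m - k))) = (\<lambda>k. of_real (x * y) * (p k * q (m - k)))"
      by (auto simp: mult_ac)
    then show "conv (\<lambda>k. of_real x * p k) (\<lambda>k. of_real y * q k) m = of_real (x * y) * conv p q m"
      unfolding conv_def by (simp del: of_real_mult)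
  qed
  have "star (\<lambda>k. of_real c * a k) = (\<lambda>k. of_real c * star a k)" by (auto simp: star_def)
  then show ?thesis unfolding tri_def by (simp only: 1) (simp add: power3_eq_cube)
qed

lemma trunc_cubic_eq: "trunc_cubic r a m = of_real ((r / max r (nrm a)) ^ 3) * tri a a a m"
  unfolding trunc_cubic_def cut_def by (rule tri_scale)

section \<open>Embedding of the homogeneous Sobolev norm\<close>

text \<open>The summand is even, so the sum is at most twice the convergent sum over the
  naturals.\<close>

lemma nn_integral_CZ_inverse_square_finite:
  "(\<integral>\<^sup>+m. ennreal (if m = 0 then 0 else 1 / (real_of_int m)\<^sup>2) \<partial>CZ) < \<infinity>"
proof -
  define f where "f m = ennreal (if m = 0 then 0 else 1 / (real_of_int m)\<^sup>2)" for m
  have "summable (\<lambda>n. 1 / (real n)\<^sup>2)"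
    using inverse_power_summable[of 2, where 'a = real] by (simp add: inverse_eq_divide)
  then have nat: "(\<integral>\<^sup>+n. f (int n) \<partial>count_space UNIV) < \<infinity>"
    unfolding nn_integral_count_space_nat f_def
    by (subst suminf_ennreal2) (auto intro: summable_comparison_test'[of _ 0])
  have r: "(\<integral>\<^sup>+m. f m * indicator (range int) m \<partial>CZ) = (\<integral>\<^sup>+n. f (int n) \<partial>count_space UNIV)"
    using nn_integral_bij_count_space[of int UNIV "range int" f]
    by (simp add: nn_integral_count_space_indicator bij_betw_def)
  have "(\<integral>\<^sup>+m. f m \<partial>CZ) \<le> (\<integral>\<^sup>+m. f m * indicator (range int) m + f (- m) * indicator (range int) (- m) \<partial>CZ)"
  proof (intro nn_integral_mono)
    fix m
    show "f m \<le> f m * indicator (range int) m + f (- m) * indicator (range int) (- m)"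
    proof (cases "0 \<le> m")
      case True
      then have "m \<in> range int" by (metis nonneg_int_cases rangeI)
      then show ?thesis by simp
    next
      case False
      then have "- m \<in> range int" by (metis nonneg_int_cases rangeI linear neg_0_le_iff_le)
      then show ?thesis by (simp add: f_def)
    qed
  qed
  also have "\<dots> = (\<integral>\<^sup>+m. f m * indicator (range int) m \<partial>CZ) + (\<integral>\<^sup>+m. f (- m) * indicator (range int) (- m) \<partial>CZ)"
    by (simp add: nn_integral_add)
  also have "\<dots> < \<infinity>"
    using nat nn_integral_CZ_uminus[of "\<lambda>m. f m * indicator (range int) m"] r by simp
  finally show ?thesis unfolding f_def .
qed

text \<open>The squared norm of the embedding of mean-zero functions with one derivative in L2 into
  absolutely convergent Fourier series.\<close>

definition emb_const :: real where
  "emb_const = enn2real (\<integral>\<^sup>+m. ennreal (if m = 0 then 0 else 1 / (real_of_int m)\<^sup>2) \<partial>CZ)"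

lemma emb_const_nonneg [simp]: "0 \<le> emb_const"
  by (simp add: emb_const_def)

lemma ennreal_le_sqrt: "x\<^sup>2 \<le> ennreal h \<Longrightarrow> x \<le> ennreal (sqrt h)"
proof (cases x)
  case (real p)
  assume "x\<^sup>2 \<le> ennreal h"
  with real have "p\<^sup>2 \<le> h \<or> p = 0"
    by (auto simp: ennreal_power ennreal_le_iff2)
  then show ?thesis
    by (elim disjE) (auto simp: real intro!: ennreal_leI real_le_rsqrt)
qed (simp add: top_unique)

text \<open>Cauchy-Schwarz with the weights \<open>1 / \<bar>m\<bar>\<close> and
  \<open>\<bar>m\<bar>\<close> bounds all modes but the zero one, and \<open>s \<ge> 1\<close>
  allows the weight to be raised to \<open>\<bar>m\<bar> ^ s\<close>. The zero mode is invisible to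
  the weight and appears on its own.\<close>

lemma l1n_le_wl2:
  assumes "1 \<le> s" "0 \<le> H" "wl2 s a \<le> ennreal H"
  shows "l1n a \<le> ennreal (cmod (a 0) + sqrt (emb_const * H))"
proof -
  define X where "X = (\<integral>\<^sup>+m. ennreal (if m = 0 then 0 else cmod (a m)) \<partial>CZ)"
  have "X\<^sup>2 \<le> ennreal (emb_const * H)"
  proof -
    have e: "ennreal (if m = 0 then 0 else cmod (a m))
        = ennreal (if m = 0 then 0 else 1 / \<bar>real_of_int m\<bar>) * ennreal (\<bar>real_of_int m\<bar> * cmod (a m))" for m
      by (auto simp: ennreal_mult'[symmetric])
    have "X\<^sup>2 \<le> (\<integral>\<^sup>+m. (ennreal (if m = 0 then 0 else 1 / \<bar>real_of_int m\<bar>))\<^sup>2 \<partial>CZ)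
          * (\<integral>\<^sup>+m. (ennreal (\<bar>real_of_int m\<bar> * cmod (a m)))\<^sup>2 \<partial>CZ)"
      unfolding X_def e by (rule Cauchy_Schwarz_nn_integral) auto
    also have "(\<integral>\<^sup>+m. (ennreal (if m = 0 then 0 else 1 / \<bar>real_of_int m\<bar>))\<^sup>2 \<partial>CZ) = ennreal emb_const"
    proof -
      have "(ennreal (if m = 0 then 0 else 1 / \<bar>real_of_int m\<bar>))\<^sup>2 = ennreal (if m = 0 then 0 else 1 / (real_of_int m)\<^sup>2)" for m
        by (simp add: ennreal_power power_divide)
      then show ?thesis
        using nn_integral_CZ_inverse_square_finite unfolding emb_const_def by (simp add: less_top)
    qed
    also have "(\<integral>\<^sup>+m. (ennreal (\<bar>real_of_int m\<bar> * cmod (a m)))\<^sup>2 \<partial>CZ) \<le> wl2 s a"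
      unfolding wl2_def
    proof (intro nn_integral_mono)
      fix m :: int
      have "\<bar>real_of_int m\<bar> ^ 2 \<le> \<bar>real_of_int m\<bar> ^ (2 * s)"
      proof (cases "m = 0")
        case False
        then have "1 \<le> \<bar>real_of_int m\<bar>" by linarith
        then show ?thesis using assms(1) by (intro power_increasing) auto
      qed (use assms(1) in auto)
      then show "(ennreal (\<bar>real_of_int m\<bar> * cmod (a m)))\<^sup>2 \<le> ennreal (real_of_int \<bar>m\<bar> ^ (2 * s) * (cmod (a m))\<^sup>2)"
        by (simp add: ennreal_power power_mult_distrib ennreal_leI mult_right_mono)
    qed
    also have "ennreal emb_const * wl2 s a \<le> ennreal emb_const * ennreal H"
      by (intro mult_left_mono assms) auto
    finally show ?thesis using assms(2) by (simp add: ennreal_mult mult_left_mono)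
  qed
  then have X: "X \<le> ennreal (sqrt (emb_const * H))" by (rule ennreal_le_sqrt)
  have "l1n a = (\<integral>\<^sup>+m. ennreal (cmod (a 0)) * indicator {0} m + ennreal (if m = 0 then 0 else cmod (a m)) \<partial>CZ)"
    unfolding l1n_def by (intro nn_integral_cong) (auto simp: indicator_def)
  also have "\<dots> = ennreal (cmod (a 0)) + X"
    unfolding X_def by (subst nn_integral_add) (auto simp: nn_integral_cmult_indicator)
  also have "\<dots> \<le> ennreal (cmod (a 0)) + ennreal (sqrt (emb_const * H))"
    by (intro add_left_mono X)
  finally show ?thesis using assms(2) by simp
qed

section \<open>Absolutely convergent Fourier series\<close>

text \<open>For summable \<open>a\<close> this is the function with Fourier coefficients
  \<open>a\<close>, defined at every point and thus a concrete representative of its L2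
  class.\<close>

definition synth :: "(int \<Rightarrow> complex) \<Rightarrow> real \<Rightarrow> complex" where
  "synth a x = (\<integral>m. a m * exp (\<i> * of_int m * of_real x) \<partial>CZ)"

text \<open>Summation over modes is integration against counting measure, so exchanging it with an
  integral or with another sum is an instance of one Fubini theorem.\<close>

lemma Fubini_CZ:
  fixes f :: "'b \<Rightarrow> int \<Rightarrow> 'c :: {banach, second_countable_topology}"
  assumes M: "sigma_finite_measure M"
    and [measurable]: "(\<lambda>(x, m). f x m) \<in> borel_measurable (M \<Otimes>\<^sub>M CZ)"
    and fin: "(\<integral>\<^sup>+m. \<integral>\<^sup>+x. ennreal (norm (f x m)) \<partial>M \<partial>CZ) < \<infinity>"
  shows "(\<integral>x. \<integral>m. f x m \<partial>CZ \<partial>M) = (\<integral>m. \<integral>x. f x m \<partial>M \<partial>CZ)"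
    and "integrable CZ (\<lambda>m. \<integral>x. f x m \<partial>M)"
    and "integrable M (\<lambda>x. \<integral>m. f x m \<partial>CZ)"
proof -
  interpret M: sigma_finite_measure M by fact
  interpret C: sigma_finite_measure CZ by (rule sigma_finite_measure_count_space)
  interpret pair_sigma_finite M CZ ..
  have "(\<integral>\<^sup>+z. ennreal (norm (case_prod f z)) \<partial>(M \<Otimes>\<^sub>M CZ)) = (\<integral>\<^sup>+m. \<integral>\<^sup>+x. ennreal (norm (f x m)) \<partial>M \<partial>CZ)"
    by (subst nn_integral_snd[symmetric]) (auto simp: split_beta')
  with fin have i: "integrable (M \<Otimes>\<^sub>M CZ) (case_prod f)"
    by (intro integrableI_bounded) (auto simp: split_beta')
  show "(\<integral>x. \<integral>m. f x m \<partial>CZ \<partial>M) = (\<integral>m. \<integral>x. f x m \<partial>M \<partial>CZ)"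
    by (rule Fubini_integral[OF i, symmetric])
  show "integrable CZ (\<lambda>m. \<integral>x. f x m \<partial>M)"
    by (rule integrable_snd[OF i])
  show "integrable M (\<lambda>x. \<integral>m. f x m \<partial>CZ)"
    using integrable_fst'[OF i] by simp
qed

lemma norm_exp_i_mult [simp]: "cmod (exp (\<i> * of_int m * of_real x)) = 1"
  "cmod (exp (- (\<i> * of_int m * of_real x))) = 1"
  using norm_exp_i_times[of "of_int m * x"] norm_exp_i_times[of "- (of_int m * x)"]
  by (simp_all add: mult.assoc)

lemma integrable_synth: "integrable CZ a \<Longrightarrow> integrable CZ (\<lambda>m. a m * exp (\<i> * of_int m * of_real x))"
  by (rule Bochner_Integration.integrable_bound[of CZ a]) (auto simp: norm_mult)

lemma cmod_synth_le: "integrable CZ a \<Longrightarrow> cmod (synth a x) \<le> nrm a"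
  unfolding synth_def nrm_eq_integral
  using integral_norm_bound[of CZ "\<lambda>m. a m * exp (\<i> * of_int m * of_real x)"] by (simp add: norm_mult)

lemma measurable_synth [measurable]: "synth a \<in> borel_measurable borel"
  unfolding synth_def
proof (rule sigma_finite_measure.borel_measurable_lebesgue_integral)
  show "sigma_finite_measure CZ" by (rule sigma_finite_measure_count_space)
  have [measurable]: "a \<in> borel_measurable CZ" "(\<lambda>m. complex_of_int m) \<in> borel_measurable CZ" by auto
  show "(\<lambda>(x, m). a m * exp (\<i> * complex_of_int m * complex_of_real x)) \<in> borel_measurable (borel \<Otimes>\<^sub>M CZ)"
    by measurable
qed

lemma synth_add: "integrable CZ a \<Longrightarrow> integrable CZ b \<Longrightarrow> synth (\<lambda>m. a m + b m) x = synth a x + synth b x"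
  by (simp add: synth_def distrib_right integrable_synth)

lemma integral_CZ_single: "(\<integral>m. (if m = k then c else 0) * f m \<partial>CZ) = (c * f k :: complex)"
proof -
  have "(\<integral>m. (if m = k then c else 0) * f m \<partial>CZ) = (\<integral>m. (c * f k) * indicator {k} m \<partial>CZ)"
    by (intro Bochner_Integration.integral_cong) (auto simp: indicator_def)
  also have "\<dots> = (c * f k) * (\<integral>m. indicator {k} m \<partial>CZ)"
    by (rule integral_mult_right_zero)
  also have "(\<integral>m. indicator {k} m \<partial>CZ) = (1 :: complex)"
    by (subst integral_complex_of_real[of CZ "\<lambda>m. indicator {k} m", simplified of_real_indicator]) simp
  finally show ?thesis by simp
qed

lemma integrable_CZ_single: "integrable CZ (\<lambda>m. if m = k then c else (0::complex))"
proof -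
  have "l1n (\<lambda>m. if m = k then c else 0) = (\<integral>\<^sup>+m. ennreal (cmod c) * indicator {k} m \<partial>CZ)"
    unfolding l1n_def by (intro nn_integral_cong) (auto simp: indicator_def)
  also have "\<dots> < \<infinity>" by (simp add: nn_integral_cmult_indicator)
  finally show ?thesis unfolding l1n_finite_iff .
qed

lemma synth_single: "synth (\<lambda>m. if m = k then c else 0) x = c * exp (\<i> * of_int k * of_real x)"
  unfolding synth_def by (rule integral_CZ_single)

text \<open>For fixed \<open>k\<close> the substitution of \<open>m + k\<close> for \<open>m\<close>
  separates the two series, since the exponential is multiplicative.\<close>

lemma synth_conv:
  assumes a: "integrable CZ a" and b: "integrable CZ b"
  shows "synth (conv a b) x = synth a x * synth b x"
proof -
  let ?e = "\<lambda>m. exp (\<i> * of_int m * of_real x)"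
  define f where "f m k = a k * b (m - k) * ?e m" for m k
  have fin: "(\<integral>\<^sup>+k. \<integral>\<^sup>+m. ennreal (cmod (f m k)) \<partial>CZ \<partial>CZ) < \<infinity>"
  proof -
    have "(\<integral>\<^sup>+k. \<integral>\<^sup>+m. ennreal (cmod (f m k)) \<partial>CZ \<partial>CZ) = l1n a * l1n b"
      using nn_integral_conv[of "\<lambda>k. cmod (a k)" "\<lambda>k. cmod (b k)"]
      by (subst nn_integral_CZ_swap) (simp add: f_def norm_mult l1n_def)
    then show ?thesis using a b by (simp add: ennreal_mult_less_top flip: l1n_finite_iff)
  qed
  have "synth (conv a b) x = (\<integral>m. \<integral>k. f m k \<partial>CZ \<partial>CZ)"
    unfolding synth_def conv_def f_def by simp
  also have "\<dots> = (\<integral>k. \<integral>m. f m k \<partial>CZ \<partial>CZ)"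
    by (rule Fubini_CZ(1)[OF sigma_finite_measure_count_space _ fin])
       (simp add: pair_measure_countable)
  also have "\<dots> = (\<integral>k. (a k * ?e k) * synth b x \<partial>CZ)"
  proof (intro Bochner_Integration.integral_cong refl)
    fix k
    have e: "?e (m + k) = ?e m * ?e k" for m
      by (simp add: distrib_left distrib_right flip: exp_add)
    have "bij (\<lambda>m. m + k)" by (rule bijI') (auto intro: exI[of _ "_ - k"])
    then have "(\<integral>m. f m k \<partial>CZ) = (\<integral>m. f (m + k) k \<partial>CZ)"
      by (rule integral_bij_count_space[symmetric])
    also have "\<dots> = (\<integral>m. (a k * ?e k) * (b m * ?e m) \<partial>CZ)"
      unfolding f_def e by (simp add: mult_ac)
    finally show "(\<integral>m. f m k \<partial>CZ) = (a k * ?e k) * synth b x"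
      unfolding synth_def by simp
  qed
  also have "\<dots> = synth a x * synth b x"
    unfolding synth_def by simp
  finally show ?thesis .
qed

lemma synth_star: "synth (star b) x = cnj (synth b x)"
proof -
  let ?f = "\<lambda>m. cnj (b m * exp (\<i> * of_int m * of_real x))"
  have "bij (\<lambda>m::int. - m)" by (rule bijI') (auto intro: exI[of _ "- _"])
  then have "(\<integral>m. ?f (- m) \<partial>CZ) = (\<integral>m. ?f m \<partial>CZ)"
    by (rule integral_bij_count_space)
  then show ?thesis
    unfolding synth_def star_def by (simp add: exp_cnj flip: Bochner_Integration.integral_cnj)
qed

lemma synth_tri:
  assumes "integrable CZ a"
  shows "synth (tri a a a) = cubic (synth a)"
  unfolding tri_def cubic_def using assms
  by (intro ext) (simp add: synth_conv synth_star integrable_conv complex_norm_square del: of_real_power)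

lemma integral_exp_i_mult:
  "(\<integral>x. indicator {0..2*pi} x *\<^sub>R exp (\<i> * of_int m * of_real x) \<partial>lborel) = (if m = 0 then 2 * pi else 0)"
proof (cases "m = 0")
  case True
  then show ?thesis
    using integral_FTC_Icc[of 0 "2*pi" "\<lambda>x. complex_of_real x" "\<lambda>_. 1"]
    by (auto intro!: derivative_eq_intros simp: has_vector_derivative_def scaleR_conv_of_real)
next
  case False
  have "(\<integral>x. indicator {0..2*pi} x *\<^sub>R exp (\<i> * of_int m * of_real x) \<partial>lborel)
      = exp (\<i> * of_int m * of_real (2*pi)) / (\<i> * of_int m) - exp (\<i> * of_int m * of_real 0) / (\<i> * of_int m)"
  proof (rule integral_FTC_Icc)
    fix x :: real
    have "((\<lambda>z. exp (\<i> * of_int m * z) / (\<i> * of_int m)) has_field_derivative exp (\<i> * of_int m * of_real x)) (at (of_real x))"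
      using False by (auto intro!: derivative_eq_intros)
    from has_vector_derivative_real_field[OF this]
    show "((\<lambda>x. exp (\<i> * of_int m * complex_of_real x) / (\<i> * of_int m)) has_vector_derivative
        exp (\<i> * of_int m * complex_of_real x)) (at x within {0..2 * pi})"
      by (rule has_vector_derivative_at_within)
  qed (auto intro!: continuous_intros)
  moreover have "exp (\<i> * of_int m * of_real (2*pi)) = 1"
    using exp_integer_2pi[of "of_int m"] by (simp add: mult_ac)
  ultimately show ?thesis using False by simp
qed

lemma fc_exp: "fc (\<lambda>x. exp (\<i> * of_int k * of_real x)) m = (if m = k then 1 else 0)"
proof -
  have "exp (\<i> * of_int k * of_real x) * exp (- (\<i> * of_int m * of_real x)) = exp (\<i> * of_int (k - m) * of_real x)" for x
    by (simp add: algebra_simps flip: exp_add)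
  then show ?thesis
    unfolding fc_def set_lebesgue_integral_def using integral_exp_i_mult[of "k - m"] by auto
qed

text \<open>Parseval's identity for an integrable function against an absolutely convergent series
  is a mere exchange of sum and integral. The coefficients and the mass of a series, the reality of
  the quartic integral and the uniqueness theorem all come from it.\<close>

lemma pairing_synth:
  assumes f: "set_integrable lborel {0..2*pi} f" and a: "integrable CZ a"
  shows "(\<integral>x. indicator {0..2*pi} x *\<^sub>R (f x * cnj (synth a x)) \<partial>lborel) = 2 * pi * (\<integral>m. fc f m * cnj (a m) \<partial>CZ)"
proof -
  define h where "h x = indicator {0..2*pi} x *\<^sub>R f x" for x
  have h: "integrable lborel h" using f by (simp add: set_integrable_def h_def[abs_def])
  then have [measurable]: "h \<in> borel_measurable lborel" by auto
  have [measurable]: "(\<lambda>m. cnj (a m)) \<in> borel_measurable CZ" "(\<lambda>m. complex_of_int m) \<in> borel_measurable CZ" by auto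
  define F where "F x m = h x * (cnj (a m) * exp (- (\<i> * of_int m * of_real x)))" for x m
  have Fm: "(\<lambda>(x, m). F x m) \<in> borel_measurable (lborel \<Otimes>\<^sub>M CZ)"
    unfolding F_def by measurable
  have fin: "(\<integral>\<^sup>+m. \<integral>\<^sup>+x. ennreal (cmod (F x m)) \<partial>lborel \<partial>CZ) < \<infinity>"
  proof -
    have "(\<integral>\<^sup>+m. \<integral>\<^sup>+x. ennreal (cmod (F x m)) \<partial>lborel \<partial>CZ) = (\<integral>\<^sup>+x. ennreal (cmod (h x)) \<partial>lborel) * l1n a"
      unfolding F_def l1n_def by (simp add: norm_mult ennreal_mult nn_integral_multc nn_integral_cmult)
    then show ?thesis using a h
      by (simp add: ennreal_mult_less_top integrable_iff_bounded l1n_def)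
  qed
  have fcm: "(\<integral>x. F x m \<partial>lborel) = 2 * pi * (fc f m * cnj (a m))" for m
  proof -
    have "(\<integral>x. F x m \<partial>lborel) = (\<integral>x. cnj (a m) * (h x * exp (- (\<i> * of_int m * of_real x))) \<partial>lborel)"
      unfolding F_def by (simp add: mult_ac)
    also have "\<dots> = cnj (a m) * (\<integral>x. h x * exp (- (\<i> * of_int m * of_real x)) \<partial>lborel)"
      by (rule integral_mult_right_zero)
    also have "\<dots> = 2 * pi * (fc f m * cnj (a m))"
      unfolding fc_def set_lebesgue_integral_def h_def by simp
    finally show ?thesis .
  qed
  have "(\<integral>x. indicator {0..2*pi} x *\<^sub>R (f x * cnj (synth a x)) \<partial>lborel) = (\<integral>x. h x * (\<integral>m. cnj (a m * exp (\<i> * of_int m * of_real x)) \<partial>CZ) \<partial>lborel)"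
    unfolding h_def synth_def Bochner_Integration.integral_cnj by simp
  also have "\<dots> = (\<integral>x. \<integral>m. F x m \<partial>CZ \<partial>lborel)"
    unfolding F_def by (simp add: exp_cnj)
  also have "\<dots> = (\<integral>m. \<integral>x. F x m \<partial>lborel \<partial>CZ)"
    by (rule Fubini_CZ(1)[OF sigma_finite_lborel Fm fin])
  also have "\<dots> = 2 * pi * (\<integral>m. fc f m * cnj (a m) \<partial>CZ)"
    unfolding fcm by (rule integral_mult_right_zero)
  finally show ?thesis .
qed

lemma set_integrable_bounded_Icc:
  fixes f :: "real \<Rightarrow> complex"
  assumes [measurable]: "f \<in> borel_measurable borel" and "\<And>x. cmod (f x) \<le> C"
  shows "set_integrable lborel {0..2*pi} f"
  unfolding set_integrable_def
proof (rule Bochner_Integration.integrable_bound)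
  show "integrable lborel (\<lambda>x. indicator {0..2*pi} x *\<^sub>R C)"
    by (intro integrable_scaleR_left integrable_real_indicator) auto
  show "AE x in lborel. norm (indicator {0..2*pi} x *\<^sub>R f x) \<le> norm (indicat_real {0..2*pi} x *\<^sub>R C)"
    by (intro AE_I2) (simp add: indicator_def order_trans[OF assms(2) abs_ge_self])
qed simp

lemma set_integrable_synth: "integrable CZ a \<Longrightarrow> set_integrable lborel {0..2*pi} (synth a)"
  using cmod_synth_le by (intro set_integrable_bounded_Icc) auto

text \<open>Parseval's identity is used with the exponential as the function and \<open>a\<close> as
  the series; conjugating the result isolates \<open>a m\<close>.\<close>

lemma fc_synth:
  assumes "integrable CZ a"
  shows "fc (synth a) m = a m"
proof -
  let ?e = "\<lambda>x. exp (\<i> * of_int m * of_real x)"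
  have "(\<integral>x. indicator {0..2*pi} x *\<^sub>R (?e x * cnj (synth a x)) \<partial>lborel) = 2 * pi * (\<integral>k. fc ?e k * cnj (a k) \<partial>CZ)"
    by (intro pairing_synth assms set_integrable_bounded_Icc[of _ 1]) auto
  also have "\<dots> = 2 * pi * cnj (a m)"
    unfolding fc_exp by (subst integral_CZ_single) simp
  finally have "cnj (\<integral>x. indicator {0..2*pi} x *\<^sub>R (?e x * cnj (synth a x)) \<partial>lborel) = 2 * pi * a m"
    by simp
  then show ?thesis
    unfolding fc_def set_lebesgue_integral_def
    by (simp add: exp_cnj mult.commute flip: Bochner_Integration.integral_cnj)
qed

lemma fc_cubic_synth: "integrable CZ a \<Longrightarrow> fc (cubic (synth a)) m = tri a a a m"
  by (simp add: integrable_tri fc_synth flip: synth_tri)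

lemma L2fun_synth:
  assumes "integrable CZ a"
  shows "L2fun (synth a)"
proof -
  have "set_integrable lborel {0..2*pi} (\<lambda>x. complex_of_real ((cmod (synth a x))\<^sup>2))"
    using cmod_synth_le[OF assms]
    by (intro set_integrable_bounded_Icc[of _ "(nrm a)\<^sup>2"]) (auto intro!: power_mono simp: norm_power)
  then have "set_integrable lborel {0..2*pi} (\<lambda>x. Re (complex_of_real ((cmod (synth a x))\<^sup>2)))"
    unfolding set_integrable_def by (auto dest: integrable_Re)
  then show ?thesis by (simp add: L2fun_def)
qed

lemma integral_CZ_cmod_power2: "(\<integral>m. (cmod (a m))\<^sup>2 \<partial>CZ) = enn2real (wl2 0 a)"
  unfolding wl2_def by (subst integral_eq_nn_integral) auto

lemma L2_norm_synth:
  assumes "integrable CZ a"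
  shows "L2_norm (synth a) = sqrt (2 * pi * enn2real (wl2 0 a))"
proof -
  have "complex_of_real (\<integral>x. indicator {0..2*pi} x *\<^sub>R (cmod (synth a x))\<^sup>2 \<partial>lborel)
     = (\<integral>x. indicator {0..2*pi} x *\<^sub>R (synth a x * cnj (synth a x)) \<partial>lborel)"
    by (subst integral_complex_of_real[symmetric]) (simp add: complex_norm_square scaleR_conv_of_real del: of_real_power)
  also have "\<dots> = 2 * pi * (\<integral>m. a m * cnj (a m) \<partial>CZ)"
    using pairing_synth[OF set_integrable_synth assms] assms by (simp add: fc_synth)
  also have "(\<integral>m. a m * cnj (a m) \<partial>CZ) = complex_of_real (\<integral>m. (cmod (a m))\<^sup>2 \<partial>CZ)"
    by (subst integral_complex_of_real[symmetric]) (simp add: complex_norm_square del: of_real_power)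
  finally have "complex_of_real (\<integral>x. indicator {0..2*pi} x *\<^sub>R (cmod (synth a x))\<^sup>2 \<partial>lborel) = complex_of_real (2 * pi * (\<integral>m. (cmod (a m))\<^sup>2 \<partial>CZ))"
    by simp
  then show ?thesis
    unfolding L2_norm_def set_lebesgue_integral_def of_real_eq_iff by (simp add: integral_CZ_cmod_power2)
qed

text \<open>On the physical side this is the reality of \<open>\<integral> \<bar>u\<bar>\<^sup>4\<close>.\<close>

lemma Im_tri_pairing:
  assumes "integrable CZ a"
  shows "Im (\<integral>m. tri a a a m * cnj (a m) \<partial>CZ) = 0"
proof -
  have "2 * pi * (\<integral>m. tri a a a m * cnj (a m) \<partial>CZ) = (\<integral>x. indicator {0..2*pi} x *\<^sub>R (cubic (synth a) x * cnj (synth a x)) \<partial>lborel)"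
    using pairing_synth[OF set_integrable_synth assms, of "tri a a a"] assms
    by (simp add: fc_cubic_synth integrable_tri synth_tri)
  also have "\<dots> = complex_of_real (\<integral>x. indicator {0..2*pi} x *\<^sub>R (cmod (synth a x)) ^ 4 \<partial>lborel)"
  proof -
    have "cubic (synth a) x * cnj (synth a x) = complex_of_real (cmod (synth a x) ^ 4)" for x
      unfolding cubic_def mult.assoc complex_norm_square[symmetric]
      by (simp add: power2_eq_square power4_eq_xxxx mult.assoc)
    then show ?thesis
      by (subst integral_complex_of_real[symmetric]) (simp add: scaleR_conv_of_real)
  qed
  finally have "Im (complex_of_real (2 * pi) * (\<integral>m. tri a a a m * cnj (a m) \<partial>CZ)) = 0"
    by simp
  then show ?thesis by simp
qed

section \<open>Uniqueness of Fourier coefficients\<close>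

text \<open>On the circle a polynomial in the two real coordinates is a trigonometric polynomial.
  The induction records only that the coefficients are summable, a property that convolution carries
  through products.\<close>

lemma real_polynomial_on_circle_synth:
  assumes "real_polynomial_function (p :: complex \<Rightarrow> real)"
  shows "\<exists>a. integrable CZ a \<and> (\<forall>x. complex_of_real (p (cis x)) = synth a x)"
  using assms
proof induction
  case (linear f)
  interpret bounded_linear f by fact
  define u where "u = complex_of_real (f 1)"
  define v where "v = complex_of_real (f \<i>)"
  \<comment> \<open>Euler's formulas applied to \<open>cos x * u + sin x * v\<close>.\<close>
  define a where "a m = (if m = 1 then (u - \<i> * v) / 2 else 0) + (if m = -1 then (u + \<i> * v) / 2 else (0::complex))" for m :: int
  have "complex_of_real (f (cis x)) = synth a x" for x
  proof -
    have "cis x = cos x *\<^sub>R 1 + sin x *\<^sub>R \<i>" by (simp add: complex_eq_iff)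
    then have "f (cis x) = cos x * f 1 + sin x * f \<i>" by (simp only: add scaleR) simp
    then have l: "complex_of_real (f (cis x)) = of_real (cos x) * u + of_real (sin x) * v"
      by (simp add: u_def v_def)
    have e: "exp (\<i> * of_int 1 * of_real x) = of_real (cos x) + \<i> * of_real (sin x)"
        "exp (\<i> * of_int (-1) * of_real x) = of_real (cos x) - \<i> * of_real (sin x)"
      using cis_conv_exp[of x] cis_conv_exp[of "-x"] by (auto simp: complex_eq_iff)
    have "synth a x = (u - \<i> * v) / 2 * exp (\<i> * of_int 1 * of_real x) + (u + \<i> * v) / 2 * exp (\<i> * of_int (-1) * of_real x)"
      unfolding a_def by (simp only: synth_add integrable_CZ_single synth_single)
    also have "\<dots> = of_real (cos x) * u + of_real (sin x) * v"
      unfolding e by (simp add: field_simps)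
    finally show ?thesis using l by simp
  qed
  moreover have "integrable CZ a"
    unfolding a_def by (intro Bochner_Integration.integrable_add integrable_CZ_single)
  ultimately show ?case by blast
next
  case (const c)
  show ?case
    by (rule exI[of _ "\<lambda>m. if m = 0 then complex_of_real c else 0"])
       (simp add: integrable_CZ_single synth_single)
next
  case (add f g)
  then obtain a b where "integrable CZ a" "\<forall>x. complex_of_real (f (cis x)) = synth a x"
    "integrable CZ b" "\<forall>x. complex_of_real (g (cis x)) = synth b x" by blast
  then show ?case by (intro exI[of _ "\<lambda>m. a m + b m"]) (simp add: synth_add)
next
  case (mult f g)
  then obtain a b where "integrable CZ a" "\<forall>x. complex_of_real (f (cis x)) = synth a x"
    "integrable CZ b" "\<forall>x. complex_of_real (g (cis x)) = synth b x" by blast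
  then show ?case by (intro exI[of _ "conv a b"]) (simp add: synth_conv integrable_conv)
qed

text \<open>Stone-Weierstrass approximates \<open>g\<close> uniformly on the circle by a polynomial,
  whose integral against \<open>f\<close> vanishes by Parseval; the error is at most the tolerance
  times the L1 norm of \<open>f\<close>.\<close>

lemma integral_continuous_on_circle_eq_0:
  assumes f: "set_integrable lborel {0..2*pi} f" and fc: "\<And>m. fc f m = 0"
    and g: "continuous_on UNIV (g :: complex \<Rightarrow> real)"
  shows "(\<integral>x. of_real (g (cis x)) * (indicator {0..2*pi} x *\<^sub>R f x) \<partial>lborel) = 0"
proof -
  define h where "h x = indicator {0..2*pi} x *\<^sub>R f x" for x
  have h: "integrable lborel h" using f by (simp add: set_integrable_def h_def[abs_def])
  then have [measurable]: "h \<in> borel_measurable borel" by auto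
  have cis_cont: "continuous_on UNIV cis"
    by (rule continuous_on_cis[OF continuous_on_id])
  have I: "integrable lborel (\<lambda>x. complex_of_real (q (cis x)) * h x)" if q: "continuous_on UNIV q" for q :: "complex \<Rightarrow> real"
  proof -
    have qc: "continuous_on UNIV (\<lambda>x. q (cis x))"
      using continuous_on_compose2[OF q cis_cont] by auto
    have [measurable]: "(\<lambda>x. q (cis x)) \<in> borel_measurable borel"
      using qc by (rule borel_measurable_continuous_onI)
    have "compact (q ` sphere 0 1)"
      by (intro compact_continuous_image continuous_on_subset[OF q]) auto
    then obtain K where "\<forall>y\<in>q ` sphere 0 1. norm y \<le> K"
      by (meson bounded_iff compact_imp_bounded)
    then have K: "\<bar>q (cis x)\<bar> \<le> K" for x by auto
    show ?thesis
    proof (rule Bochner_Integration.integrable_bound)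
      show "integrable lborel (\<lambda>x. K *\<^sub>R h x)" using h by simp
      show "AE x in lborel. norm (complex_of_real (q (cis x)) * h x) \<le> norm (K *\<^sub>R h x)"
        by (intro AE_I2) (simp add: norm_mult mult_right_mono order_trans[OF K abs_ge_self])
    qed simp
  qed
  define J where "J = (\<integral>x. complex_of_real (g (cis x)) * h x \<partial>lborel)"
  define A where "A = (\<integral>x. cmod (h x) \<partial>lborel)"
  have "cmod J \<le> e * A" if e: "0 < e" for e
  proof -
    obtain p where p: "real_polynomial_function p" "\<And>z. z \<in> sphere 0 1 \<Longrightarrow> \<bar>g z - p z\<bar> < e"
      using Stone_Weierstrass_real_polynomial_function[of "sphere (0::complex) 1" g e] e g
      by (metis compact_sphere continuous_on_subset subset_UNIV)
    have pc: "continuous_on UNIV p"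
      using p(1) continuous_on_polymonial_function real_polynomial_function_eq by blast
    obtain a where a: "integrable CZ a" "\<And>x. complex_of_real (p (cis x)) = synth a x"
      using real_polynomial_on_circle_synth[OF p(1)] by blast
    \<comment> \<open>The polynomial is real-valued, so the conjugate in Parseval's identity can be
      inserted at no cost.\<close>
    have "cnj (synth a x) = synth a x" for x
      unfolding a(2)[symmetric] by simp
    then have "(\<integral>x. complex_of_real (p (cis x)) * h x \<partial>lborel) = (\<integral>x. indicator {0..2*pi} x *\<^sub>R (f x * cnj (synth a x)) \<partial>lborel)"
      unfolding a(2) h_def by (simp add: mult.commute)
    also have "\<dots> = 0"
      using pairing_synth[OF f a(1)] by (simp add: fc)
    finally have "J = (\<integral>x. complex_of_real (g (cis x)) * h x - complex_of_real (p (cis x)) * h x \<partial>lborel)"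
      unfolding J_def using I[OF g] I[OF pc] by simp
    also have "cmod \<dots> \<le> (\<integral>x. cmod (complex_of_real (g (cis x)) * h x - complex_of_real (p (cis x)) * h x) \<partial>lborel)"
      by (rule integral_norm_bound)
    also have "\<dots> \<le> (\<integral>x. e * cmod (h x) \<partial>lborel)"
    proof (rule integral_mono)
      fix x
      have "complex_of_real (g (cis x)) * h x - complex_of_real (p (cis x)) * h x = of_real (g (cis x) - p (cis x)) * h x"
        by (simp add: left_diff_distrib)
      then show "cmod (complex_of_real (g (cis x)) * h x - complex_of_real (p (cis x)) * h x) \<le> e * cmod (h x)"
        using p(2)[of "cis x"] by (simp only: norm_mult norm_of_real) (simp add: mult_right_mono)
    qed (use I[OF g] I[OF pc] h in auto)
    finally show ?thesis by (simp add: A_def)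
  qed
  from this have "cmod J \<le> 0"
  proof (cases "A = 0")
    case True
    then show ?thesis using \<open>\<And>e. 0 < e \<Longrightarrow> cmod J \<le> e * A\<close>[of 1] by simp
  next
    case False
    then have "A > 0" unfolding A_def by (simp add: less_le)
    show ?thesis
    proof (rule field_le_epsilon)
      fix e :: real assume "0 < e"
      with \<open>A > 0\<close> show "cmod J \<le> 0 + e"
        using \<open>\<And>e. 0 < e \<Longrightarrow> cmod J \<le> e * A\<close>[of "e / A"] by simp
    qed
  qed
  then show ?thesis by (simp add: J_def h_def)
qed

text \<open>The endpoints 0 and 2 pi have the same image, so one of the two points has to be
  interior.\<close>

lemma cis_inj_on_open_interval:
  assumes "cis x = cis y" "0 < x" "x < 2 * pi" "0 \<le> y" "y \<le> 2 * pi"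
  shows "x = y"
proof -
  have "cos x = cos y" "sin x = sin y" using assms(1) by (auto simp: complex_eq_iff)
  then obtain n where n: "x = y + 2 * pi * of_int n"
    using sin_cos_eq_iff[of x y] by auto
  have "2 * pi * of_int n < 2 * pi * 1" "2 * pi * (-1) < 2 * pi * of_int n"
    using assms(2-5) n by linarith+
  then have "of_int n < (1::real)" "(-1::real) < of_int n"
    by (simp_all only: mult_less_cancel_left_pos[of "2 * pi"] pi_gt_zero mult_pos_pos zero_less_numeral)
  then have "n = 0" by linarith
  with n show ?thesis by simp
qed

text \<open>Continuous functions on the circle approximate indicators of closed sets, so
  \<open>f\<close> has integral 0 over each closed set. Closed sets are stable under intersection
  and generate the Borel sets, and a density whose integrals all vanish is zero almost
  everywhere.\<close>

theorem Fourier_uniqueness: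
  assumes f: "set_integrable lborel {0..2*pi} f" and fc: "\<And>m. fc f m = 0"
  shows "AE x in lborel. x \<in> {0..2*pi} \<longrightarrow> f x = 0"
proof -
  define h where "h x = indicator {0..2*pi} x *\<^sub>R f x" for x
  have h: "integrable lborel h" using f by (simp add: set_integrable_def h_def[abs_def])
  then have [measurable]: "h \<in> borel_measurable borel" by auto
  have closed_0: "set_lebesgue_integral lborel A h = 0" if A: "closed A" for A
  proof -
    \<comment> \<open>Test functions must be periodic, so the closed set is transported to the
      circle. Cutoffs of the distance to its compact image decrease to the indicator of that
      image.\<close>
    define C where "C = cis ` (A \<inter> {0..2*pi})"
    have "compact C" unfolding C_def
      by (intro compact_continuous_image continuous_on_cis continuous_on_id closed_Int_compact A) auto
    then have C: "closed C" by (rule compact_imp_closed)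
    show ?thesis
    proof (cases "C = {}")
      case True
      then have "indicator A x *\<^sub>R h x = 0" for x by (auto simp: C_def h_def indicator_def)
      then show ?thesis unfolding set_lebesgue_integral_def by (simp only: integral_zero)
    next
      case ne: False
      define g where "g n z = max 0 (1 - real n * infdist z C)" for n z
      have gc: "continuous_on UNIV (g n)" for n
        unfolding g_def by (intro continuous_intros)
      have [measurable]: "(\<lambda>x. g n (cis x)) \<in> borel_measurable borel" for n
        by (intro borel_measurable_continuous_onI continuous_on_compose2[OF gc]
            continuous_on_cis continuous_on_id) auto
      \<comment> \<open>If only one endpoint of the period lies in \<open>A\<close>, the limit is
        wrong at the other, so both are discarded as a null set.\<close>
      have null: "AE x in lborel. x \<noteq> 0 \<and> x \<noteq> 2 * pi"
        using AE_lborel_singleton[of 0] AE_lborel_singleton[of "2 * pi"] by eventually_elim auto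
      have [measurable]: "A \<in> sets borel" using A by auto
      have "(\<lambda>n. \<integral>x. of_real (g n (cis x)) * h x \<partial>lborel) \<longlonglongrightarrow> (\<integral>x. indicator A x *\<^sub>R h x \<partial>lborel)"
      proof (rule integral_dominated_convergence[where w = "\<lambda>x. cmod (h x)"])
        show "integrable lborel (\<lambda>x. cmod (h x))" using h by simp
        show "AE x in lborel. cmod (of_real (g n (cis x)) * h x) \<le> cmod (h x)" for n
        proof (intro AE_I2)
          fix x
          have "\<bar>g n (cis x)\<bar> \<le> 1" by (simp add: g_def infdist_nonneg)
          then show "cmod (of_real (g n (cis x)) * h x) \<le> cmod (h x)"
            by (simp add: norm_mult mult_left_le_one_le)
        qed
        show "AE x in lborel. (\<lambda>n. of_real (g n (cis x)) * h x) \<longlonglongrightarrow> indicator A x *\<^sub>R h x"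
          using null
        proof eventually_elim
          case (elim x)
          show ?case
          proof (cases "x \<in> {0..2*pi}")
            case False
            then show ?thesis by (simp add: h_def)
          next
            case x: True
            have "(\<lambda>n. g n (cis x)) \<longlonglongrightarrow> indicator A x"
            proof (cases "x \<in> A")
              case True
              then have "cis x \<in> C" using x by (auto simp: C_def)
              then have "g n (cis x) = 1" for n by (simp add: g_def)
              then show ?thesis using True by simp
            next
              case False
              have "cis x \<notin> C"
              proof
                assume "cis x \<in> C"
                then obtain y where "y \<in> A" "0 \<le> y" "y \<le> 2 * pi" "cis x = cis y" by (auto simp: C_def)
                with cis_inj_on_open_interval[of x y] elim x False show False by auto
              qed
              then have d: "0 < infdist (cis x) C"
                using C ne by (metis in_closed_iff_infdist_zero infdist_nonneg less_le)
              have "eventually (\<lambda>n. g n (cis x) = 0) sequentially"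
              proof -
                obtain n0 where n0: "1 / infdist (cis x) C < real n0" using reals_Archimedean2 by blast
                show ?thesis
                  using eventually_ge_at_top[of n0]
                proof eventually_elim
                  case (elim n)
                  then have "1 / infdist (cis x) C < real n" using n0 by (meson less_le_trans of_nat_le_iff)
                  then have "1 < real n * infdist (cis x) C" using d by (simp add: field_simps)
                  then show ?case by (simp add: g_def)
                qed
              qed
              then show ?thesis using False by (simp add: tendsto_eventually)
            qed
            then have "(\<lambda>n. g n (cis x) *\<^sub>R h x) \<longlonglongrightarrow> indicator A x *\<^sub>R h x"
              by (intro tendsto_scaleR tendsto_const)
            then show ?thesis by (simp add: scaleR_conv_of_real)
          qed
        qed
      qed auto
      moreover have "(\<integral>x. of_real (g n (cis x)) * h x \<partial>lborel) = 0" for n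
        unfolding h_def using integral_continuous_on_circle_eq_0[OF f fc gc] .
      ultimately show ?thesis
        by (simp add: set_lebesgue_integral_def LIMSEQ_const_iff)
    qed
  qed
  have hA: "set_integrable lborel A h" if "A \<in> sets borel" for A
    unfolding set_integrable_def using that h by (intro integrable_mult_indicator) auto
  have all_0: "set_lebesgue_integral lborel A h = 0" if "A \<in> sets borel" for A
  proof -
    have "Int_stable (Collect (closed :: real set \<Rightarrow> bool))" by (auto simp: Int_stable_def)
    moreover have "Collect (closed :: real set \<Rightarrow> bool) \<subseteq> Pow UNIV" by simp
    moreover have "A \<in> sigma_sets UNIV (Collect closed)"
      using that by (simp add: borel_eq_closed)
    ultimately show ?thesis
    proof (induction rule: sigma_sets_induct_disjoint)
      case (basic A)
      then show ?case by (simp add: closed_0)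
    next
      case empty
      show ?case by (simp add: set_lebesgue_integral_def)
    next
      case (compl A)
      then have A: "A \<in> sets borel" by (simp add: borel_eq_closed)
      have "set_lebesgue_integral lborel (A \<union> (UNIV - A)) h
          = set_lebesgue_integral lborel A h + set_lebesgue_integral lborel (UNIV - A) h"
        by (intro set_integral_Un hA) (use A in auto)
      then show ?case using compl closed_0[of UNIV] by (simp add: Un_Diff_cancel)
    next
      case (union A)
      then have A: "A i \<in> sets borel" for i by (auto simp: borel_eq_closed)
      have "set_lebesgue_integral lborel (\<Union>i. A i) h = (\<Sum>i. set_lebesgue_integral lborel (A i) h)"
        using union(1) A by (intro lebesgue_integral_countable_add hA) (auto simp: disjoint_family_on_def)
      then show ?case using union by simp
    qed
  qed
  have "AE x in lborel. h x = 0"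
    by (rule sigma_finite_measure.density_zero[OF sigma_finite_lborel h]) (simp add: all_0)
  then show ?thesis
    by eventually_elim (auto simp: h_def indicator_def)
qed

lemma L2fun_set_integrable:
  assumes "L2fun f"
  shows "set_integrable lborel {0..2*pi} f"
proof -
  have [measurable]: "f \<in> borel_measurable borel" using assms by (simp add: L2fun_def)
  have "set_integrable lborel {0..2*pi} (\<lambda>x. (cmod (f x))\<^sup>2)" using assms by (simp add: L2fun_def)
  moreover have "set_integrable lborel {0..2*pi} (\<lambda>x. 1 :: real)"
    unfolding set_integrable_def by simp
  ultimately have i: "set_integrable lborel {0..2*pi} (\<lambda>x. 1 + (cmod (f x))\<^sup>2)"
    by (intro set_integral_add)
  have "cmod z \<le> 1 + (cmod z)\<^sup>2" for z
  proof -
    have "0 \<le> (cmod z - 1)\<^sup>2" by simp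
    then show ?thesis by (simp add: power2_diff) (smt (verit) norm_ge_zero zero_le_power2)
  qed
  then show ?thesis
    unfolding set_integrable_def
    by (intro Bochner_Integration.integrable_bound[OF i[unfolded set_integrable_def]])
       (auto simp: indicator_def)
qed

lemma set_integrable_mult_exp:
  assumes "set_integrable lborel {0..2*pi} f"
  shows "set_integrable lborel {0..2*pi} (\<lambda>x. f x * exp (- (\<i> * of_int m * of_real x)))"
proof -
  define h where "h x = indicator {0..2*pi} x *\<^sub>R f x" for x
  have h: "integrable lborel h" using assms by (simp add: set_integrable_def h_def[abs_def])
  then have [measurable]: "h \<in> borel_measurable borel" by auto
  have "integrable lborel (\<lambda>x. h x * exp (- (\<i> * of_int m * of_real x)))"
    by (rule Bochner_Integration.integrable_bound[OF h]) (auto simp: norm_mult)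
  then show ?thesis by (simp add: set_integrable_def h_def)
qed

lemma fc_diff:
  assumes "L2fun f" "L2fun g"
  shows "fc (\<lambda>x. f x - g x) m = fc f m - fc g m"
  unfolding fc_def
  by (simp add: left_diff_distrib right_diff_distrib set_integral_diff set_integrable_mult_exp L2fun_set_integrable assms)

text \<open>Coefficients determine a function up to null sets, which is the sense in which two
  solutions are finally identified.\<close>

lemma L2fun_fc_cong:
  assumes "L2fun f" "L2fun g" "\<And>m. fc f m = fc g m"
  shows "AE x in lborel. x \<in> {0..2*pi} \<longrightarrow> f x = g x"
proof -
  have "set_integrable lborel {0..2*pi} (\<lambda>x. f x - g x)"
    by (intro set_integral_diff L2fun_set_integrable assms)
  from Fourier_uniqueness[OF this] show ?thesis
    using assms by (simp add: fc_diff)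
qed

section \<open>The truncated equation in the interaction picture\<close>

text \<open>The symbol of the propagator exp(i b \<Delta>) at the mode \<open>m\<close>;
  \<open>rot\<close> is the propagator itself, acting on coefficients.\<close>

definition ph :: "real \<Rightarrow> int \<Rightarrow> complex" where
  "ph b m = exp (- (\<i> * of_real b * of_int (m\<^sup>2)))"

definition rot :: "real \<Rightarrow> (int \<Rightarrow> complex) \<Rightarrow> int \<Rightarrow> complex" where
  "rot b w m = ph b m * w m"

text \<open>The right-hand side of the equation for \<open>w = e\<^bsup>-i\<beta>\<Delta>\<^esup> u\<close>, in which the dispersion no longer appears
  as an unbounded term.\<close>

definition vf :: "real \<Rightarrow> real \<Rightarrow> (int \<Rightarrow> bool) \<Rightarrow> real \<Rightarrow> (int \<Rightarrow> complex) \<Rightarrow> int \<Rightarrow> complex" where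
  "vf lam r J b w m = (if J m then \<i> * of_real lam * (ph (- b) m * trunc_cubic r (rot b w) m) else 0)"

abbreviation duhamel ::
  "real \<Rightarrow> real \<Rightarrow> (int \<Rightarrow> bool) \<Rightarrow> (real \<Rightarrow> real) \<Rightarrow> (real \<Rightarrow> int \<Rightarrow> complex) \<Rightarrow> real \<Rightarrow> int \<Rightarrow> complex" where
  "duhamel lam r J \<beta> w t m \<equiv> set_lebesgue_integral lborel {0..t} (\<lambda>s. vf lam r J (\<beta> s) (w s) m)"

lemma cmod_ph [simp]: "cmod (ph b m) = 1"
  using norm_exp_i_times[of "- b * of_int (m\<^sup>2)"] by (simp add: ph_def mult.assoc)

lemma ph_add: "ph (b + c) m = ph b m * ph c m"
  unfolding ph_def by (simp add: distrib_left distrib_right flip: exp_add)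

lemma ph_0 [simp]: "ph 0 m = 1"
  by (simp add: ph_def)

lemma ph_minus_mult [simp]: "ph (- b) m * ph b m = 1" "ph b m * ph (- b) m = 1"
  by (simp_all flip: ph_add)

lemma cnj_ph: "cnj (ph b m) = ph (- b) m"
  by (simp add: ph_def exp_cnj)

lemma cmod_rot [simp]: "cmod (rot b w m) = cmod (w m)"
  by (simp add: rot_def norm_mult)

lemma l1n_rot [simp]: "l1n (rot b w) = l1n w"
  by (simp add: l1n_def)

lemma nrm_rot [simp]: "nrm (rot b w) = nrm w"
  by (simp add: nrm_def)

lemma wl2_rot [simp]: "wl2 s (rot b w) = wl2 s w"
  by (simp add: wl2_def)

lemma integrable_rot [simp]: "integrable CZ (rot b w) \<longleftrightarrow> integrable CZ w"
  by (simp flip: l1n_finite_iff)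

lemma cmod_vf_le: "cmod (vf lam r J b w m) \<le> cmod (of_real lam * trunc_cubic r (rot b w) m)"
  by (simp add: vf_def norm_mult)

text \<open>The bound does not involve \<open>w\<close>: the truncation caps the nonlinearity
  itself, which starts the Picard estimate without any knowledge of the solution.\<close>

lemma l1n_vf:
  assumes "integrable CZ w" "0 < r"
  shows "l1n (vf lam r J b w) \<le> ennreal (\<bar>lam\<bar> * r ^ 3)"
proof -
  have "l1n (vf lam r J b w) \<le> ennreal \<bar>lam\<bar> * l1n (trunc_cubic r (rot b w))"
    using l1n_mono[of "vf lam r J b w" "\<lambda>m. of_real lam * trunc_cubic r (rot b w) m", OF cmod_vf_le] by (simp add: l1n_cmult)
  also have "\<dots> \<le> ennreal \<bar>lam\<bar> * ennreal (r ^ 3)"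
    using assms by (intro mult_left_mono l1n_trunc_cubic) auto
  finally show ?thesis using assms by (simp add: ennreal_mult)
qed

lemma integrable_vf [simp]: "integrable CZ w \<Longrightarrow> 0 < r \<Longrightarrow> integrable CZ (vf lam r J b w)"
  using l1n_vf[of w r lam J b] by (simp add: le_less_trans flip: l1n_finite_iff)

lemma cmod_vf_bound:
  assumes "integrable CZ w" "0 < r"
  shows "cmod (vf lam r J b w m) \<le> \<bar>lam\<bar> * r ^ 3"
proof -
  have "ennreal (cmod (vf lam r J b w m)) \<le> ennreal (\<bar>lam\<bar> * r ^ 3)"
    using cmod_le_l1n l1n_vf[OF assms] by (rule order_trans)
  then show ?thesis using assms by simp
qed

lemma l1n_vf_diff:
  assumes "integrable CZ w" "integrable CZ w'" "0 < r"
  shows "l1n (\<lambda>m. vf lam r J b w m - vf lam r J b w' m) \<le> ennreal (\<bar>lam\<bar> * (6 * r\<^sup>2)) * l1n (\<lambda>m. w m - w' m)"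
proof -
  have "vf lam r J b w m - vf lam r J b w' m =
     (if J m then \<i> * of_real lam * (ph (- b) m * (trunc_cubic r (rot b w) m - trunc_cubic r (rot b w') m)) else 0)" for m
    by (simp add: vf_def algebra_simps)
  then have "l1n (\<lambda>m. vf lam r J b w m - vf lam r J b w' m)
     \<le> l1n (\<lambda>m. of_real lam * (trunc_cubic r (rot b w) m - trunc_cubic r (rot b w') m))"
    by (intro l1n_mono) (simp add: norm_mult)
  also have "\<dots> = ennreal \<bar>lam\<bar> * l1n (\<lambda>m. trunc_cubic r (rot b w) m - trunc_cubic r (rot b w') m)"
    by (simp add: l1n_cmult)
  also have "\<dots> \<le> ennreal \<bar>lam\<bar> * (ennreal (6 * r\<^sup>2) * l1n (\<lambda>m. rot b w m - rot b w' m))"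
    using assms by (intro mult_left_mono l1n_trunc_cubic_diff) auto
  also have "(\<lambda>m. rot b w m - rot b w' m) = rot b (\<lambda>m. w m - w' m)"
    by (auto simp: rot_def right_diff_distrib)
  finally show ?thesis using assms by (simp add: ennreal_mult mult.assoc)
qed

lemma wl2_cmult: "wl2 s (\<lambda>m. c * a m) = ennreal ((cmod c)\<^sup>2) * wl2 s a"
  unfolding wl2_def
  by (simp add: norm_mult power_mult_distrib ennreal_mult mult_ac flip: nn_integral_cmult)

lemma wl2_vf:
  assumes "integrable CZ w" "0 < r"
  shows "wl2 s (vf lam r J b w) \<le> ennreal (lam\<^sup>2 * (wl2_tri_const s * r ^ 4)) * wl2 s w"
proof -
  have "wl2 s (vf lam r J b w) \<le> ennreal (lam\<^sup>2) * wl2 s (trunc_cubic r (rot b w))"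
    using wl2_mono[of "vf lam r J b w" "\<lambda>m. of_real lam * trunc_cubic r (rot b w) m", OF cmod_vf_le] by (simp add: wl2_cmult)
  also have "\<dots> \<le> ennreal (lam\<^sup>2) * (ennreal (wl2_tri_const s * r ^ 4) * wl2 s (rot b w))"
    using assms by (intro mult_left_mono wl2_trunc_cubic) auto
  finally show ?thesis using assms by (simp add: ennreal_mult wl2_tri_const_def mult.assoc)
qed

section \<open>Measurable dependence of the nonlinearity on parameters\<close>

lemma measurable_pair_CZ:
  assumes "\<And>m. (\<lambda>x. w x m) \<in> measurable N K"
  shows "(\<lambda>(x, m). w x m) \<in> measurable (N \<Otimes>\<^sub>M CZ) K"
proof -
  have "(\<lambda>p. w (fst p) (snd p)) \<in> measurable (N \<Otimes>\<^sub>M CZ) K"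
  proof (rule measurable_compose_countable[where f = "\<lambda>m p. w (fst p) m" and g = snd])
    show "(\<lambda>p. w (fst p) m) \<in> measurable (N \<Otimes>\<^sub>M CZ) K" for m
      by (rule measurable_compose[OF measurable_fst assms])
  qed (rule measurable_snd)
  then show ?thesis by (simp add: split_beta')
qed

lemma measurable_nrm:
  assumes "\<And>m. (\<lambda>x. w x m) \<in> borel_measurable N"
  shows "(\<lambda>x. nrm (w x)) \<in> borel_measurable N"
  unfolding nrm_def l1n_def
  using assms
  by (intro borel_measurable_enn2real sigma_finite_measure.borel_measurable_nn_integral
      sigma_finite_measure_count_space measurable_pair_CZ) auto

lemma measurable_conv:
  assumes "\<And>m. (\<lambda>x. v x m) \<in> borel_measurable N" "\<And>m. (\<lambda>x. w x m) \<in> borel_measurable N"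
  shows "(\<lambda>x. conv (v x) (w x) m) \<in> borel_measurable N"
  unfolding conv_def
  using assms
  by (intro sigma_finite_measure.borel_measurable_lebesgue_integral
      sigma_finite_measure_count_space measurable_pair_CZ) auto

lemma measurable_cnj: "f \<in> borel_measurable N \<Longrightarrow> (\<lambda>x. cnj (f x)) \<in> borel_measurable N"
  by (rule measurable_compose[of f N borel cnj]) (auto intro!: borel_measurable_continuous_onI continuous_intros)

lemma measurable_tri:
  assumes "\<And>m. (\<lambda>x. w x m) \<in> borel_measurable N"
  shows "(\<lambda>x. cube (w x) m) \<in> borel_measurable N"
  unfolding tri_def star_def[abs_def] using assms by (intro measurable_conv measurable_cnj)

lemma measurable_trunc_cubic:
  assumes [measurable]: "\<And>m. (\<lambda>x. w x m) \<in> borel_measurable N"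
  shows "(\<lambda>x. trunc_cubic r (w x) m) \<in> borel_measurable N"
  unfolding trunc_cubic_eq
  using measurable_tri[of w N, OF assms] measurable_nrm[of w N, OF assms] by measurable

lemma measurable_ph [measurable]: "(\<lambda>x. ph x m) \<in> borel_measurable borel"
  unfolding ph_def by (intro borel_measurable_continuous_onI continuous_intros)

lemma measurable_vf:
  assumes [measurable]: "\<And>m. (\<lambda>x. w x m) \<in> borel_measurable N" "b \<in> borel_measurable N"
  shows "(\<lambda>x. vf lam r J (b x) (w x) m) \<in> borel_measurable N"
proof -
  have [measurable]: "(\<lambda>x. ph (b x) m) \<in> borel_measurable N" "(\<lambda>x. ph (- b x) m) \<in> borel_measurable N" for m
    by (rule measurable_compose[OF _ measurable_ph], measurable)+
  have [measurable]: "(\<lambda>x. trunc_cubic r (rot (b x) (w x)) m) \<in> borel_measurable N"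
    by (rule measurable_trunc_cubic) (simp add: rot_def)
  show ?thesis unfolding vf_def by simp
qed

section \<open>Norms of time integrals and integral inequalities\<close>

lemma nn_integral_swap_CZ:
  assumes "sigma_finite_measure M" "\<And>m. (\<lambda>x. f x m) \<in> borel_measurable M"
  shows "(\<integral>\<^sup>+m. \<integral>\<^sup>+x. f x m \<partial>M \<partial>CZ) = (\<integral>\<^sup>+x. \<integral>\<^sup>+m. f x m \<partial>CZ \<partial>M)"
proof -
  interpret M: sigma_finite_measure M by fact
  interpret C: sigma_finite_measure CZ by (rule sigma_finite_measure_count_space)
  interpret pair_sigma_finite M CZ ..
  show ?thesis
    using Fubini'[of f] measurable_pair_CZ[of f, OF assms(2)] by simp
qed

lemma cmod_set_integral_le:
  fixes f :: "real \<Rightarrow> complex"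
  shows "ennreal (cmod (set_lebesgue_integral lborel A f)) \<le> (\<integral>\<^sup>+s. ennreal (cmod (f s)) * indicator A s \<partial>lborel)"
proof (cases "set_integrable lborel A f")
  case True
  then have "ennreal (cmod (set_lebesgue_integral lborel A f)) \<le> (\<integral>\<^sup>+s. ennreal (cmod (indicator A s *\<^sub>R f s)) \<partial>lborel)"
    unfolding set_lebesgue_integral_def set_integrable_def by (rule integral_norm_bound_ennreal)
  also have "\<dots> = (\<integral>\<^sup>+s. ennreal (cmod (f s)) * indicator A s \<partial>lborel)"
    by (intro nn_integral_cong) (simp add: indicator_def)
  finally show ?thesis .
next
  case False
  then show ?thesis by (simp add: set_lebesgue_integral_def set_integrable_def not_integrable_integral_eq)
qed

lemma l1n_set_integral_le:
  fixes F :: "real \<Rightarrow> int \<Rightarrow> complex"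
  assumes [measurable]: "\<And>m. (\<lambda>s. F s m) \<in> borel_measurable borel"
  shows "l1n (\<lambda>m. set_lebesgue_integral lborel {0..t} (\<lambda>s. F s m)) \<le> (\<integral>\<^sup>+s. l1n (F s) * indicator {0..t} s \<partial>lborel)"
proof -
  have "l1n (\<lambda>m. set_lebesgue_integral lborel {0..t} (\<lambda>s. F s m))
     \<le> (\<integral>\<^sup>+m. \<integral>\<^sup>+s. ennreal (cmod (F s m)) * indicator {0..t} s \<partial>lborel \<partial>CZ)"
    unfolding l1n_def by (intro nn_integral_mono cmod_set_integral_le)
  also have "\<dots> = (\<integral>\<^sup>+s. \<integral>\<^sup>+m. ennreal (cmod (F s m)) * indicator {0..t} s \<partial>CZ \<partial>lborel)"
    by (intro nn_integral_swap_CZ sigma_finite_lborel) simp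
  finally show ?thesis by (simp add: l1n_def nn_integral_multc)
qed

text \<open>Cauchy-Schwarz in time, mode by mode, trades the square of the integral for
  \<open>t\<close> times the integral of the square; the sum over modes passes inside by
  Tonelli.\<close>

lemma wl2_set_integral_le:
  fixes F :: "real \<Rightarrow> int \<Rightarrow> complex"
  assumes [measurable]: "\<And>m. (\<lambda>s. F s m) \<in> borel_measurable borel" and t: "0 \<le> t"
  shows "wl2 k (\<lambda>m. set_lebesgue_integral lborel {0..t} (\<lambda>s. F s m))
    \<le> ennreal t * (\<integral>\<^sup>+s. wl2 k (F s) * indicator {0..t} s \<partial>lborel)"
proof -
  define c where "c m = real_of_int \<bar>m\<bar> ^ (2 * k)" for m
  have c: "0 \<le> c m" for m by (simp add: c_def)
  have 1: "ennreal ((cmod (set_lebesgue_integral lborel {0..t} (\<lambda>s. F s m)))\<^sup>2)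
     \<le> ennreal t * (\<integral>\<^sup>+s. ennreal ((cmod (F s m))\<^sup>2) * indicator {0..t} s \<partial>lborel)" for m
  proof -
    have "ennreal ((cmod (set_lebesgue_integral lborel {0..t} (\<lambda>s. F s m)))\<^sup>2)
       \<le> (\<integral>\<^sup>+s. ennreal (cmod (F s m)) * indicator {0..t} s \<partial>lborel)\<^sup>2"
      using power_mono[OF cmod_set_integral_le[of "{0..t}" "\<lambda>s. F s m"], where n = 2] by (simp add: ennreal_power)
    also have "\<dots> = (\<integral>\<^sup>+s. indicator {0..t} s * (ennreal (cmod (F s m)) * indicator {0..t} s) \<partial>lborel)\<^sup>2"
      by (intro arg_cong[of _ _ "\<lambda>x. x\<^sup>2"] nn_integral_cong) (simp add: indicator_def)
    also have "\<dots> \<le> (\<integral>\<^sup>+s. (indicator {0..t} s)\<^sup>2 \<partial>lborel) * (\<integral>\<^sup>+s. (ennreal (cmod (F s m)) * indicator {0..t} s)\<^sup>2 \<partial>lborel)"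
      by (rule Cauchy_Schwarz_nn_integral) auto
    also have "(\<integral>\<^sup>+s. (indicator {0..t} s)\<^sup>2 \<partial>lborel) = (\<integral>\<^sup>+s. indicator {0..t} s \<partial>lborel)"
      by (intro nn_integral_cong) (simp add: indicator_def)
    also have "\<dots> = ennreal t" using t by simp
    also have "(\<integral>\<^sup>+s. (ennreal (cmod (F s m)) * indicator {0..t} s)\<^sup>2 \<partial>lborel) = (\<integral>\<^sup>+s. ennreal ((cmod (F s m))\<^sup>2) * indicator {0..t} s \<partial>lborel)"
      by (intro nn_integral_cong) (simp add: indicator_def ennreal_power)
    finally show ?thesis .
  qed
  have "wl2 k (\<lambda>m. set_lebesgue_integral lborel {0..t} (\<lambda>s. F s m))
     \<le> (\<integral>\<^sup>+m. ennreal (c m) * (ennreal t * (\<integral>\<^sup>+s. ennreal ((cmod (F s m))\<^sup>2) * indicator {0..t} s \<partial>lborel)) \<partial>CZ)"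
    unfolding wl2_def c_def[symmetric] ennreal_mult[OF c zero_le_power2]
    by (intro nn_integral_mono mult_left_mono 1) auto
  also have "\<dots> = ennreal t * (\<integral>\<^sup>+m. (\<integral>\<^sup>+s. ennreal (c m * (cmod (F s m))\<^sup>2) * indicator {0..t} s \<partial>lborel) \<partial>CZ)"
    by (simp add: c ennreal_mult mult_ac flip: nn_integral_cmult)
  also have "(\<integral>\<^sup>+m. (\<integral>\<^sup>+s. ennreal (c m * (cmod (F s m))\<^sup>2) * indicator {0..t} s \<partial>lborel) \<partial>CZ)
     = (\<integral>\<^sup>+s. (\<integral>\<^sup>+m. ennreal (c m * (cmod (F s m))\<^sup>2) * indicator {0..t} s \<partial>CZ) \<partial>lborel)"
    by (intro nn_integral_swap_CZ sigma_finite_lborel) simp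
  also have "\<dots> = (\<integral>\<^sup>+s. wl2 k (F s) * indicator {0..t} s \<partial>lborel)"
    by (simp add: wl2_def c_def nn_integral_multc)
  finally show ?thesis .
qed

lemma nn_integral_exp:
  assumes "0 \<le> K" "0 \<le> A" "0 \<le> t"
  shows "ennreal K * (\<integral>\<^sup>+s. ennreal (A * exp (K * s)) * indicator {0..t} s \<partial>lborel) = ennreal (A * exp (K * t) - A)"
proof -
  have "ennreal K * (\<integral>\<^sup>+s. ennreal (A * exp (K * s)) * indicator {0..t} s \<partial>lborel)
     = (\<integral>\<^sup>+s. ennreal (K * (A * exp (K * s))) * indicator {0..t} s \<partial>lborel)"
    using assms by (subst nn_integral_cmult[symmetric]) (auto simp: ennreal_mult mult.assoc)
  also have "\<dots> = ennreal (A * exp (K * t) - A * exp (K * 0))"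
    using assms by (intro nn_integral_FTC_Icc) (auto intro!: derivative_eq_intros)
  finally show ?thesis by simp
qed

text \<open>In the norm weighted by \<open>exp (- 2 * L * t)\<close> integration with the factor
  \<open>L\<close> halves distances, whatever the length of the interval. This gives a geometric
  rate in place of factorials. The sequence may be constant, and in that case the bound yields
  uniqueness.\<close>

lemma iterated_integral_bound:
  fixes d :: "nat \<Rightarrow> real \<Rightarrow> ennreal"
  assumes L: "0 \<le> L" "0 \<le> C"
    and d0: "\<And>t. t \<in> {0..T} \<Longrightarrow> d 0 t \<le> ennreal C"
    and d: "\<And>n t. t \<in> {0..T} \<Longrightarrow> d (Suc n) t \<le> ennreal L * (\<integral>\<^sup>+s. d n s * indicator {0..t} s \<partial>lborel)"
    and t: "t \<in> {0..T}"
  shows "d n t \<le> ennreal (C * (1/2) ^ n * exp (2 * L * t))"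
  using t
proof (induction n arbitrary: t)
  case 0
  have "C * 1 \<le> C * exp (2 * L * t)" using 0 L by (intro mult_left_mono) auto
  then show ?case using d0[OF 0] by (simp add: ennreal_leI order_trans)
next
  case (Suc n)
  let ?A = "C * (1/2) ^ n"
  have "d (Suc n) t \<le> ennreal L * (\<integral>\<^sup>+s. d n s * indicator {0..t} s \<partial>lborel)"
    using Suc by (intro d) auto
  also have "\<dots> \<le> ennreal L * (\<integral>\<^sup>+s. ennreal (?A * exp (2 * L * s)) * indicator {0..t} s \<partial>lborel)"
    using Suc by (intro mult_left_mono nn_integral_mono) (auto simp: indicator_def)
  \<comment> \<open>Writing \<open>L\<close> as half of \<open>2 * L\<close> makes the integrand an
    exact derivative and produces the factor 1/2.\<close>
  also have "\<dots> = ennreal (2 * L) * (\<integral>\<^sup>+s. ennreal (?A / 2 * exp (2 * L * s)) * indicator {0..t} s \<partial>lborel)"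
  proof -
    have "ennreal (?A * exp (2 * L * s)) * indicator {0..t} s = 2 * (ennreal (?A / 2 * exp (2 * L * s)) * indicator {0..t} s)" for s
      using L by (auto simp: indicator_def ennreal_mult'[symmetric] simp flip: ennreal_numeral)
    then show ?thesis using L
      by (simp only:) (subst nn_integral_cmult, auto simp: ennreal_mult' mult_ac)
  qed
  also have "\<dots> = ennreal (?A / 2 * exp (2 * L * t) - ?A / 2)"
    using L Suc by (intro nn_integral_exp) auto
  also have "\<dots> \<le> ennreal (C * (1/2) ^ Suc n * exp (2 * L * t))"
    using L by (intro ennreal_leI) simp
  finally show ?case .
qed

text \<open>Gronwall's inequality along an iteration: \<open>A * exp (K * t)\<close> solves the
  limiting integral equation exactly, so it persists as an upper bound.\<close>

lemma iterated_integral_source_bound: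
  fixes h :: "nat \<Rightarrow> real \<Rightarrow> ennreal"
  assumes K: "0 \<le> K" "0 \<le> A"
    and h0: "\<And>t. t \<in> {0..T} \<Longrightarrow> h 0 t \<le> ennreal A"
    and h: "\<And>n t. t \<in> {0..T} \<Longrightarrow> h (Suc n) t \<le> ennreal A + ennreal K * (\<integral>\<^sup>+s. h n s * indicator {0..t} s \<partial>lborel)"
    and t: "t \<in> {0..T}"
  shows "h n t \<le> ennreal (A * exp (K * t))"
  using t
proof (induction n arbitrary: t)
  case 0
  have "A * 1 \<le> A * exp (K * t)" using 0 K by (intro mult_left_mono) auto
  then show ?case using h0[OF 0] by (simp add: ennreal_leI order_trans)
next
  case (Suc n)
  have "h (Suc n) t \<le> ennreal A + ennreal K * (\<integral>\<^sup>+s. h n s * indicator {0..t} s \<partial>lborel)"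
    using Suc by (intro h) auto
  also have "\<dots> \<le> ennreal A + ennreal K * (\<integral>\<^sup>+s. ennreal (A * exp (K * s)) * indicator {0..t} s \<partial>lborel)"
    using Suc by (intro add_left_mono mult_left_mono nn_integral_mono) (auto simp: indicator_def)
  also have "\<dots> = ennreal A + ennreal (A * exp (K * t) - A)"
    using K Suc by (subst nn_integral_exp) auto
  also have "\<dots> = ennreal (A * exp (K * t))"
    using K Suc mult_left_mono[of 1 "exp (K * t)" A] by (subst ennreal_plus[symmetric]) auto
  finally show ?case .
qed

section \<open>Picard iteration\<close>

lemma nn_integral_CZ_Fatou:
  assumes "\<And>m. (\<lambda>n. f n m) \<longlonglongrightarrow> F m" "\<And>n. (\<integral>\<^sup>+m. ennreal (f n m) \<partial>CZ) \<le> B"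
  shows "(\<integral>\<^sup>+m. ennreal (F m) \<partial>CZ) \<le> B"
proof -
  have "(\<integral>\<^sup>+m. ennreal (F m) \<partial>CZ) = (\<integral>\<^sup>+m. liminf (\<lambda>n. ennreal (f n m)) \<partial>CZ)"
  proof (intro nn_integral_cong)
    fix m
    have "(\<lambda>n. ennreal (f n m)) \<longlonglongrightarrow> ennreal (F m)" by (intro tendsto_ennrealI assms)
    then show "ennreal (F m) = liminf (\<lambda>n. ennreal (f n m))"
      by (simp add: lim_imp_Liminf)
  qed
  also have "\<dots> \<le> liminf (\<lambda>n. \<integral>\<^sup>+m. ennreal (f n m) \<partial>CZ)"
    by (rule nn_integral_liminf) auto
  also have "\<dots> \<le> B"
    using assms(2) by (intro Liminf_le) auto
  finally show ?thesis .
qed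

lemma l1n_Fatou:
  assumes "\<And>m. (\<lambda>n. a n m) \<longlonglongrightarrow> b m" "\<And>n. l1n (a n) \<le> B"
  shows "l1n b \<le> B"
  unfolding l1n_def
proof (rule nn_integral_CZ_Fatou)
  show "(\<lambda>n. cmod (a n m)) \<longlonglongrightarrow> cmod (b m)" for m by (intro tendsto_norm assms)
  show "(\<integral>\<^sup>+m. ennreal (cmod (a n m)) \<partial>CZ) \<le> B" for n using assms(2) by (simp add: l1n_def)
qed

lemma wl2_Fatou:
  assumes "\<And>m. (\<lambda>n. a n m) \<longlonglongrightarrow> b m" "\<And>n. wl2 s (a n) \<le> B"
  shows "wl2 s b \<le> B"
  unfolding wl2_def
proof (rule nn_integral_CZ_Fatou)
  show "(\<lambda>n. real_of_int \<bar>m\<bar> ^ (2 * s) * (cmod (a n m))\<^sup>2) \<longlonglongrightarrow> real_of_int \<bar>m\<bar> ^ (2 * s) * (cmod (b m))\<^sup>2" for m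
    by (intro tendsto_intros assms)
  show "(\<integral>\<^sup>+m. ennreal (real_of_int \<bar>m\<bar> ^ (2 * s) * (cmod (a n m))\<^sup>2) \<partial>CZ) \<le> B" for n
    using assms(2) by (simp add: wl2_def)
qed

lemma wl2_add: "wl2 s (\<lambda>m. a m + b m) \<le> 2 * wl2 s a + 2 * wl2 s b"
proof -
  have "wl2 s (\<lambda>m. a m + b m) \<le> (\<integral>\<^sup>+m. 2 * ennreal (real_of_int \<bar>m\<bar> ^ (2 * s) * (cmod (a m))\<^sup>2)
      + 2 * ennreal (real_of_int \<bar>m\<bar> ^ (2 * s) * (cmod (b m))\<^sup>2) \<partial>CZ)"
    unfolding wl2_def
  proof (intro nn_integral_mono)
    fix m
    have "(cmod (a m + b m))\<^sup>2 \<le> (cmod (a m) + cmod (b m))\<^sup>2"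
      by (intro power_mono norm_triangle_ineq) auto
    also have "\<dots> \<le> 2 * (cmod (a m))\<^sup>2 + 2 * (cmod (b m))\<^sup>2"
      using sum_squares_bound[of "cmod (a m)" "cmod (b m)"] by (simp add: power2_sum)
    finally have "real_of_int \<bar>m\<bar> ^ (2 * s) * (cmod (a m + b m))\<^sup>2
        \<le> real_of_int \<bar>m\<bar> ^ (2 * s) * (2 * (cmod (a m))\<^sup>2 + 2 * (cmod (b m))\<^sup>2)"
      by (intro mult_left_mono) auto
    then have "real_of_int \<bar>m\<bar> ^ (2 * s) * (cmod (a m + b m))\<^sup>2
        \<le> 2 * (real_of_int \<bar>m\<bar> ^ (2 * s) * (cmod (a m))\<^sup>2) + 2 * (real_of_int \<bar>m\<bar> ^ (2 * s) * (cmod (b m))\<^sup>2)"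
      by (simp add: algebra_simps)
    then show "ennreal (real_of_int \<bar>m\<bar> ^ (2 * s) * (cmod (a m + b m))\<^sup>2)
       \<le> 2 * ennreal (real_of_int \<bar>m\<bar> ^ (2 * s) * (cmod (a m))\<^sup>2) + 2 * ennreal (real_of_int \<bar>m\<bar> ^ (2 * s) * (cmod (b m))\<^sup>2)"
      by (subst (1 2) ennreal_numeral[symmetric], subst (1 2) ennreal_mult[symmetric],
          auto simp del: ennreal_numeral simp flip: ennreal_plus intro!: ennreal_leI)
  qed
  also have "\<dots> = 2 * wl2 s a + 2 * wl2 s b"
    by (simp add: wl2_def nn_integral_add nn_integral_cmult)
  finally show ?thesis .
qed

lemma nn_integral_const_Icc: "0 \<le> t \<Longrightarrow> (\<integral>\<^sup>+s. c * indicator {0..t::real} s \<partial>lborel) = c * ennreal t"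
  by (simp add: nn_integral_cmult_indicator)

text \<open>\<open>g\<close> holds the initial coefficients and \<open>J\<close> selects the
  retained modes. The driving path is an argument of the iteration and not a parameter here, because
  measurability in \<omega> concerns a whole family of paths.\<close>

locale truncated_equation =
  fixes lam r T :: real and J :: "int \<Rightarrow> bool" and g :: "int \<Rightarrow> complex"
  assumes r: "0 < r" and T: "0 \<le> T" and g: "integrable CZ g"
begin

primrec pic :: "(real \<Rightarrow> real) \<Rightarrow> nat \<Rightarrow> real \<Rightarrow> int \<Rightarrow> complex" where
  "pic \<beta> 0 t m = g m"
| "pic \<beta> (Suc n) t m = g m + duhamel lam r J \<beta> (pic \<beta> n) t m"

text \<open>A pointwise \<open>lim\<close> of measurable iterates is measurable before any
  convergence is known. Convergence is established on \<open>[0, T]\<close>.\<close>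

definition sol :: "(real \<Rightarrow> real) \<Rightarrow> real \<Rightarrow> int \<Rightarrow> complex" where
  "sol \<beta> t m = lim (\<lambda>n. pic \<beta> n t m)"

text \<open>The Duhamel integral is measurable in \<omega> only if its integrand is jointly
  measurable in time and \<omega>, so the induction has to carry the pair. The variable upper limit
  enters as a jointly measurable indicator.\<close>

lemma measurable_pic_pair:
  assumes [measurable]: "(\<lambda>(t, \<omega>). \<beta> \<omega> t) \<in> borel_measurable (borel \<Otimes>\<^sub>M M)"
  shows "(\<lambda>(t, \<omega>). pic (\<beta> \<omega>) n t m) \<in> borel_measurable (borel \<Otimes>\<^sub>M M)"
proof (induction n arbitrary: m)
  case 0
  show ?case by simp
next
  case (Suc n)
  let ?N = "(borel \<Otimes>\<^sub>M M) \<Otimes>\<^sub>M lborel :: ((real \<times> _) \<times> real) measure"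
  note Suc[measurable]
  have swap: "(\<lambda>y. (snd y, snd (fst y))) \<in> measurable ?N (borel \<Otimes>\<^sub>M M)" by measurable
  have vm: "(\<lambda>y. vf lam r J (\<beta> (snd (fst y)) (snd y)) (pic (\<beta> (snd (fst y))) n (snd y)) m) \<in> borel_measurable ?N"
  proof (rule measurable_vf)
    show "(\<lambda>y. pic (\<beta> (snd (fst y))) n (snd y) k) \<in> borel_measurable ?N" for k
      using measurable_compose[OF swap Suc[of k]] by simp
    show "(\<lambda>y. \<beta> (snd (fst y)) (snd y)) \<in> borel_measurable ?N"
      using measurable_compose[OF swap assms] by simp
  qed
  have im: "(\<lambda>y. indicat_real {0..fst (fst y)} (snd y)) \<in> borel_measurable ?N"
    unfolding indicator_def atLeastAtMost_iff by measurable
  have "(\<lambda>x. \<integral>s. indicator {0..fst x} s *\<^sub>R vf lam r J (\<beta> (snd x) s) (pic (\<beta> (snd x)) n s) m \<partial>lborel) \<in> borel_measurable (borel \<Otimes>\<^sub>M M)"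
    using borel_measurable_scaleR[OF im vm]
    by (intro sigma_finite_measure.borel_measurable_lebesgue_integral sigma_finite_lborel) (simp add: split_beta')
  then show ?case
    by (simp add: split_beta' set_lebesgue_integral_def)
qed

lemma measurable_sol_pair:
  assumes "(\<lambda>(t, \<omega>). \<beta> \<omega> t) \<in> borel_measurable (borel \<Otimes>\<^sub>M M)"
  shows "(\<lambda>(t, \<omega>). sol (\<beta> \<omega>) t m) \<in> borel_measurable (borel \<Otimes>\<^sub>M M)"
  using measurable_pic_pair[OF assms] unfolding sol_def split_beta'
  by (intro borel_measurable_lim_metric)

context
  fixes \<beta> :: "real \<Rightarrow> real"
  assumes \<beta> [measurable]: "\<beta> \<in> borel_measurable borel"
begin

text \<open>A deterministic path is treated as a family over a one-point space, which turns the
  joint statement into measurability in time alone.\<close>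

lemma measurable_const_pair: "(\<lambda>(t, \<omega>::unit). \<beta> t) \<in> borel_measurable (borel \<Otimes>\<^sub>M count_space UNIV)"
  by measurable

lemma measurable_pic [measurable]: "(\<lambda>t. pic \<beta> n t m) \<in> borel_measurable borel"
  using measurable_compose[of "\<lambda>t. (t, ())" borel "borel \<Otimes>\<^sub>M count_space UNIV", OF _ measurable_pic_pair[OF measurable_const_pair]]
  by simp

lemma measurable_sol [measurable]: "(\<lambda>t. sol \<beta> t m) \<in> borel_measurable borel"
  unfolding sol_def by (intro borel_measurable_lim_metric measurable_pic)

lemma measurable_vf_path:
  assumes "\<And>m. (\<lambda>t. w t m) \<in> borel_measurable borel"
  shows "(\<lambda>s. vf lam r J (\<beta> s) (w s) m) \<in> borel_measurable borel"
  using assms by (intro measurable_vf) auto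

lemma set_integrable_vf:
  assumes "\<And>m. (\<lambda>t. w t m) \<in> borel_measurable borel" "\<And>s. s \<in> {0..t} \<Longrightarrow> integrable CZ (w s)"
  shows "set_integrable lborel {0..t} (\<lambda>s. vf lam r J (\<beta> s) (w s) m)"
  unfolding set_integrable_def
proof (rule Bochner_Integration.integrable_bound)
  show "integrable lborel (\<lambda>s. indicator {0..t} s *\<^sub>R (\<bar>lam\<bar> * r ^ 3))"
    by (intro integrable_scaleR_left integrable_real_indicator) (auto simp: emeasure_lborel_Icc_eq)
  show "(\<lambda>s. indicator {0..t} s *\<^sub>R vf lam r J (\<beta> s) (w s) m) \<in> borel_measurable lborel"
    using measurable_vf_path[OF assms(1)] by measurable
  show "AE s in lborel. norm (indicator {0..t} s *\<^sub>R vf lam r J (\<beta> s) (w s) m) \<le> norm (indicat_real {0..t} s *\<^sub>R (\<bar>lam\<bar> * r ^ 3))"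
    using r cmod_vf_bound[OF assms(2) r] by (intro AE_I2) (simp add: indicator_def)
qed

lemma l1n_integral_vf:
  assumes "\<And>m. (\<lambda>t. w t m) \<in> borel_measurable borel" "\<And>s. s \<in> {0..t} \<Longrightarrow> integrable CZ (w s)" "t \<in> {0..T}"
  shows "l1n (\<lambda>m. duhamel lam r J \<beta> w t m) \<le> ennreal (\<bar>lam\<bar> * r ^ 3 * T)"
proof -
  have "l1n (\<lambda>m. duhamel lam r J \<beta> w t m)
      \<le> (\<integral>\<^sup>+s\<in>{0..t}. l1n (vf lam r J (\<beta> s) (w s)) \<partial>lborel)"
    by (intro l1n_set_integral_le measurable_vf_path assms)
  also have "\<dots> \<le> (\<integral>\<^sup>+s\<in>{0..t}. ennreal (\<bar>lam\<bar> * r ^ 3) \<partial>lborel)"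
    using l1n_vf[OF assms(2) r] by (intro nn_integral_mono) (simp add: indicator_def)
  also have "\<dots> = ennreal (\<bar>lam\<bar> * r ^ 3 * t)"
    using assms(3) r by (simp add: nn_integral_const_Icc ennreal_mult)
  also have "\<dots> \<le> ennreal (\<bar>lam\<bar> * r ^ 3 * T)"
    using assms(3) r by (intro ennreal_leI mult_left_mono) auto
  finally show ?thesis .
qed

lemma l1n_integral_vf_diff:
  assumes "\<And>m. (\<lambda>t. w t m) \<in> borel_measurable borel" "\<And>s. s \<in> {0..t} \<Longrightarrow> integrable CZ (w s)"
    and "\<And>m. (\<lambda>t. w' t m) \<in> borel_measurable borel" "\<And>s. s \<in> {0..t} \<Longrightarrow> integrable CZ (w' s)"
  shows "l1n (\<lambda>m. duhamel lam r J \<beta> w t m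
       - duhamel lam r J \<beta> w' t m)
    \<le> ennreal (\<bar>lam\<bar> * (6 * r\<^sup>2)) * (\<integral>\<^sup>+s\<in>{0..t}. l1n (\<lambda>m. w s m - w' s m) \<partial>lborel)"
proof -
  have [measurable]: "(\<lambda>s. l1n (\<lambda>m. w s m - w' s m)) \<in> borel_measurable borel"
    unfolding l1n_def using assms(1,3)
    by (intro sigma_finite_measure.borel_measurable_nn_integral sigma_finite_measure_count_space measurable_pair_CZ) simp
  have "l1n (\<lambda>m. duhamel lam r J \<beta> w t m
       - duhamel lam r J \<beta> w' t m)
     = l1n (\<lambda>m. set_lebesgue_integral lborel {0..t} (\<lambda>s. vf lam r J (\<beta> s) (w s) m - vf lam r J (\<beta> s) (w' s) m))"
    by (subst set_integral_diff(2)[OF set_integrable_vf set_integrable_vf]) (auto simp: assms)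
  also have "\<dots> \<le> (\<integral>\<^sup>+s\<in>{0..t}. l1n (\<lambda>m. vf lam r J (\<beta> s) (w s) m - vf lam r J (\<beta> s) (w' s) m) \<partial>lborel)"
    by (intro l1n_set_integral_le borel_measurable_diff measurable_vf_path assms)
  also have "\<dots> \<le> (\<integral>\<^sup>+s. ennreal (\<bar>lam\<bar> * (6 * r\<^sup>2)) * (l1n (\<lambda>m. w s m - w' s m) * indicator {0..t} s) \<partial>lborel)"
    using l1n_vf_diff[OF assms(2) assms(4) r] by (intro nn_integral_mono) (simp add: indicator_def)
  also have "\<dots> = ennreal (\<bar>lam\<bar> * (6 * r\<^sup>2)) * (\<integral>\<^sup>+s\<in>{0..t}. l1n (\<lambda>m. w s m - w' s m) \<partial>lborel)"
    by (intro nn_integral_cmult) simp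
  finally show ?thesis .
qed

lemma integrable_pic: "t \<in> {0..T} \<Longrightarrow> integrable CZ (pic \<beta> n t)"
proof (induction n arbitrary: t)
  case 0
  show ?case using g by (simp add: pic.simps(1)[abs_def] fun_eq_iff[symmetric])
next
  case (Suc n)
  have "l1n (\<lambda>m. duhamel lam r J \<beta> (pic \<beta> n) t m) \<le> ennreal (\<bar>lam\<bar> * r ^ 3 * T)"
    using Suc by (intro l1n_integral_vf) auto
  then have "integrable CZ (\<lambda>m. duhamel lam r J \<beta> (pic \<beta> n) t m)"
    unfolding l1n_finite_iff[symmetric] by (rule le_less_trans) simp
  then have "integrable CZ (\<lambda>m. g m + duhamel lam r J \<beta> (pic \<beta> n) t m)"
    using g by simp
  then show ?case by (simp add: pic.simps(2)[abs_def])
qed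

text \<open>The bound for the first Picard step times the weight \<open>exp (2 * L * T)\<close>,
  with \<open>L = \<bar>lam\<bar> * (6 * r\<^sup>2)\<close> the Lipschitz constant of the truncated
  field.\<close>

definition rate :: real where "rate = \<bar>lam\<bar> * r ^ 3 * T * exp (2 * (\<bar>lam\<bar> * (6 * r\<^sup>2)) * T)"

lemma rate_nonneg: "0 \<le> rate"
  using r T by (simp add: rate_def)

lemma l1n_pic_step:
  assumes "t \<in> {0..T}"
  shows "l1n (\<lambda>m. pic \<beta> (Suc n) t m - pic \<beta> n t m) \<le> ennreal (rate * (1/2) ^ n)"
proof -
  have "l1n (\<lambda>m. pic \<beta> (Suc n) t m - pic \<beta> n t m)
     \<le> ennreal (\<bar>lam\<bar> * r ^ 3 * T * (1/2) ^ n * exp (2 * (\<bar>lam\<bar> * (6 * r\<^sup>2)) * t))"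
  proof (rule iterated_integral_bound[where d = "\<lambda>n t. l1n (\<lambda>m. pic \<beta> (Suc n) t m - pic \<beta> n t m)" and T = T])
    fix t assume t: "t \<in> {0..T}"
    have "l1n (\<lambda>m. duhamel lam r J \<beta> (pic \<beta> 0) t m) \<le> ennreal (\<bar>lam\<bar> * r ^ 3 * T)"
      using t by (intro l1n_integral_vf integrable_pic measurable_pic) auto
    then show "l1n (\<lambda>m. pic \<beta> (Suc 0) t m - pic \<beta> 0 t m) \<le> ennreal (\<bar>lam\<bar> * r ^ 3 * T)"
      by simp
    show "l1n (\<lambda>m. pic \<beta> (Suc (Suc n)) t m - pic \<beta> (Suc n) t m)
       \<le> ennreal (\<bar>lam\<bar> * (6 * r\<^sup>2)) * (\<integral>\<^sup>+s\<in>{0..t}. l1n (\<lambda>m. pic \<beta> (Suc n) s m - pic \<beta> n s m) \<partial>lborel)" for n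
    proof -
      have "l1n (\<lambda>m. duhamel lam r J \<beta> (pic \<beta> (Suc n)) t m
         - duhamel lam r J \<beta> (pic \<beta> n) t m)
       \<le> ennreal (\<bar>lam\<bar> * (6 * r\<^sup>2)) * (\<integral>\<^sup>+s\<in>{0..t}. l1n (\<lambda>m. pic \<beta> (Suc n) s m - pic \<beta> n s m) \<partial>lborel)"
        using t by (intro l1n_integral_vf_diff integrable_pic measurable_pic) auto
      then show ?thesis by (subst (1 2) pic.simps(2)) simp
    qed
  qed (use r T assms in auto)
  also have "\<dots> \<le> ennreal (rate * (1/2) ^ n)"
  proof (intro ennreal_leI)
    have "\<bar>lam\<bar> * r ^ 3 * T * (1/2) ^ n * exp (2 * (\<bar>lam\<bar> * (6 * r\<^sup>2)) * t)
       \<le> \<bar>lam\<bar> * r ^ 3 * T * (1/2) ^ n * exp (2 * (\<bar>lam\<bar> * (6 * r\<^sup>2)) * T)"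
      using r T assms by (intro mult_left_mono) (auto intro!: mult_left_mono)
    then show "\<bar>lam\<bar> * r ^ 3 * T * (1/2) ^ n * exp (2 * (\<bar>lam\<bar> * (6 * r\<^sup>2)) * t) \<le> rate * (1/2) ^ n"
      by (simp add: rate_def mult_ac)
  qed
  finally show ?thesis .
qed

lemma pic_tendsto:
  assumes "t \<in> {0..T}"
  shows "(\<lambda>n. pic \<beta> n t m) \<longlonglongrightarrow> sol \<beta> t m"
proof -
  have step: "cmod (pic \<beta> (Suc n) t m - pic \<beta> n t m) \<le> rate * (1/2) ^ n" for n
  proof -
    have "ennreal (cmod (pic \<beta> (Suc n) t m - pic \<beta> n t m)) \<le> ennreal (rate * (1/2) ^ n)"
      using cmod_le_l1n[of "\<lambda>m. pic \<beta> (Suc n) t m - pic \<beta> n t m" m] l1n_pic_step[OF assms] by (rule order_trans)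
    then show ?thesis using rate_nonneg by (subst (asm) ennreal_le_iff) auto
  qed
  have "summable (\<lambda>n. rate * (1/2) ^ n)"
    by (intro summable_mult summable_geometric) simp
  then have "summable (\<lambda>n. pic \<beta> (Suc n) t m - pic \<beta> n t m)"
    by (rule summable_comparison_test'[of _ 0]) (rule step)
  then have "convergent (\<lambda>n. \<Sum>i<n. pic \<beta> (Suc i) t m - pic \<beta> i t m)"
    by (simp add: summable_iff_convergent)
  then have "convergent (\<lambda>n. pic \<beta> n t m - pic \<beta> 0 t m)"
    by (simp only: sum_lessThan_telescope[of "\<lambda>i. pic \<beta> i t m"])
  then have "convergent (\<lambda>n. (pic \<beta> n t m - pic \<beta> 0 t m) + pic \<beta> 0 t m)"
    by (intro convergent_add convergent_const)
  then show ?thesis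
    unfolding sol_def by (simp add: convergent_LIMSEQ_iff del: pic.simps)
qed

lemma l1n_sol_diff:
  assumes "t \<in> {0..T}"
  shows "l1n (\<lambda>m. sol \<beta> t m - pic \<beta> n t m) \<le> ennreal (2 * rate * (1/2) ^ n)"
proof (rule l1n_Fatou)
  show "(\<lambda>k. pic \<beta> (n + k) t m - pic \<beta> n t m) \<longlonglongrightarrow> sol \<beta> t m - pic \<beta> n t m" for m
    using LIMSEQ_ignore_initial_segment[OF pic_tendsto[OF assms], of n] by (intro tendsto_intros) (simp add: add.commute)
  fix k
  \<comment> \<open>The exact geometric tail is kept in the induction; with the cruder bound
    \<open>2 * rate * (1/2) ^ n\<close> the step would not close.\<close>
  have "l1n (\<lambda>m. pic \<beta> (n + k) t m - pic \<beta> n t m) \<le> ennreal (2 * rate * (1/2) ^ n - 2 * rate * (1/2) ^ (n + k))"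
  proof (induction k)
    case 0
    show ?case by (simp add: l1n_def)
  next
    case (Suc k)
    have "(\<lambda>m. pic \<beta> (n + Suc k) t m - pic \<beta> n t m)
       = (\<lambda>m. (pic \<beta> (Suc (n + k)) t m - pic \<beta> (n + k) t m) + (pic \<beta> (n + k) t m - pic \<beta> n t m))"
      by (simp del: pic.simps)
    then have "l1n (\<lambda>m. pic \<beta> (n + Suc k) t m - pic \<beta> n t m)
        \<le> l1n (\<lambda>m. pic \<beta> (Suc (n + k)) t m - pic \<beta> (n + k) t m) + l1n (\<lambda>m. pic \<beta> (n + k) t m - pic \<beta> n t m)"
      by (simp only: l1n_add)
    also have "\<dots> \<le> ennreal (rate * (1/2) ^ (n + k)) + ennreal (2 * rate * (1/2) ^ n - 2 * rate * (1/2) ^ (n + k))"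
      by (intro add_mono l1n_pic_step assms Suc)
    also have "\<dots> = ennreal (2 * rate * (1/2) ^ n - 2 * rate * (1/2) ^ (n + Suc k))"
    proof -
      have "2 * rate * (1/2) ^ (n + k) \<le> 2 * rate * (1/2) ^ n"
        using rate_nonneg by (intro mult_left_mono power_decreasing) auto
      then show ?thesis using rate_nonneg by (subst ennreal_plus[symmetric]) auto
    qed
    finally show ?case .
  qed
  also have "\<dots> \<le> ennreal (2 * rate * (1/2) ^ n)"
    using rate_nonneg by (intro ennreal_leI) auto
  finally show "l1n (\<lambda>m. pic \<beta> (n + k) t m - pic \<beta> n t m) \<le> ennreal (2 * rate * (1/2) ^ n)" .
qed

lemma integrable_sol: "t \<in> {0..T} \<Longrightarrow> integrable CZ (sol \<beta> t)"
proof -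
  assume t: "t \<in> {0..T}"
  have "l1n (\<lambda>m. sol \<beta> t m - pic \<beta> 0 t m) < \<infinity>"
    using l1n_sol_diff[OF t, of 0] by (rule le_less_trans) simp
  then have "integrable CZ (\<lambda>m. (sol \<beta> t m - pic \<beta> 0 t m) + pic \<beta> 0 t m)"
    unfolding l1n_finite_iff using integrable_pic[OF t] by (rule Bochner_Integration.integrable_add)
  then show ?thesis by simp
qed

text \<open>The Lipschitz bound and the geometric rate, uniform over \<open>[0, T]\<close>, carry
  the limit through the integral with an explicit error.\<close>

lemma sol_eq:
  assumes "t \<in> {0..T}"
  shows "sol \<beta> t m = g m + duhamel lam r J \<beta> (sol \<beta>) t m"
proof -
  let ?I = "\<lambda>w m. duhamel lam r J \<beta> w t m"
  define K where "K = \<bar>lam\<bar> * (6 * r\<^sup>2) * (2 * rate * T)"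
  have K: "0 \<le> K" using rate_nonneg T by (simp add: K_def)
  have bound: "cmod (?I (pic \<beta> n) m - ?I (sol \<beta>) m) \<le> K * (1/2) ^ n" for n
  proof -
    have "ennreal (cmod (?I (pic \<beta> n) m - ?I (sol \<beta>) m)) \<le> l1n (\<lambda>m. ?I (pic \<beta> n) m - ?I (sol \<beta>) m)"
      by (rule cmod_le_l1n)
    also have "\<dots> \<le> ennreal (\<bar>lam\<bar> * (6 * r\<^sup>2)) * (\<integral>\<^sup>+s\<in>{0..t}. l1n (\<lambda>m. pic \<beta> n s m - sol \<beta> s m) \<partial>lborel)"
      using assms by (intro l1n_integral_vf_diff integrable_pic integrable_sol measurable_pic measurable_sol) auto
    also have "\<dots> \<le> ennreal (\<bar>lam\<bar> * (6 * r\<^sup>2)) * (\<integral>\<^sup>+s\<in>{0..t}. ennreal (2 * rate * (1/2) ^ n) \<partial>lborel)"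
    proof (intro mult_left_mono nn_integral_mono)
      fix s
      have "l1n (\<lambda>m. pic \<beta> n s m - sol \<beta> s m) = l1n (\<lambda>m. sol \<beta> s m - pic \<beta> n s m)"
        by (simp add: l1n_def norm_minus_commute)
      then show "l1n (\<lambda>m. pic \<beta> n s m - sol \<beta> s m) * indicator {0..t} s \<le> ennreal (2 * rate * (1/2) ^ n) * indicator {0..t} s"
        using l1n_sol_diff[of s n] assms by (simp add: indicator_def)
    qed auto
    also have "\<dots> = ennreal (\<bar>lam\<bar> * (6 * r\<^sup>2) * (2 * rate * (1/2) ^ n * t))"
    proof -
      have t0: "0 \<le> t" using assms by simp
      show ?thesis
        unfolding nn_integral_const_Icc[OF t0] ennreal_mult''[OF t0, symmetric]
        by (rule ennreal_mult''[symmetric]) (use t0 rate_nonneg in simp)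
    qed
    also have "\<dots> \<le> ennreal (\<bar>lam\<bar> * (6 * r\<^sup>2) * (2 * rate * (1/2) ^ n * T))"
      using assms rate_nonneg by (intro ennreal_leI mult_left_mono) auto
    also have "\<bar>lam\<bar> * (6 * r\<^sup>2) * (2 * rate * (1/2) ^ n * T) = K * (1/2) ^ n"
      by (simp add: K_def mult_ac)
    finally show ?thesis using K by (subst (asm) ennreal_le_iff) auto
  qed
  have "(\<lambda>n. K * (1/2) ^ n) \<longlonglongrightarrow> K * 0"
    by (intro tendsto_mult tendsto_const LIMSEQ_power_zero) auto
  then have "(\<lambda>n. K * (1/2) ^ n) \<longlonglongrightarrow> 0" by (simp only: mult_zero_right)
  then have "(\<lambda>n. ?I (pic \<beta> n) m - ?I (sol \<beta>) m) \<longlonglongrightarrow> 0"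
    by (rule Lim_null_comparison[rotated]) (intro always_eventually allI bound)
  then have "(\<lambda>n. ?I (pic \<beta> n) m) \<longlonglongrightarrow> ?I (sol \<beta>) m"
    by (rule LIM_zero_cancel)
  then have "(\<lambda>n. g m + ?I (pic \<beta> n) m) \<longlonglongrightarrow> g m + ?I (sol \<beta>) m"
    by (intro tendsto_add tendsto_const)
  then have "(\<lambda>n. pic \<beta> (Suc n) t m) \<longlonglongrightarrow> g m + ?I (sol \<beta>) m"
    by simp
  with LIMSEQ_Suc[OF pic_tendsto[OF assms]] show ?thesis
    by (rule LIMSEQ_unique)
qed

text \<open>The estimate is proved for the iterates and inherited by Fatou's lemma, so finiteness of
  the Sobolev norm of \<open>sol\<close> is a result and not an assumption. Both factors 2 come from
  \<open>wl2_add\<close>; in the exponent one \<open>T\<close> is due to Cauchy-Schwarz in time, the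
  other to evaluation at the end of the interval.\<close>

lemma wl2_sol:
  assumes "wl2 k g \<le> ennreal H" "0 \<le> H" "t \<in> {0..T}"
  shows "wl2 k (sol \<beta> t) \<le> ennreal (2 * H * exp (2 * T * (lam\<^sup>2 * (wl2_tri_const k * r ^ 4)) * T))"
proof (rule wl2_Fatou)
  show "(\<lambda>n. pic \<beta> n t m) \<longlonglongrightarrow> sol \<beta> t m" for m by (rule pic_tendsto[OF assms(3)])
  fix n
  define c where "c = lam\<^sup>2 * (wl2_tri_const k * r ^ 4)"
  have c: "0 \<le> c" using r by (simp add: c_def wl2_tri_const_def)
  have "wl2 k (pic \<beta> n t) \<le> ennreal (2 * H * exp (2 * T * c * t))"
  proof (rule iterated_integral_source_bound[where h = "\<lambda>n t. wl2 k (pic \<beta> n t)" and T = T])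
    fix t assume t: "t \<in> {0..T}"
    have "wl2 k (pic \<beta> 0 t) = wl2 k g" by (simp add: wl2_def)
    also have "\<dots> \<le> ennreal (2 * H)" using assms(1,2) by (auto elim!: order_trans intro: ennreal_leI)
    finally show "wl2 k (pic \<beta> 0 t) \<le> ennreal (2 * H)" .
    fix n
    have [measurable]: "(\<lambda>s. wl2 k (pic \<beta> n s)) \<in> borel_measurable borel"
      unfolding wl2_def
      by (intro sigma_finite_measure.borel_measurable_nn_integral sigma_finite_measure_count_space measurable_pair_CZ) simp
    have "wl2 k (pic \<beta> (Suc n) t) \<le> 2 * wl2 k g + 2 * wl2 k (\<lambda>m. duhamel lam r J \<beta> (pic \<beta> n) t m)"
      using wl2_add[of k g "\<lambda>m. duhamel lam r J \<beta> (pic \<beta> n) t m"]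
      by (simp add: pic.simps(2)[abs_def])
    also have "\<dots> \<le> 2 * ennreal H + 2 * (ennreal T * (ennreal c * (\<integral>\<^sup>+s\<in>{0..t}. wl2 k (pic \<beta> n s) \<partial>lborel)))"
    proof (intro add_mono mult_left_mono)
      have "wl2 k (\<lambda>m. duhamel lam r J \<beta> (pic \<beta> n) t m)
         \<le> ennreal t * (\<integral>\<^sup>+s\<in>{0..t}. wl2 k (vf lam r J (\<beta> s) (pic \<beta> n s)) \<partial>lborel)"
        using t by (intro wl2_set_integral_le measurable_vf_path measurable_pic) auto
      also have "\<dots> \<le> ennreal T * (\<integral>\<^sup>+s. ennreal c * (wl2 k (pic \<beta> n s) * indicator {0..t} s) \<partial>lborel)"
      proof (rule mult_mono)
        show "(\<integral>\<^sup>+s\<in>{0..t}. wl2 k (vf lam r J (\<beta> s) (pic \<beta> n s)) \<partial>lborel)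
           \<le> (\<integral>\<^sup>+s. ennreal c * (wl2 k (pic \<beta> n s) * indicator {0..t} s) \<partial>lborel)"
          using t wl2_vf[OF integrable_pic r] unfolding c_def
          by (intro nn_integral_mono) (simp add: indicator_def)
      qed (use t in \<open>auto intro: ennreal_leI\<close>)
      also have "\<dots> = ennreal T * (ennreal c * (\<integral>\<^sup>+s\<in>{0..t}. wl2 k (pic \<beta> n s) \<partial>lborel))"
        by (subst nn_integral_cmult) auto
      finally show "wl2 k (\<lambda>m. duhamel lam r J \<beta> (pic \<beta> n) t m)
         \<le> ennreal T * (ennreal c * (\<integral>\<^sup>+s\<in>{0..t}. wl2 k (pic \<beta> n s) \<partial>lborel))" .
    qed (use assms in auto)
    also have "\<dots> = ennreal (2 * H) + ennreal (2 * T * c) * (\<integral>\<^sup>+s\<in>{0..t}. wl2 k (pic \<beta> n s) \<partial>lborel)"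
      using assms(2) T c by (simp add: ennreal_mult' mult.assoc)
    finally show "wl2 k (pic \<beta> (Suc n) t) \<le> ennreal (2 * H) + ennreal (2 * T * c) * (\<integral>\<^sup>+s\<in>{0..t}. wl2 k (pic \<beta> n s) \<partial>lborel)" .
  qed (use assms T c in auto)
  also have "\<dots> \<le> ennreal (2 * H * exp (2 * T * c * T))"
    using assms T c by (intro ennreal_leI mult_left_mono) (auto intro!: mult_left_mono)
  finally show "wl2 k (pic \<beta> n t) \<le> ennreal (2 * H * exp (2 * T * (lam\<^sup>2 * (wl2_tri_const k * r ^ 4)) * T))"
    by (simp add: c_def)
qed

text \<open>The difference is at most \<open>C\<close> because both Duhamel terms are bounded, and
  it satisfies the integral inequality with itself on both sides. The iterated bound for a constant
  sequence therefore holds with every power of 1/2.\<close>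

lemma truncated_unique:
  assumes w: "\<And>m. (\<lambda>t. w t m) \<in> borel_measurable borel" "\<And>t. t \<in> {0..T} \<Longrightarrow> integrable CZ (w t)"
    and w': "\<And>m. (\<lambda>t. w' t m) \<in> borel_measurable borel" "\<And>t. t \<in> {0..T} \<Longrightarrow> integrable CZ (w' t)"
    and eq: "\<And>t m. t \<in> {0..T} \<Longrightarrow> w t m = g m + duhamel lam r J \<beta> w t m"
    and eq': "\<And>t m. t \<in> {0..T} \<Longrightarrow> w' t m = g m + duhamel lam r J \<beta> w' t m"
    and t: "t \<in> {0..T}"
  shows "w t m = w' t m"
proof -
  define C where "C = 2 * (\<bar>lam\<bar> * r ^ 3 * T)"
  define L where "L = \<bar>lam\<bar> * (6 * r\<^sup>2)"
  have C: "0 \<le> C" using r T by (simp add: C_def)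
  have D: "l1n (\<lambda>m. w t m - w' t m) \<le> ennreal (C * (1/2) ^ n * exp (2 * L * t))" for n
  proof (rule iterated_integral_bound[where d = "\<lambda>n t. l1n (\<lambda>m. w t m - w' t m)" and T = T])
    fix t assume t: "t \<in> {0..T}"
    let ?I = "\<lambda>w m. duhamel lam r J \<beta> w t m"
    have e: "l1n (\<lambda>m. w t m - w' t m) = l1n (\<lambda>m. ?I w m - ?I w' m)"
      using eq[OF t] eq'[OF t] by simp
    also have "\<dots> \<le> l1n (?I w) + l1n (?I w')" by (rule l1n_diff)
    also have "\<dots> \<le> ennreal (\<bar>lam\<bar> * r ^ 3 * T) + ennreal (\<bar>lam\<bar> * r ^ 3 * T)"
      using t by (intro add_mono l1n_integral_vf w w') auto
    also have "\<dots> = ennreal C" using r T by (simp add: C_def flip: ennreal_plus)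
    finally show "l1n (\<lambda>m. w t m - w' t m) \<le> ennreal C" .
    show "l1n (\<lambda>m. w t m - w' t m) \<le> ennreal L * (\<integral>\<^sup>+s\<in>{0..t}. l1n (\<lambda>m. w s m - w' s m) \<partial>lborel)"
      unfolding e L_def using t by (intro l1n_integral_vf_diff w w') auto
  qed (use C t in \<open>auto simp: L_def\<close>)
  have bound: "cmod (w t m - w' t m) \<le> C * (1/2) ^ n * exp (2 * L * t)" for n
    using order_trans[OF cmod_le_l1n D, of m n] C by (subst (asm) ennreal_le_iff) auto
  have "(\<lambda>n. C * (1/2) ^ n * exp (2 * L * t)) \<longlonglongrightarrow> C * 0 * exp (2 * L * t)"
    by (intro tendsto_mult tendsto_const LIMSEQ_power_zero) auto
  then have "cmod (w t m - w' t m) \<le> C * 0 * exp (2 * L * t)"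
    by (rule LIMSEQ_le_const) (intro exI allI impI bound)
  then show ?thesis by simp
qed

end

end

section \<open>Continuity in time and conservation of mass\<close>

lemma continuous_on_integral_CZ:
  fixes f :: "real \<Rightarrow> int \<Rightarrow> 'b :: {banach, second_countable_topology}"
  assumes "\<And>k. continuous_on S (\<lambda>s. f s k)" "\<And>s k. s \<in> S \<Longrightarrow> norm (f s k) \<le> D k" "integrable CZ D"
  shows "continuous_on S (\<lambda>s. \<integral>k. f s k \<partial>CZ)"
proof (rule continuous_on_sequentiallyI)
  fix u :: "nat \<Rightarrow> real" and a
  assume u: "\<forall>n. u n \<in> S" "a \<in> S" "u \<longlonglongrightarrow> a"
  show "(\<lambda>n. \<integral>k. f (u n) k \<partial>CZ) \<longlonglongrightarrow> (\<integral>k. f a k \<partial>CZ)"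
  proof (rule integral_dominated_convergence[where w = D])
    show "AE k in CZ. (\<lambda>n. f (u n) k) \<longlonglongrightarrow> f a k"
      using assms(1) u by (intro AE_I2) (auto simp: continuous_on_sequentially o_def)
    show "AE k in CZ. norm (f (u n) k) \<le> D k" for n
      using assms(2) u by (intro AE_I2) auto
  qed (use assms(3) in auto)
qed

lemma continuous_on_conv:
  fixes a b :: "real \<Rightarrow> int \<Rightarrow> complex"
  assumes a: "\<And>k. continuous_on S (\<lambda>s. a s k)" "\<And>s k. s \<in> S \<Longrightarrow> cmod (a s k) \<le> K"
    and b: "\<And>k. continuous_on S (\<lambda>s. b s k)" "\<And>s k. s \<in> S \<Longrightarrow> cmod (b s k) \<le> D k" "integrable CZ D"
  shows "continuous_on S (\<lambda>s. conv (a s) (b s) m)"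
  unfolding conv_def
proof (rule continuous_on_integral_CZ)
  show "continuous_on S (\<lambda>s. a s k * b s (m - k))" for k
    by (intro continuous_intros a b)
  show "norm (a s k * b s (m - k)) \<le> K * D (m - k)" if "s \<in> S" for s k
    unfolding norm_mult using that a(2)[OF that, of k]
    by (intro mult_mono a b) (auto intro: order_trans[OF norm_ge_zero])
  have "bij (\<lambda>k. m - k)" by (rule bijI') (auto intro: exI[of _ "m - _"] simp: algebra_simps)
  then have "integrable CZ (\<lambda>k. D (m - k))"
    using integrable_bij_count_space[of "\<lambda>k. m - k" UNIV UNIV D] b(3) by simp
  then show "integrable CZ (\<lambda>k. K * D (m - k))" by simp
qed

text \<open>Continuity of each coefficient together with one summable majorant is what dominated
  convergence asks for, in the cubic sums and, with a weighted majorant, in Sobolev norms.\<close>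

locale dominated_family =
  fixes S :: "real set" and a :: "real \<Rightarrow> int \<Rightarrow> complex" and D :: "int \<Rightarrow> real"
  assumes cont: "\<And>k. continuous_on S (\<lambda>s. a s k)"
    and dom: "\<And>s k. s \<in> S \<Longrightarrow> cmod (a s k) \<le> D k"
    and intD: "integrable CZ D"
begin

lemma integrable_a: "s \<in> S \<Longrightarrow> integrable CZ (a s)"
  using dom by (intro Bochner_Integration.integrable_bound[OF intD]) (auto intro!: AE_I2 order_trans[OF dom])

lemma nrm_a_le: "s \<in> S \<Longrightarrow> nrm (a s) \<le> (\<integral>k. D k \<partial>CZ)"
  using dom intD integrable_a by (simp add: nrm_eq_integral integral_mono)

lemma cmod_a_le: "s \<in> S \<Longrightarrow> cmod (a s k) \<le> (\<integral>k. D k \<partial>CZ)"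
proof -
  assume s: "s \<in> S"
  have "ennreal (cmod (a s k)) \<le> ennreal (nrm (a s))"
    using cmod_le_l1n[of "a s" k] integrable_a[OF s] by (simp add: l1n_eq_nrm)
  then show ?thesis using nrm_a_le[OF s] by simp
qed

lemma continuous_on_nrm: "continuous_on S (\<lambda>s. nrm (a s))"
proof -
  have "continuous_on S (\<lambda>s. \<integral>k. cmod (a s k) \<partial>CZ)"
    using dom intD by (intro continuous_on_integral_CZ[where D = D] continuous_intros cont) auto
  then show ?thesis using integrable_a by (simp add: nrm_eq_integral cong: continuous_on_cong)
qed

lemma continuous_on_tri: "continuous_on S (\<lambda>s. cube (a s) m)"
  unfolding tri_def
proof (rule continuous_on_conv[where D = D and K = "(\<integral>k. D k \<partial>CZ)\<^sup>2"])
  show "continuous_on S (\<lambda>s. conv (a s) (star (a s)) k)" for k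
  proof (rule continuous_on_conv[where D = "\<lambda>k. D (- k)" and K = "\<integral>k. D k \<partial>CZ"])
    show "continuous_on S (\<lambda>s. star (a s) k)" for k
      unfolding star_def by (intro continuous_intros cont)
    have "bij (\<lambda>m::int. - m)" by (rule bijI') (auto intro: exI[of _ "- _"])
    then show "integrable CZ (\<lambda>k. D (- k))"
      using integrable_bij_count_space[of "\<lambda>k. - k" UNIV UNIV D] intD by simp
  qed (auto simp: star_def cont dom cmod_a_le)
  fix s k assume s: "s \<in> S"
  have "ennreal (cmod (conv (a s) (star (a s)) k)) \<le> l1n (a s) * l1n (a s)"
    using order_trans[OF cmod_le_l1n l1n_conv, of "a s" "star (a s)"] by simp
  also have "\<dots> = ennreal ((nrm (a s))\<^sup>2)"
    using integrable_a[OF s] by (simp add: l1n_eq_nrm power2_eq_square ennreal_mult)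
  finally have "cmod (conv (a s) (star (a s)) k) \<le> (nrm (a s))\<^sup>2" by simp
  also have "\<dots> \<le> (\<integral>k. D k \<partial>CZ)\<^sup>2" using nrm_a_le[OF s] by (intro power_mono) auto
  finally show "cmod (conv (a s) (star (a s)) k) \<le> (\<integral>k. D k \<partial>CZ)\<^sup>2" .
qed (auto simp: cont dom intD)

lemma continuous_on_trunc_cubic:
  assumes "0 < r"
  shows "continuous_on S (\<lambda>s. trunc_cubic r (a s) m)"
proof -
  have "max r x \<noteq> 0" for x using assms by (auto simp: max_def)
  then show ?thesis
    unfolding trunc_cubic_eq by (intro continuous_intros continuous_on_nrm continuous_on_tri) auto
qed

end

lemma continuous_on_ph: "continuous_on S \<beta> \<Longrightarrow> continuous_on S (\<lambda>s. ph (\<beta> s) m)"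
  unfolding ph_def by (intro continuous_intros)

lemma dominated_family_rot:
  assumes "dominated_family S w D" "continuous_on S \<beta>"
  shows "dominated_family S (\<lambda>s. rot (\<beta> s) (w s)) D"
proof -
  interpret dominated_family S w D by fact
  show ?thesis
    by unfold_locales (auto simp: dom intD rot_def[abs_def] norm_mult intro!: continuous_intros cont continuous_on_ph assms)
qed

lemma continuous_on_vf:
  assumes "dominated_family S w D" "continuous_on S \<beta>" "0 < r"
  shows "continuous_on S (\<lambda>s. vf lam r J (\<beta> s) (w s) m)"
proof -
  have "continuous_on S (\<lambda>s. trunc_cubic r (rot (\<beta> s) (w s)) m)"
    by (rule dominated_family.continuous_on_trunc_cubic[OF dominated_family_rot[OF assms(1,2)] assms(3)])
  then show ?thesis
    unfolding vf_def by (cases "J m") (auto intro!: continuous_intros continuous_on_ph assms)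
qed

lemma integrable_cmod_power2:
  assumes "integrable CZ a"
  shows "integrable CZ (\<lambda>m. (cmod (a m))\<^sup>2)"
proof (rule Bochner_Integration.integrable_bound)
  show "integrable CZ (\<lambda>m. nrm a *\<^sub>R cmod (a m))" using assms by simp
  have "cmod (a m) \<le> nrm a" for m
    using cmod_le_l1n[of a m] assms by (simp add: l1n_eq_nrm)
  then show "AE m in CZ. norm ((cmod (a m))\<^sup>2) \<le> norm (nrm a *\<^sub>R cmod (a m))"
    by (intro AE_I2) (simp add: power2_eq_square mult_right_mono)
qed simp

text \<open>The phase of the vector field moves to \<open>w\<close> and turns the pairing into that
  of the rotated coefficients \<open>a\<close> with their cube. Modes outside \<open>J\<close>
  contribute nothing since \<open>w\<close> vanishes there, so cutting off the nonlinearity is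
  harmless. The result is \<open>\<i>\<close> times a real number.\<close>

lemma Re_vf_pairing:
  assumes w: "integrable CZ w" and supp: "\<And>m. \<not> J m \<Longrightarrow> w m = 0"
  shows "Re (\<integral>m. vf lam r J b w m * cnj (w m) \<partial>CZ) = 0"
proof -
  define a where "a = rot b w"
  define c where "c = lam * (r / max r (nrm a)) ^ 3"
  have "vf lam r J b w m * cnj (w m) = (\<i> * of_real c) * (tri a a a m * cnj (a m))" for m
    using supp[of m]
    by (cases "J m") (simp_all add: vf_def trunc_cubic_eq a_def[symmetric] c_def,
        simp_all add: a_def rot_def cnj_ph mult_ac)
  then have "(\<integral>m. vf lam r J b w m * cnj (w m) \<partial>CZ) = (\<i> * of_real c) * (\<integral>m. tri a a a m * cnj (a m) \<partial>CZ)"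
    by (simp only: integral_mult_right_zero)
  moreover have "Im (\<integral>m. tri a a a m * cnj (a m) \<partial>CZ) = 0"
    using w by (intro Im_tri_pairing) (simp add: a_def)
  ultimately show ?thesis by simp
qed

context truncated_equation
begin

context
  fixes \<beta> :: "real \<Rightarrow> real"
  assumes \<beta> [measurable]: "\<beta> \<in> borel_measurable borel" and \<beta>c: "continuous_on {0..T} \<beta>"
begin

text \<open>The Duhamel formula with absolute values inside and extended to the full interval: a
  majorant independent of \<open>t\<close> that inherits summability and Sobolev weights from the
  data.\<close>

definition dmn :: "int \<Rightarrow> real" where
  "dmn m = cmod (g m) + set_lebesgue_integral lborel {0..T} (\<lambda>s. cmod (vf lam r J (\<beta> s) (sol \<beta> s) m))"

lemma measurable_vf_sol [measurable]: "(\<lambda>s. vf lam r J (\<beta> s) (sol \<beta> s) m) \<in> borel_measurable borel"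
  by (intro measurable_vf_path[OF \<beta>] measurable_sol[OF \<beta>])

lemma set_integrable_vf_sol: "t \<le> T \<Longrightarrow> set_integrable lborel {0..t} (\<lambda>s. vf lam r J (\<beta> s) (sol \<beta> s) m)"
  by (intro set_integrable_vf[OF \<beta>] measurable_sol[OF \<beta>] integrable_sol[OF \<beta>]) auto

lemma of_real_dmn:
  "complex_of_real (dmn m) = of_real (cmod (g m)) + set_lebesgue_integral lborel {0..T} (\<lambda>s. complex_of_real (cmod (vf lam r J (\<beta> s) (sol \<beta> s) m)))"
  by (simp add: dmn_def set_integral_complex_of_real)

lemma cmod_sol_le:
  assumes "t \<in> {0..T}"
  shows "cmod (sol \<beta> t m) \<le> dmn m"
proof -
  let ?F = "\<lambda>s. vf lam r J (\<beta> s) (sol \<beta> s) m"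
  have "ennreal (cmod (set_lebesgue_integral lborel {0..t} ?F)) \<le> (\<integral>\<^sup>+s\<in>{0..t}. ennreal (cmod (?F s)) \<partial>lborel)"
    by (rule cmod_set_integral_le)
  also have "\<dots> \<le> (\<integral>\<^sup>+s. ennreal (indicator {0..T} s *\<^sub>R cmod (?F s)) \<partial>lborel)"
    using assms by (intro nn_integral_mono) (auto simp: indicator_def)
  also have "\<dots> = ennreal (set_lebesgue_integral lborel {0..T} (\<lambda>s. cmod (?F s)))"
    unfolding set_lebesgue_integral_def
    using set_integrable_norm[OF set_integrable_vf_sol[of T m]]
    by (intro nn_integral_eq_integral) (auto simp: set_integrable_def)
  finally have "cmod (set_lebesgue_integral lborel {0..t} ?F) \<le> set_lebesgue_integral lborel {0..T} (\<lambda>s. cmod (?F s))"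
    by (subst (asm) ennreal_le_iff) (auto simp: set_lebesgue_integral_def intro!: integral_nonneg_AE)
  then show ?thesis
    unfolding dmn_def sol_eq[OF \<beta> assms] by (intro norm_triangle_le add_left_mono)
qed

lemma integrable_dmn: "integrable CZ dmn"
proof -
  define I where "I m = set_lebesgue_integral lborel {0..T} (\<lambda>s. complex_of_real (cmod (vf lam r J (\<beta> s) (sol \<beta> s) m)))" for m
  have "l1n I \<le> (\<integral>\<^sup>+s\<in>{0..T}. l1n (\<lambda>m. complex_of_real (cmod (vf lam r J (\<beta> s) (sol \<beta> s) m))) \<partial>lborel)"
    unfolding I_def by (intro l1n_set_integral_le) measurable
  also have "\<dots> = (\<integral>\<^sup>+s\<in>{0..T}. l1n (vf lam r J (\<beta> s) (sol \<beta> s)) \<partial>lborel)"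
    by (simp add: l1n_def)
  also have "\<dots> \<le> (\<integral>\<^sup>+s\<in>{0..T}. ennreal (\<bar>lam\<bar> * r ^ 3) \<partial>lborel)"
    using l1n_vf[OF integrable_sol[OF \<beta>] r] by (intro nn_integral_mono) (simp add: indicator_def)
  also have "\<dots> < \<infinity>"
    using T by (simp add: nn_integral_const_Icc ennreal_mult_less_top)
  finally have "integrable CZ I" unfolding l1n_finite_iff .
  then have "integrable CZ (\<lambda>m. complex_of_real (cmod (g m)) + I m)"
    using g by (intro Bochner_Integration.integrable_add integrable_of_real integrable_norm)
  then have "integrable CZ (\<lambda>m. complex_of_real (dmn m))"
    by (simp add: of_real_dmn I_def)
  then have "integrable CZ (\<lambda>m. Re (complex_of_real (dmn m)))"
    by (rule integrable_Re)
  then show ?thesis by simp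
qed

text \<open>Sobolev bounds at each time do not give continuity in the Sobolev norm; a majorant with
  finite weighted norm does.\<close>

lemma wl2_dmn:
  assumes "wl2 k g < \<infinity>"
  shows "wl2 k (\<lambda>m. complex_of_real (dmn m)) < \<infinity>"
proof -
  obtain H where H: "0 \<le> H" "wl2 k g = ennreal H"
    using assms by (cases "wl2 k g") auto
  define c where "c = ennreal (lam\<^sup>2 * (wl2_tri_const k * r ^ 4))"
  define B where "B = ennreal (2 * H * exp (2 * T * (lam\<^sup>2 * (wl2_tri_const k * r ^ 4)) * T))"
  define I where "I m = set_lebesgue_integral lborel {0..T} (\<lambda>s. complex_of_real (cmod (vf lam r J (\<beta> s) (sol \<beta> s) m)))" for m
  have "wl2 k I \<le> ennreal T * (\<integral>\<^sup>+s\<in>{0..T}. wl2 k (\<lambda>m. complex_of_real (cmod (vf lam r J (\<beta> s) (sol \<beta> s) m))) \<partial>lborel)"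
    unfolding I_def using T by (intro wl2_set_integral_le) auto
  also have "\<dots> = ennreal T * (\<integral>\<^sup>+s\<in>{0..T}. wl2 k (vf lam r J (\<beta> s) (sol \<beta> s)) \<partial>lborel)"
    by (simp add: wl2_def)
  also have "\<dots> \<le> ennreal T * (\<integral>\<^sup>+s\<in>{0..T}. (c * B) \<partial>lborel)"
  proof (intro mult_left_mono nn_integral_mono)
    fix s
    show "wl2 k (vf lam r J (\<beta> s) (sol \<beta> s)) * indicator {0..T} s \<le> c * B * indicator {0..T} s"
    proof (cases "s \<in> {0..T}")
      case True
      have "wl2 k (vf lam r J (\<beta> s) (sol \<beta> s)) \<le> c * wl2 k (sol \<beta> s)"
        unfolding c_def by (rule wl2_vf[OF integrable_sol[OF \<beta> True] r])
      also have "\<dots> \<le> c * B"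
        unfolding B_def using H by (intro mult_left_mono wl2_sol[OF \<beta> _ _ True]) auto
      finally show ?thesis using True by simp
    qed simp
  qed auto
  also have "\<dots> = ennreal T * (c * B * ennreal T)"
    using T by (simp only: nn_integral_const_Icc)
  also have "\<dots> < \<infinity>" by (simp add: c_def B_def ennreal_mult_less_top)
  finally have I: "wl2 k I < \<infinity>" .
  have "wl2 k (\<lambda>m. complex_of_real (dmn m)) \<le> 2 * wl2 k (\<lambda>m. complex_of_real (cmod (g m))) + 2 * wl2 k I"
    unfolding of_real_dmn I_def by (rule wl2_add)
  also have "wl2 k (\<lambda>m. complex_of_real (cmod (g m))) = wl2 k g" by (simp add: wl2_def)
  also have "2 * wl2 k g + 2 * wl2 k I < \<infinity>"
    using I assms by (simp add: ennreal_mult_less_top)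
  finally show ?thesis .
qed

lemma continuous_on_sol: "continuous_on {0..T} (\<lambda>t. sol \<beta> t m)"
proof -
  let ?F = "\<lambda>s. vf lam r J (\<beta> s) (sol \<beta> s) m"
  have "continuous_on {0..T} (\<lambda>t. g m + integral {0..t} ?F)"
    using set_borel_integral_eq_integral(1)[OF set_integrable_vf_sol[of T m]]
    by (intro continuous_intros indefinite_integral_continuous_1) auto
  then show ?thesis
    by (rule continuous_on_eq)
       (simp add: sol_eq[OF \<beta>] set_borel_integral_eq_integral(2)[OF set_integrable_vf_sol])
qed

lemma dominated_sol: "dominated_family {0..T} (sol \<beta>) dmn"
  by unfold_locales (auto simp: continuous_on_sol cmod_sol_le integrable_dmn)

lemma sol_has_vector_derivative:
  assumes "t \<in> {0..T}"
  shows "((\<lambda>t. sol \<beta> t m) has_vector_derivative vf lam r J (\<beta> t) (sol \<beta> t) m) (at t within {0..T})"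
proof -
  let ?F = "\<lambda>s. vf lam r J (\<beta> s) (sol \<beta> s) m"
  have "((\<lambda>t. integral {0..t} ?F) has_vector_derivative ?F t) (at t within {0..T})"
    by (rule integral_has_vector_derivative[OF continuous_on_vf[OF dominated_sol \<beta>c r] assms])
  then have "((\<lambda>t. g m + integral {0..t} ?F) has_vector_derivative ?F t) (at t within {0..T})"
    by (auto intro!: derivative_eq_intros)
  then show ?thesis
    by (rule has_vector_derivative_transform[OF assms, rotated])
       (simp add: sol_eq[OF \<beta>] set_borel_integral_eq_integral(2)[OF set_integrable_vf_sol])
qed

lemma sol_support: "\<lbrakk>\<And>m. \<not> J m \<Longrightarrow> g m = 0; t \<in> {0..T}; \<not> J m\<rbrakk> \<Longrightarrow> sol \<beta> t m = 0"
  by (simp add: sol_eq[OF \<beta>] vf_def set_lebesgue_integral_def)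

lemma sol_0: "sol \<beta> 0 m = g m"
  using sol_eq[OF \<beta>, of 0 m] T set_borel_integral_eq_integral(2)[OF set_integrable_vf_sol[of 0 m]] by simp

text \<open>Each mode satisfies an ordinary differential equation, so the change of its squared
  modulus is a time integral of \<open>p\<close>. Summing over modes under that integral avoids
  differentiating an infinite sum, and the summed \<open>p\<close> vanishes at every time.\<close>

lemma sol_mass:
  assumes supp: "\<And>m. \<not> J m \<Longrightarrow> g m = 0" and t: "t \<in> {0..T}"
  shows "wl2 0 (sol \<beta> t) = wl2 0 g"
proof -
  define F where "F s m = vf lam r J (\<beta> s) (sol \<beta> s) m" for s m
  define p where "p s m = sol \<beta> s m \<bullet> F s m + F s m \<bullet> sol \<beta> s m" for s m
  have F_meas: "(\<lambda>s. F s m) \<in> borel_measurable borel" for m unfolding F_def by measurable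
  have sol_meas: "(\<lambda>s. sol \<beta> s m) \<in> borel_measurable borel" for m by (rule measurable_sol[OF \<beta>])
  define K where "K = (\<integral>k. dmn k \<partial>CZ)"
  have K: "cmod (sol \<beta> s m) \<le> K" if "s \<in> {0..T}" for s m
    unfolding K_def by (rule dominated_family.cmod_a_le[OF dominated_sol that])
  have p_le: "\<bar>p s m\<bar> \<le> 2 * K * cmod (F s m)" if "s \<in> {0..T}" for s m
  proof -
    have "\<bar>sol \<beta> s m \<bullet> F s m\<bar> \<le> cmod (sol \<beta> s m) * cmod (F s m)" by (rule Cauchy_Schwarz_ineq2)
    also have "\<dots> \<le> K * cmod (F s m)" by (intro mult_right_mono K that) auto
    finally show ?thesis by (simp add: p_def inner_commute)
  qed
  have K0: "0 \<le> K" using K[of 0 0] T by (auto intro: order_trans[OF norm_ge_zero])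
  have diff: "(\<integral>s. indicator {0..t} s *\<^sub>R p s m \<partial>lborel) = (cmod (sol \<beta> t m))\<^sup>2 - (cmod (g m))\<^sup>2" for m
  proof -
    have "(\<integral>s. indicator {0..t} s *\<^sub>R p s m \<partial>lborel) = sol \<beta> t m \<bullet> sol \<beta> t m - sol \<beta> 0 m \<bullet> sol \<beta> 0 m"
    proof (rule integral_FTC_Icc)
      fix s assume s: "0 \<le> s" "s \<le> t"
      have "((\<lambda>s. sol \<beta> s m) has_vector_derivative F s m) (at s within {0..t})"
        unfolding F_def using s t
        by (intro has_vector_derivative_within_subset[OF sol_has_vector_derivative]) auto
      from bounded_bilinear.has_vector_derivative[OF bounded_bilinear_inner this this]
      show "((\<lambda>s. sol \<beta> s m \<bullet> sol \<beta> s m) has_vector_derivative p s m) (at s within {0..t})"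
        by (simp add: p_def)
    next
      have "continuous_on {0..T} (\<lambda>s. F s m)"
        unfolding F_def by (rule continuous_on_vf[OF dominated_sol \<beta>c r])
      then have "continuous_on {0..T} (\<lambda>s. p s m)"
        unfolding p_def by (intro continuous_intros continuous_on_sol)
      then show "continuous_on {0..t} (\<lambda>s. p s m)"
        using t by (rule_tac continuous_on_subset) auto
    qed (use t in auto)
    then show ?thesis by (simp add: sol_0 dot_square_norm)
  qed
  have meas: "(\<lambda>(s, m). indicator {0..t} s *\<^sub>R p s m) \<in> borel_measurable (lborel \<Otimes>\<^sub>M CZ)"
  proof (rule measurable_pair_CZ)
    note F_meas[measurable] sol_meas[measurable]
    show "(\<lambda>s. indicator {0..t} s *\<^sub>R p s m) \<in> borel_measurable lborel" for m
      unfolding p_def by simp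
  qed
  \<comment> \<open>One factor of \<open>p\<close> is bounded by \<open>K\<close>, the other has l1
    norm at most \<open>\<bar>lam\<bar> * r ^ 3\<close>, uniformly in time.\<close>
  have fin: "(\<integral>\<^sup>+m. \<integral>\<^sup>+s. ennreal (norm (indicator {0..t} s *\<^sub>R p s m)) \<partial>lborel \<partial>CZ) < \<infinity>"
  proof -
    have "(\<integral>\<^sup>+m. \<integral>\<^sup>+s. ennreal (norm (indicator {0..t} s *\<^sub>R p s m)) \<partial>lborel \<partial>CZ)
        \<le> (\<integral>\<^sup>+m. \<integral>\<^sup>+s. ennreal (2 * K) * (ennreal (cmod (F s m)) * indicator {0..t} s) \<partial>lborel \<partial>CZ)"
    proof (intro nn_integral_mono)
      fix m s
      show "ennreal (norm (indicator {0..t} s *\<^sub>R p s m)) \<le> ennreal (2 * K) * (ennreal (cmod (F s m)) * indicator {0..t} s)"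
        using p_le[of s m] t K0 by (auto simp: indicator_def ennreal_leI simp flip: ennreal_mult)
    qed
    also have "\<dots> = (\<integral>\<^sup>+s. \<integral>\<^sup>+m. ennreal (2 * K) * (ennreal (cmod (F s m)) * indicator {0..t} s) \<partial>CZ \<partial>lborel)"
      using F_meas by (intro nn_integral_swap_CZ sigma_finite_lborel) simp
    also have "\<dots> = (\<integral>\<^sup>+s. ennreal (2 * K) * (l1n (F s) * indicator {0..t} s) \<partial>lborel)"
      by (simp add: nn_integral_cmult nn_integral_multc l1n_def)
    also have "\<dots> \<le> (\<integral>\<^sup>+s\<in>{0..t}. ennreal (2 * K) * ennreal (\<bar>lam\<bar> * r ^ 3) \<partial>lborel)"
    proof (intro nn_integral_mono)
      fix s
      show "ennreal (2 * K) * (l1n (F s) * indicator {0..t} s) \<le> ennreal (2 * K) * ennreal (\<bar>lam\<bar> * r ^ 3) * indicator {0..t} s"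
        using l1n_vf[OF integrable_sol[OF \<beta>, of s] r] t by (auto simp: indicator_def F_def[abs_def] intro!: mult_left_mono)
    qed
    also have "\<dots> < \<infinity>" using t by (simp add: nn_integral_const_Icc ennreal_mult_less_top)
    finally show ?thesis .
  qed
  have zero: "(\<integral>m. indicator {0..t} s *\<^sub>R p s m \<partial>CZ) = 0" for s
  proof (cases "s \<in> {0..t}")
    case True
    then have s: "s \<in> {0..T}" using t by auto
    have w: "integrable CZ (sol \<beta> s)" by (rule integrable_sol[OF \<beta> s])
    have Fi: "integrable CZ (F s)" unfolding F_def[abs_def] using w r by (intro integrable_vf)
    have i: "integrable CZ (\<lambda>m. F s m * cnj (sol \<beta> s m))"
    proof (rule Bochner_Integration.integrable_bound)
      show "integrable CZ (\<lambda>m. K *\<^sub>R F s m)" using Fi by simp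
      show "AE m in CZ. norm (F s m * cnj (sol \<beta> s m)) \<le> norm (K *\<^sub>R F s m)"
        using K[OF s] K0 by (intro AE_I2) (simp add: norm_mult mult.commute[of K] mult_left_mono)
    qed simp
    have "p s m = 2 * Re (F s m * cnj (sol \<beta> s m))" for m
      by (simp add: p_def inner_complex_def)
    then have "(\<integral>m. p s m \<partial>CZ) = 2 * Re (\<integral>m. F s m * cnj (sol \<beta> s m) \<partial>CZ)"
      using i by (simp add: integral_Re del: times_complex.simps)
    also have "\<dots> = 0"
      unfolding F_def using Re_vf_pairing[OF w sol_support[OF supp s]] by simp
    finally show ?thesis by simp
  qed simp
  have "(\<integral>m. (cmod (sol \<beta> t m))\<^sup>2 - (cmod (g m))\<^sup>2 \<partial>CZ) = 0"
    using Fubini_CZ(1)[OF sigma_finite_lborel meas fin] unfolding zero diff by simp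
  then have "(\<integral>m. (cmod (sol \<beta> t m))\<^sup>2 \<partial>CZ) = (\<integral>m. (cmod (g m))\<^sup>2 \<partial>CZ)"
    using integrable_cmod_power2[OF integrable_sol[OF \<beta> t]] integrable_cmod_power2[OF g] by simp
  moreover have "wl2 0 a = ennreal (\<integral>m. (cmod (a m))\<^sup>2 \<partial>CZ)" if "integrable CZ a" for a
    unfolding wl2_def using nn_integral_eq_integral[OF integrable_cmod_power2[OF that]] by simp
  ultimately show ?thesis using g integrable_sol[OF \<beta> t] by simp
qed

end

end

section \<open>Sobolev norms of functions on the torus\<close>

lemma Hdot_sq_eq: "1 \<le> s \<Longrightarrow> Hdot_sq s f = wl2 s (fc f)"
  unfolding Hdot_sq_def wl2_def by (intro nn_integral_cong) auto

lemma Hs_sq_eq: "Hs_sq s f = wl2 0 (fc f) + wl2 s (fc f)"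
proof -
  have "Hs_sq s f = (\<integral>\<^sup>+m. ennreal (real_of_int \<bar>m\<bar> ^ (2 * 0) * (cmod (fc f m))\<^sup>2)
      + ennreal (real_of_int \<bar>m\<bar> ^ (2 * s) * (cmod (fc f m))\<^sup>2) \<partial>CZ)"
    unfolding Hs_sq_def by (intro nn_integral_cong) (simp add: distrib_right)
  then show ?thesis
    unfolding wl2_def by (subst (asm) nn_integral_add) auto
qed

lemma integrable_if_wl2:
  assumes "1 \<le> s" "wl2 s a < \<infinity>"
  shows "integrable CZ a"
proof -
  obtain H where "0 \<le> H" "wl2 s a = ennreal H" using assms(2) by (cases "wl2 s a") auto
  then have "l1n a \<le> ennreal (cmod (a 0) + sqrt (emb_const * H))"
    by (intro l1n_le_wl2[OF assms(1)]) auto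
  then have "l1n a < \<infinity>" by (rule le_less_trans) simp
  then show ?thesis unfolding l1n_finite_iff .
qed

lemma in_Hs_integrable_fc:
  assumes "1 \<le> s" "in_Hs s f"
  shows "integrable CZ (fc f)"
  using assms by (intro integrable_if_wl2[of s]) (auto simp: in_Hs_def Hs_sq_eq)

lemma L2fun_eq_synth:
  assumes "L2fun f" "integrable CZ (fc f)"
  shows "AE x in lborel. x \<in> {0..2*pi} \<longrightarrow> f x = synth (fc f) x"
  using assms by (intro L2fun_fc_cong L2fun_synth) (auto simp: fc_synth)

lemma L2_norm_fc:
  assumes "L2fun f" "integrable CZ (fc f)"
  shows "L2_norm f = sqrt (2 * pi * enn2real (wl2 0 (fc f)))"
proof -
  have [measurable]: "f \<in> borel_measurable borel" using assms by (simp add: L2fun_def)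
  have "(\<integral>x. indicator {0..2*pi} x *\<^sub>R (cmod (f x))\<^sup>2 \<partial>lborel) = (\<integral>x. indicator {0..2*pi} x *\<^sub>R (cmod (synth (fc f) x))\<^sup>2 \<partial>lborel)"
    using L2fun_eq_synth[OF assms] by (intro integral_cong_AE) (auto simp: indicator_def)
  then have "L2_norm f = L2_norm (synth (fc f))"
    by (simp add: L2_norm_def set_lebesgue_integral_def)
  then show ?thesis using L2_norm_synth[OF assms(2)] by simp
qed

text \<open>A function with summable coefficients agrees almost everywhere with its series, for
  which the product formula applies. So the cubic term of an arbitrary competing solution can be
  computed on coefficients.\<close>

lemma fc_cubic:
  assumes "L2fun f" "integrable CZ (fc f)"
  shows "fc (cubic f) m = cube (fc f) m"
proof -
  have [measurable]: "f \<in> borel_measurable borel" using assms by (simp add: L2fun_def)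
  have "(\<integral>x. indicator {0..2*pi} x *\<^sub>R (cubic f x * exp (- (\<i> * of_int m * of_real x))) \<partial>lborel)
      = (\<integral>x. indicator {0..2*pi} x *\<^sub>R (cubic (synth (fc f)) x * exp (- (\<i> * of_int m * of_real x))) \<partial>lborel)"
    unfolding cubic_def
    using L2fun_eq_synth[OF assms] by (intro integral_cong_AE) (auto simp: indicator_def)
  then have "fc (cubic f) m = fc (cubic (synth (fc f))) m"
    by (simp add: fc_def set_lebesgue_integral_def)
  then show ?thesis using assms by (simp add: fc_cubic_synth)
qed

lemma synth_finite_support:
  assumes "finite F" "\<And>m. m \<notin> F \<Longrightarrow> a m = 0"
  shows "synth a x = (\<Sum>m\<in>F. a m * exp (\<i> * of_int m * of_real x))" and "integrable CZ a"
proof -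
  have fin: "finite {m. a m * exp (\<i> * of_int m * of_real x) \<noteq> 0}"
    by (rule finite_subset[OF _ assms(1)]) (use assms(2) in force)
  then show "synth a x = (\<Sum>m\<in>F. a m * exp (\<i> * of_int m * of_real x))"
    unfolding synth_def using assms
    by (subst lebesgue_integral_count_space_finite_support) (auto intro!: sum.mono_neutral_left)
  have "l1n a = (\<Sum>m\<in>F. ennreal (cmod (a m)))"
    unfolding l1n_def using assms by (intro nn_integral_count_space') auto
  also have "\<dots> < \<infinity>" by simp
  finally show "integrable CZ a" unfolding l1n_finite_iff .
qed

text \<open>For \<open>N = \<infinity>\<close> the projection is \<open>f\<close> itself, equal to
  its series only almost everywhere; for finite \<open>N\<close> it is literally a finite
  series.\<close>

lemma L2_norm_projN:
  assumes "L2fun f" "integrable CZ (fc f)"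
  shows "L2_norm (projN N f) = sqrt (2 * pi * enn2real (wl2 0 (\<lambda>m. if inN N m then fc f m else 0)))"
proof (cases N)
  case infinity
  then show ?thesis using L2_norm_fc[OF assms] by (simp add: projN_def inN_def)
next
  case (enat n)
  let ?g = "\<lambda>m. if inN N m then fc f m else 0"
  have J: "inN N m \<longleftrightarrow> m \<in> {- int n..int n}" for m
    using enat by (auto simp: inN_def)
  have "projN N f = synth ?g"
  proof
    fix x
    have "synth ?g x = (\<Sum>m\<in>{- int n..int n}. ?g m * exp (\<i> * of_int m * of_real x))"
      by (rule synth_finite_support) (auto simp: J)
    also have "\<dots> = (\<Sum>m\<in>{- int n..int n}. fc f m * exp (\<i> * of_int m * of_real x))"
      by (intro sum.cong) (auto simp: J)
    finally show "projN N f x = synth ?g x" using enat by (simp add: projN_def)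
  qed
  moreover have "integrable CZ ?g"
    by (rule synth_finite_support(2)[of "{- int n..int n}"]) (auto simp: J)
  ultimately show ?thesis by (simp add: L2_norm_synth)
qed

lemma fc_synth_diff:
  "integrable CZ a \<Longrightarrow> integrable CZ b \<Longrightarrow> fc (\<lambda>x. synth a x - synth b x) m = a m - b m"
  by (simp add: fc_diff L2fun_synth fc_synth)

lemma Hs_norm_eq_integral:
  "Hs_norm s f = sqrt (\<integral>m. (1 + real_of_int \<bar>m\<bar> ^ (2 * s)) * (cmod (fc f m))\<^sup>2 \<partial>CZ)"
  unfolding Hs_norm_def Hs_sq_def by (subst integral_eq_nn_integral) auto

text \<open>The terms of the squared norm of an increment are dominated by four times the weighted
  squares of \<open>D\<close>, so continuity at \<open>t\<close> is dominated convergence to the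
  value 0.\<close>

lemma C_Hs_synth:
  assumes "dominated_family {0..T} a D"
    and D: "wl2 0 (\<lambda>m. complex_of_real (D m)) < \<infinity>" "wl2 s (\<lambda>m. complex_of_real (D m)) < \<infinity>"
  shows "C_Hs s T (\<lambda>t. synth (a t))"
proof -
  interpret dominated_family "{0..T}" a D by fact
  have "Hs_sq s (synth (a t)) < \<infinity>" if t: "t \<in> {0..T}" for t
  proof -
    have le: "cmod (a t m) \<le> cmod (complex_of_real (D m))" for m
      using dom[OF t, of m] by simp
    have "fc (synth (a t)) = a t" by (intro ext fc_synth integrable_a t)
    then show ?thesis
      using le_less_trans[OF wl2_mono[OF le] D(1)] le_less_trans[OF wl2_mono[OF le] D(2)]
      by (simp add: Hs_sq_eq)
  qed
  then have 1: "in_Hs s (synth (a t))" if "t \<in> {0..T}" for t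
    using that by (simp add: in_Hs_def L2fun_synth integrable_a)
  have 2: "\<exists>d>0. \<forall>t'\<in>{0..T}. \<bar>t' - t\<bar> < d \<longrightarrow> Hs_norm s (\<lambda>x. synth (a t') x - synth (a t) x) < e"
    if t: "t \<in> {0..T}" and e: "0 < e" for t e
  proof -
    define f where "f t' m = (1 + real_of_int \<bar>m\<bar> ^ (2 * s)) * (cmod (a t' m - a t m))\<^sup>2" for t' m
    define E where "E m = (1 + real_of_int \<bar>m\<bar> ^ (2 * s)) * (4 * (D m)\<^sup>2)" for m
    have c: "continuous_on {0..T} (\<lambda>t'. sqrt (\<integral>m. f t' m \<partial>CZ))"
    proof (intro continuous_on_real_sqrt continuous_on_integral_CZ[where D = E])
      show "continuous_on {0..T} (\<lambda>t'. f t' m)" for m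
        unfolding f_def by (intro continuous_intros cont)
      show "norm (f t' m) \<le> E m" if t': "t' \<in> {0..T}" for t' m
      proof -
        have "cmod (a t' m - a t m) \<le> 2 * D m"
          using norm_triangle_ineq4[of "a t' m" "a t m"] dom[OF t, of m] dom[OF t', of m] by linarith
        then have "(cmod (a t' m - a t m))\<^sup>2 \<le> (2 * D m)\<^sup>2" by (intro power_mono) auto
        then show ?thesis
          unfolding f_def E_def by (simp add: power_mult_distrib mult_left_mono)
      qed
      have "(\<integral>\<^sup>+m. ennreal (E m) \<partial>CZ) = 4 * (wl2 0 (\<lambda>m. complex_of_real (D m)) + wl2 s (\<lambda>m. complex_of_real (D m)))"
      proof -
        have "ennreal (E m) = 4 * (ennreal (real_of_int \<bar>m\<bar> ^ (2 * 0) * (cmod (complex_of_real (D m)))\<^sup>2)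
            + ennreal (real_of_int \<bar>m\<bar> ^ (2 * s) * (cmod (complex_of_real (D m)))\<^sup>2))" for m
        proof -
          have "E m = 4 * (real_of_int \<bar>m\<bar> ^ (2 * 0) * (cmod (complex_of_real (D m)))\<^sup>2
            + real_of_int \<bar>m\<bar> ^ (2 * s) * (cmod (complex_of_real (D m)))\<^sup>2)"
            by (simp add: E_def algebra_simps)
          then show ?thesis by (simp add: ennreal_mult')
        qed
        then show ?thesis
          unfolding wl2_def by (simp add: nn_integral_cmult nn_integral_add)
      qed
      also have "\<dots> < \<infinity>" using D by (simp add: ennreal_mult_less_top)
      finally show "integrable CZ E"
        by (intro integrableI_nonneg) (auto simp: E_def)
    qed
    have "sqrt (\<integral>m. f t m \<partial>CZ) = 0" by (simp add: f_def)
    with c t e obtain d where "0 < d" "\<And>t'. t' \<in> {0..T} \<Longrightarrow> dist t' t < d \<Longrightarrow> dist (sqrt (\<integral>m. f t' m \<partial>CZ)) 0 < e"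
      unfolding continuous_on_iff by metis
    then show ?thesis
      using t by (intro exI[of _ d]) (auto simp: dist_real_def Hs_norm_eq_integral f_def fc_synth_diff integrable_a)
  qed
  show ?thesis unfolding C_Hs_def using 1 2 by blast
qed

lemma nrm_le_Hs_norm:
  assumes "1 \<le> s" "Hs_sq s f < \<infinity>"
  shows "nrm (fc f) \<le> (1 + sqrt emb_const) * Hs_norm s f"
proof -
  define h where "h = Hs_norm s f"
  have h: "0 \<le> h" by (simp add: h_def Hs_norm_def)
  have H: "Hs_sq s f = ennreal (h\<^sup>2)"
    using assms(2) by (simp add: h_def Hs_norm_def less_top)
  have w: "wl2 0 (fc f) \<le> ennreal (h\<^sup>2)" "wl2 s (fc f) \<le> ennreal (h\<^sup>2)"
    unfolding H[symmetric] Hs_sq_eq by (auto simp: add_increasing add_increasing2)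
  have "ennreal ((cmod (fc f 0))\<^sup>2) \<le> wl2 0 (fc f)"
    unfolding wl2_def by (rule order_trans[OF _ nn_integral_ge_point[of 0]]) auto
  then have "(cmod (fc f 0))\<^sup>2 \<le> h\<^sup>2" using w(1) by (metis ennreal_le_iff order_trans zero_le_power2)
  then have c0: "cmod (fc f 0) \<le> h" using h by (simp add: power2_le_iff_abs_le)
  have "l1n (fc f) \<le> ennreal (cmod (fc f 0) + sqrt (emb_const * h\<^sup>2))"
    by (intro l1n_le_wl2[OF assms(1)] w) simp
  then have "nrm (fc f) \<le> cmod (fc f 0) + sqrt (emb_const * h\<^sup>2)"
    unfolding nrm_def by (intro enn2real_leI) (auto simp: h)
  also have "\<dots> \<le> h + sqrt emb_const * h" using c0 h by (simp add: real_sqrt_mult)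
  finally show ?thesis by (simp add: h_def algebra_simps)
qed

text \<open>The embedding of the Sobolev space into summable sequences translates
  \<open>C_Hs\<close> to coefficients: they move continuously in l1, and compactness of the interval
  bounds their norm.\<close>

lemma C_Hs_fc:
  assumes s: "1 \<le> s" and T: "0 \<le> T" and v: "C_Hs s T v"
  shows "\<And>t. t \<in> {0..T} \<Longrightarrow> L2fun (v t)"
    and "\<And>t. t \<in> {0..T} \<Longrightarrow> integrable CZ (fc (v t))"
    and "continuous_on {0..T} (\<lambda>t. fc (v t) m)"
    and "\<exists>K. \<forall>t\<in>{0..T}. nrm (fc (v t)) \<le> K"
proof -
  have Hs: "in_Hs s (v t)" if "t \<in> {0..T}" for t using v that by (simp add: C_Hs_def)
  show L: "L2fun (v t)" if "t \<in> {0..T}" for t using Hs[OF that] by (simp add: in_Hs_def)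
  show I: "integrable CZ (fc (v t))" if "t \<in> {0..T}" for t
    by (rule in_Hs_integrable_fc[OF s Hs[OF that]])
  define C where "C = 1 + sqrt emb_const"
  have C: "0 < C" by (simp add: C_def add_pos_nonneg)
  have close: "\<exists>d>0. \<forall>t'\<in>{0..T}. \<bar>t' - t\<bar> < d \<longrightarrow> nrm (\<lambda>m. fc (v t') m - fc (v t) m) < e"
    if t: "t \<in> {0..T}" and e: "0 < e" for t e
  proof -
    from v t have "\<forall>e>0. \<exists>d>0. \<forall>t'\<in>{0..T}. \<bar>t' - t\<bar> < d \<longrightarrow> Hs_norm s (\<lambda>x. v t' x - v t x) < e"
      by (simp add: C_Hs_def)
    then obtain d where d: "0 < d" "\<And>t'. t' \<in> {0..T} \<Longrightarrow> \<bar>t' - t\<bar> < d \<Longrightarrow> Hs_norm s (\<lambda>x. v t' x - v t x) < e / C"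
      using divide_pos_pos[OF e C] by meson
    have "nrm (\<lambda>m. fc (v t') m - fc (v t) m) < e" if t': "t' \<in> {0..T}" "\<bar>t' - t\<bar> < d" for t'
    proof -
      have f: "fc (\<lambda>x. v t' x - v t x) = (\<lambda>m. fc (v t') m - fc (v t) m)"
        by (intro ext fc_diff L t t')
      have "wl2 k (\<lambda>m. fc (v t') m - fc (v t) m) < \<infinity>" if "wl2 k (fc (v t)) < \<infinity>" "wl2 k (fc (v t')) < \<infinity>" for k
      proof -
        have "wl2 k (\<lambda>m. fc (v t') m + (- fc (v t) m)) \<le> 2 * wl2 k (fc (v t')) + 2 * wl2 k (\<lambda>m. - fc (v t) m)"
          by (rule wl2_add)
        also have "wl2 k (\<lambda>m. - fc (v t) m) = wl2 k (fc (v t))" by (simp add: wl2_def)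
        also have "2 * wl2 k (fc (v t')) + 2 * wl2 k (fc (v t)) < \<infinity>"
          using that by (simp add: ennreal_mult_less_top)
        finally show ?thesis by simp
      qed
      then have "Hs_sq s (\<lambda>x. v t' x - v t x) < \<infinity>"
        using Hs[OF t] Hs[OF t'(1)] by (simp add: Hs_sq_eq f in_Hs_def)
      from nrm_le_Hs_norm[OF s this] have "nrm (\<lambda>m. fc (v t') m - fc (v t) m) \<le> C * Hs_norm s (\<lambda>x. v t' x - v t x)"
        by (simp add: f C_def)
      also have "\<dots> < C * (e / C)" using d(2)[OF t'] C by (intro mult_strict_left_mono)
      finally show ?thesis using C by simp
    qed
    with d(1) show ?thesis by blast
  qed
  show "continuous_on {0..T} (\<lambda>t. fc (v t) m)"
    unfolding continuous_on_iff
  proof (intro ballI allI impI)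
    fix t e :: real assume t: "t \<in> {0..T}" and e: "0 < e"
    obtain d where d: "0 < d" "\<And>t'. t' \<in> {0..T} \<Longrightarrow> \<bar>t' - t\<bar> < d \<Longrightarrow> nrm (\<lambda>m. fc (v t') m - fc (v t) m) < e"
      using close[OF t e] by blast
    have "cmod (fc (v t') m - fc (v t) m) < e" if "t' \<in> {0..T}" "\<bar>t' - t\<bar> < d" for t'
    proof -
      have "integrable CZ (\<lambda>m. fc (v t') m - fc (v t) m)" using I t that by simp
      then have "cmod (fc (v t') m - fc (v t) m) \<le> nrm (\<lambda>m. fc (v t') m - fc (v t) m)"
        using cmod_le_l1n[of "\<lambda>m. fc (v t') m - fc (v t) m" m] by (simp add: l1n_eq_nrm)
      with d(2)[OF that] show ?thesis by simp
    qed
    with d(1) show "\<exists>d>0. \<forall>x'\<in>{0..T}. dist x' t < d \<longrightarrow> dist (fc (v x') m) (fc (v t) m) < e"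
      by (auto simp: dist_norm)
  qed
  have "continuous_on {0..T} (\<lambda>t. nrm (fc (v t)))"
    unfolding continuous_on_iff
  proof (intro ballI allI impI)
    fix t e :: real assume t: "t \<in> {0..T}" and e: "0 < e"
    obtain d where d: "0 < d" "\<And>t'. t' \<in> {0..T} \<Longrightarrow> \<bar>t' - t\<bar> < d \<Longrightarrow> nrm (\<lambda>m. fc (v t') m - fc (v t) m) < e"
      using close[OF t e] by blast
    have "\<bar>nrm (fc (v t')) - nrm (fc (v t))\<bar> < e" if "t' \<in> {0..T}" "\<bar>t' - t\<bar> < d" for t'
      using nrm_diff_abs[OF I[OF that(1)] I[OF t]] d(2)[OF that] by simp
    with d(1) show "\<exists>d>0. \<forall>x'\<in>{0..T}. dist x' t < d \<longrightarrow> dist (nrm (fc (v x'))) (nrm (fc (v t))) < e"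
      by (auto simp: dist_norm)
  qed
  then have "compact ((\<lambda>t. nrm (fc (v t))) ` {0..T})" by (intro compact_continuous_image) auto
  then have "bounded ((\<lambda>t. nrm (fc (v t))) ` {0..T})" by (rule compact_imp_bounded)
  then show "\<exists>K. \<forall>t\<in>{0..T}. nrm (fc (v t)) \<le> K"
    unfolding bounded_iff by (auto simp: abs_le_iff)
qed

section \<open>Mild form and uniqueness along a path\<close>

lemma vf_untruncated:
  assumes "nrm w \<le> r" "0 < r"
  shows "vf lam r J b w m = (if J m then \<i> * of_real lam * (ph (- b) m * cube (rot b w) m) else 0)"
  using assms by (simp add: vf_def trunc_cubic_def cut_eq)

text \<open>Multiplying by the unimodular \<open>ph (- b t) m\<close> and splitting
  \<open>b t - b s\<close> turns one equation into the other; the truncation is invisible along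
  \<open>w\<close>, whose norm never exceeds \<open>r\<close>.\<close>

lemma mild_iff_interaction_picture:
  fixes b :: "real \<Rightarrow> real"
  assumes "\<And>s. s \<in> {0..t} \<Longrightarrow> nrm (w s) \<le> r" "0 < r"
  shows "rot (b t) (w t) m = ph (b t) m * g m + \<i> * of_real lam * set_lebesgue_integral lborel {0..t}
      (\<lambda>s. if J m then ph (b t - b s) m * cube (rot (b s) (w s)) m else 0)
    \<longleftrightarrow> w t m = g m + duhamel lam r J b w t m"
proof -
  let ?f = "\<lambda>s. if J m then ph (b t - b s) m * cube (rot (b s) (w s)) m else 0"
  define Y where "Y = \<i> * of_real lam * set_lebesgue_integral lborel {0..t} ?f"
  have ph: "ph (- c) m = ph (- b t) m * ph (b t - c) m" for c
    using ph_add[of "- b t" "b t - c" m] by simp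
  have "duhamel lam r J b w t m
      = (\<integral>s. (ph (- b t) m * (\<i> * of_real lam)) * (indicator {0..t} s *\<^sub>R ?f s) \<partial>lborel)"
    unfolding set_lebesgue_integral_def
  proof (intro Bochner_Integration.integral_cong refl)
    fix s
    show "indicator {0..t} s *\<^sub>R vf lam r J (b s) (w s) m = (ph (- b t) m * (\<i> * of_real lam)) * (indicator {0..t} s *\<^sub>R ?f s)"
    proof (cases "s \<in> {0..t}")
      case True
      then show ?thesis
        using vf_untruncated[OF assms(1)[OF True] assms(2)] ph[of "b s"] by (simp add: mult_ac)
    qed simp
  qed
  also have "\<dots> = ph (- b t) m * Y"
    unfolding Y_def set_lebesgue_integral_def by (simp only: integral_mult_right_zero mult.assoc)
  finally have I: "duhamel lam r J b w t m = ph (- b t) m * Y" .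
  have inv: "ph (b t) m * (ph (- b t) m * z) = z" "ph (- b t) m * (ph (b t) m * z) = z" for z
    by (simp_all flip: mult.assoc)
  have "ph (b t) m * w t m = ph (b t) m * g m + Y \<longleftrightarrow> w t m = g m + ph (- b t) m * Y"
  proof
    assume "ph (b t) m * w t m = ph (b t) m * g m + Y"
    then have "ph (- b t) m * (ph (b t) m * w t m) = ph (- b t) m * (ph (b t) m * g m + Y)" by simp
    then show "w t m = g m + ph (- b t) m * Y" by (simp add: distrib_left inv)
  next
    assume "w t m = g m + ph (- b t) m * Y"
    then show "ph (b t) m * w t m = ph (b t) m * g m + Y" by (simp add: distrib_left inv)
  qed
  then show ?thesis unfolding I rot_def[of "b t"] Y_def[symmetric] .
qed

text \<open>Approximation from below keeps times in \<open>[0, T]\<close>, and its countable range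
  serves both for rational times and for joint measurability.\<close>

lemma floor_quotient_approx:
  fixes t :: real
  shows "of_int \<lfloor>real (Suc n) * t\<rfloor> / real (Suc n) \<le> t"
    and "(\<lambda>n. of_int \<lfloor>real (Suc n) * t\<rfloor> / real (Suc n)) \<longlonglongrightarrow> t"
proof -
  define q where "q n = of_int \<lfloor>real (Suc n) * t\<rfloor> / real (Suc n)" for n
  have q: "q n \<le> t" "t - q n \<le> 1 / real (Suc n)" for n
  proof -
    have "of_int \<lfloor>real (Suc n) * t\<rfloor> \<le> real (Suc n) * t" by linarith
    then show "q n \<le> t" unfolding q_def by (simp add: field_simps)
    have "real (Suc n) * t - of_int \<lfloor>real (Suc n) * t\<rfloor> \<le> 1" by linarith
    then have "(real (Suc n) * t - of_int \<lfloor>real (Suc n) * t\<rfloor>) / real (Suc n) \<le> 1 / real (Suc n)"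
      by (rule divide_right_mono) simp
    then show "t - q n \<le> 1 / real (Suc n)" unfolding q_def by (simp add: diff_divide_distrib)
  qed
  have "(\<lambda>n. t - q n) \<longlonglongrightarrow> 0"
    by (rule tendsto_sandwich[of "\<lambda>_. 0" _ _ "\<lambda>n. 1 / real (Suc n)"])
       (use q in \<open>auto intro!: always_eventually LIMSEQ_Suc[OF lim_1_over_n] simp del: of_nat_Suc\<close>)
  then have "(\<lambda>n. t - (t - q n)) \<longlonglongrightarrow> t - 0" by (intro tendsto_diff tendsto_const)
  then show "(\<lambda>n. of_int \<lfloor>real (Suc n) * t\<rfloor> / real (Suc n)) \<longlonglongrightarrow> t" by (simp add: q_def)
  show "of_int \<lfloor>real (Suc n) * t\<rfloor> / real (Suc n) \<le> t" using q(1) by (simp add: q_def)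
qed

lemma continuous_on_eq_on_rationals:
  fixes f h :: "real \<Rightarrow> complex"
  assumes "continuous_on {0..T} f" "continuous_on {0..T} h"
    and eq: "\<And>t. t \<in> {0..T} \<Longrightarrow> t \<in> \<rat> \<Longrightarrow> f t = h t" and t: "t \<in> {0..T}"
  shows "f t = h t"
proof -
  define q where "q n = of_int \<lfloor>real (Suc n) * t\<rfloor> / real (Suc n)" for n
  have q: "q n \<le> t" "q \<longlonglongrightarrow> t" for n
    unfolding q_def by (rule floor_quotient_approx)+
  have q0: "0 \<le> q n" and qQ: "q n \<in> \<rat>" for n
    using t unfolding q_def by (auto intro!: divide_nonneg_nonneg Rats_divide simp del: of_nat_Suc)
  have qT: "q n \<in> {0..T}" for n using q(1)[of n] q0[of n] t by auto
  have "(\<lambda>n. f (q n)) \<longlonglongrightarrow> f t" "(\<lambda>n. h (q n)) \<longlonglongrightarrow> h t"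
    using assms(1,2) q(2) qT t by (auto simp: continuous_on_sequentially o_def)
  moreover have "f (q n) = h (q n)" for n using eq qT qQ by blast
  ultimately show ?thesis using LIMSEQ_unique by simp
qed

text \<open>The competitor \<open>y\<close> may exceed the radius \<open>r\<close>. At
  \<open>R = max r K\<close> the truncation is inactive for both solutions, and they coincide by
  uniqueness for the equation truncated at \<open>R\<close>. The equation for \<open>y\<close> is
  supposed at rational times, which is what one null set can provide.\<close>

lemma mild_unique_path:
  fixes b :: "real \<Rightarrow> real"
  assumes b [measurable]: "b \<in> borel_measurable borel" and bc: "continuous_on {0..T} b"
    and T: "0 \<le> T" and g: "integrable CZ g"
    and y: "\<And>t. t \<in> {0..T} \<Longrightarrow> integrable CZ (y t)" "\<And>m. continuous_on {0..T} (\<lambda>t. y t m)"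
      "\<And>t. t \<in> {0..T} \<Longrightarrow> nrm (y t) \<le> K"
    and y_eq: "\<And>t m. t \<in> {0..T} \<Longrightarrow> t \<in> \<rat> \<Longrightarrow> y t m = ph (b t) m * g m + \<i> * of_real lam * set_lebesgue_integral lborel {0..t}
      (\<lambda>s. if J m then ph (b t - b s) m * cube (y s) m else 0)"
    and z: "\<And>m. (\<lambda>t. z t m) \<in> borel_measurable borel" "\<And>t. t \<in> {0..T} \<Longrightarrow> integrable CZ (z t)"
      "\<And>t. t \<in> {0..T} \<Longrightarrow> nrm (z t) \<le> r" "0 < r"
    and z_eq: "\<And>t m. t \<in> {0..T} \<Longrightarrow> z t m = g m + duhamel lam r J b z t m"
    and t: "t \<in> {0..T}"
  shows "y t m = rot (b t) (z t) m"
proof -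
  define R where "R = max r K"
  have R: "0 < R" "r \<le> R" "K \<le> R" using z(4) by (auto simp: R_def)
  interpret E: truncated_equation lam R T J g
    by unfold_locales (use R T g in auto)
  \<comment> \<open>Fixing the value outside \<open>[0, T]\<close> makes the path Borel on the whole
    line.\<close>
  define w where "w t m = (if t \<in> {0..T} then ph (- b t) m * y t m else 0)" for t m
  have wr: "rot (b t) (w t) = y t" if "t \<in> {0..T}" for t
    using that by (auto simp: rot_def w_def simp flip: mult.assoc)
  have wy: "w t = rot (- b t) (y t)" if "t \<in> {0..T}" for t
    using that by (auto simp: rot_def w_def)
  have wc: "continuous_on {0..T} (\<lambda>t. ph (- b t) m * y t m)" for m
    by (intro continuous_intros continuous_on_ph[of _ "\<lambda>t. - b t"] bc y)
  have wm: "(\<lambda>t. w t m) \<in> borel_measurable borel" for m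
    unfolding w_def by (intro borel_measurable_continuous_on_if wc continuous_on_const) auto
  have wi: "integrable CZ (w t)" if "t \<in> {0..T}" for t using wy[OF that] y(1)[OF that] by simp
  have wn: "nrm (w t) \<le> R" if "t \<in> {0..T}" for t using wy[OF that] y(3)[OF that] R by simp
  have w_rat: "w t m = g m + duhamel lam R J b w t m"
    if t: "t \<in> {0..T}" "t \<in> \<rat>" for t m
  proof (rule mild_iff_interaction_picture[THEN iffD1])
    show "nrm (w s) \<le> R" if "s \<in> {0..t}" for s using wn[of s] that t by auto
    have "set_lebesgue_integral lborel {0..t} (\<lambda>s. if J m then ph (b t - b s) m * cube (rot (b s) (w s)) m else 0)
        = set_lebesgue_integral lborel {0..t} (\<lambda>s. if J m then ph (b t - b s) m * cube (y s) m else 0)"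
      using t wr by (intro set_lebesgue_integral_cong) auto
    then show "rot (b t) (w t) m = ph (b t) m * g m + \<i> * of_real lam * set_lebesgue_integral lborel {0..t}
      (\<lambda>s. if J m then ph (b t - b s) m * cube (rot (b s) (w s)) m else 0)"
      using y_eq[OF t] wr[OF t(1)] by simp
  qed (rule R(1))
  have wI: "set_integrable lborel {0..t} (\<lambda>s. vf lam R J (b s) (w s) m)" if "t \<in> {0..T}" for t m
    using that by (intro E.set_integrable_vf[OF b wm] wi) auto
  \<comment> \<open>Both sides are continuous in \<open>t\<close>, so equality extends from the
    rational times.\<close>
  have w_eq: "w t m = g m + duhamel lam R J b w t m" if t: "t \<in> {0..T}" for t m
  proof -
    let ?F = "\<lambda>s. vf lam R J (b s) (w s) m"
    have "continuous_on {0..T} (\<lambda>t. g m + integral {0..t} ?F)"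
      using set_borel_integral_eq_integral(1)[OF wI[of T]] T
      by (intro continuous_intros indefinite_integral_continuous_1) auto
    moreover have "continuous_on {0..T} (\<lambda>t. w t m)"
      using wc by (rule continuous_on_eq) (simp add: w_def)
    ultimately have "w t m = g m + integral {0..t} ?F"
      using w_rat set_borel_integral_eq_integral(2)[OF wI]
      by (intro continuous_on_eq_on_rationals[of T "\<lambda>t. w t m" "\<lambda>t. g m + integral {0..t} ?F" t] t) auto
    then show ?thesis using set_borel_integral_eq_integral(2)[OF wI[OF t]] by simp
  qed
  have z_eq': "z t m = g m + duhamel lam R J b z t m" if t: "t \<in> {0..T}" for t m
  proof -
    have "duhamel lam R J b z t m = duhamel lam r J b z t m"
    proof (intro set_lebesgue_integral_cong allI impI)
      fix s assume "s \<in> {0..t}"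
      then have s: "s \<in> {0..T}" using t by auto
      have "nrm (z s) \<le> R" using z(3)[OF s] R by simp
      then show "vf lam R J (b s) (z s) m = vf lam r J (b s) (z s) m"
        using vf_untruncated[OF z(3)[OF s] z(4)] vf_untruncated[OF _ R(1)] by simp
    qed simp
    then show ?thesis using z_eq[OF t] by simp
  qed
  have "w t m = z t m" for m
    by (rule E.truncated_unique[OF b wm wi z(1,2) w_eq z_eq' t])
  then show ?thesis using wr[OF t] by (metis rot_def)
qed

text \<open>Conserved mass bounds the zero mode by \<open>q\<close> and smallness bounds the sum of
  the others by 1. Both estimates are available for the truncated solution at all times, so there is
  no first exit time to exclude.\<close>

lemma (in truncated_equation) sol_nrm_le:
  assumes b: "b \<in> borel_measurable borel" "continuous_on {0..T} b"
    and supp: "\<And>m. \<not> J m \<Longrightarrow> g m = 0" and s: "1 \<le> s"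
    and q: "wl2 0 g \<le> ennreal (q\<^sup>2)" "0 \<le> q" "q + 1 \<le> r"
    and h: "wl2 s g \<le> ennreal h" "0 \<le> h"
      "emb_const * (2 * h * exp (2 * T * (lam\<^sup>2 * (wl2_tri_const s * r ^ 4)) * T)) \<le> 1"
    and t: "t \<in> {0..T}"
  shows "nrm (sol b t) \<le> r"
proof -
  have "ennreal ((cmod (sol b t 0))\<^sup>2) \<le> wl2 0 (sol b t)"
    unfolding wl2_def by (rule order_trans[OF _ nn_integral_ge_point[of 0]]) auto
  also have "\<dots> \<le> ennreal (q\<^sup>2)" using sol_mass[OF b supp t] q(1) by simp
  finally have "(cmod (sol b t 0))\<^sup>2 \<le> q\<^sup>2" by simp
  then have c0: "cmod (sol b t 0) \<le> q" using q by (simp add: power2_le_iff_abs_le)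
  have "l1n (sol b t) \<le> ennreal (cmod (sol b t 0) + sqrt (emb_const * (2 * h * exp (2 * T * (lam\<^sup>2 * (wl2_tri_const s * r ^ 4)) * T))))"
    using h by (intro l1n_le_wl2[OF s] wl2_sol[OF b(1) _ _ t]) auto
  also have "\<dots> \<le> ennreal r"
    using c0 q h(3) by (intro ennreal_leI) (smt (verit) real_sqrt_le_1_iff)
  finally show ?thesis unfolding nrm_def using r by (intro enn2real_leI) auto
qed

section \<open>Regularity of the driving paths\<close>

text \<open>The linear pieces have to match at the integers. Near an integer \<open>k\<close> the
  interpolation is a single formula in the positive and negative parts of
  \<open>y - k\<close>.\<close>

lemma continuous_interpolation:
  fixes F :: "int \<Rightarrow> real"
  shows "continuous_on UNIV (\<lambda>x::real. F \<lfloor>x\<rfloor> + (x - of_int \<lfloor>x\<rfloor>) * (F (\<lfloor>x\<rfloor> + 1) - F \<lfloor>x\<rfloor>))"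
proof (intro continuous_at_imp_continuous_on ballI)
  fix x :: real
  \<comment> \<open>A nearest integer, so that the open interval of radius 1 around it contains
    \<open>x\<close> and no other kink.\<close>
  define k where "k = \<lfloor>x + 1/2\<rfloor>"
  let ?S = "{of_int k - 1<..<of_int k + 1 :: real}"
  let ?h = "\<lambda>x::real. F \<lfloor>x\<rfloor> + (x - of_int \<lfloor>x\<rfloor>) * (F (\<lfloor>x\<rfloor> + 1) - F \<lfloor>x\<rfloor>)"
  have x: "x \<in> ?S" unfolding k_def greaterThanLessThan_iff by linarith
  have "continuous_on ?S (\<lambda>y. F k + max 0 (y - of_int k) * (F (k + 1) - F k) + min 0 (y - of_int k) * (F k - F (k - 1)))"
    by (intro continuous_intros)
  then have "continuous_on ?S ?h"
  proof (rule continuous_on_eq)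
    fix y assume y: "y \<in> ?S"
    show "F k + max 0 (y - of_int k) * (F (k + 1) - F k) + min 0 (y - of_int k) * (F k - F (k - 1)) = ?h y"
    proof (cases "of_int k \<le> y")
      case True
      then have "\<lfloor>y\<rfloor> = k" using y by (intro floor_unique) auto
      then show ?thesis using True by simp
    next
      case False
      then have f: "\<lfloor>y\<rfloor> = k - 1" using y by (intro floor_unique) auto
      show ?thesis unfolding f using False by (simp add: algebra_simps)
    qed
  qed
  then show "isCont ?h x" using x by (simp add: continuous_on_eq_continuous_at)
qed

lemma continuous_on_clipB:
  assumes "continuous_on {0..} (\<lambda>t. B t \<omega>)"
  shows "continuous_on {0..} (\<lambda>t. clipB R B t \<omega>)"
  unfolding clipB_def using assms by (cases "R = \<infinity>") (auto intro!: continuous_intros)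

text \<open>Using \<open>max 0 t\<close> extends the path to the real line and removes the boundary
  at time 0. In the time unit \<delta> the process is the interpolation of its values at the
  integers.\<close>

lemma continuous_on_WZ_B:
  assumes "continuous_on {0..} (\<lambda>t. B t \<omega>)" "0 \<le> \<delta>"
  shows "continuous_on UNIV (\<lambda>t. WZ_B \<delta> R B (max 0 t) \<omega>)"
proof (cases "\<delta> = 0")
  case True
  have "continuous_on UNIV (\<lambda>t. clipB R B (max 0 t) \<omega>)"
    by (rule continuous_on_compose2[OF continuous_on_clipB[of B \<omega> R, OF assms(1)]]) (auto intro!: continuous_intros)
  then show ?thesis using True by (simp add: WZ_B_def)
next
  case False
  then have d: "0 < \<delta>" using assms(2) by simp
  define F where "F k = clipB R B (\<delta> * of_int k) \<omega>" for k
  let ?h = "\<lambda>x::real. F \<lfloor>x\<rfloor> + (x - of_int \<lfloor>x\<rfloor>) * (F (\<lfloor>x\<rfloor> + 1) - F \<lfloor>x\<rfloor>)"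
  have "WZ_B \<delta> R B t \<omega> = ?h (t / \<delta>)" for t
  proof -
    have "(t - \<delta> * of_int \<lfloor>t / \<delta>\<rfloor>) / \<delta> = t / \<delta> - of_int \<lfloor>t / \<delta>\<rfloor>" using d by (simp add: field_simps)
    moreover have "\<delta> * of_int \<lfloor>t / \<delta>\<rfloor> + \<delta> = \<delta> * of_int (\<lfloor>t / \<delta>\<rfloor> + 1)" by (simp add: algebra_simps)
    ultimately show ?thesis using False unfolding WZ_B_def F_def floor_d_def by simp
  qed
  moreover have "continuous_on UNIV (\<lambda>t. ?h (max 0 t / \<delta>))"
    by (rule continuous_on_compose2[OF continuous_interpolation[of F]]) (use d in \<open>auto intro!: continuous_intros\<close>)
  ultimately show ?thesis by simp
qed

lemma measurable_WZ_B:
  assumes B: "\<And>t. 0 \<le> t \<Longrightarrow> B t \<in> borel_measurable M" and "0 \<le> \<delta>" "0 \<le> t"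
  shows "(\<lambda>\<omega>. WZ_B \<delta> R B t \<omega>) \<in> borel_measurable M"
proof -
  have c: "(\<lambda>\<omega>. clipB R B t \<omega>) \<in> borel_measurable M" if "0 \<le> t" for t
    using B[OF that] unfolding clipB_def by (cases "R = \<infinity>") auto
  show ?thesis
  proof (cases "\<delta> = 0")
    case True
    then show ?thesis using c[OF assms(3)] by (simp add: WZ_B_def)
  next
    case False
    have f: "0 \<le> floor_d \<delta> t" unfolding floor_d_def using assms by (intro mult_nonneg_nonneg) auto
    then have "0 \<le> floor_d \<delta> t + \<delta>" using assms by simp
    from c[OF f] c[OF this] show ?thesis using False unfolding WZ_B_def by simp
  qed
qed

text \<open>The Caratheodory argument: a process with continuous paths is the limit of its values at
  discretised times, which are jointly measurable because they take countably many values.\<close>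

lemma measurable_pair_continuous:
  fixes \<beta> :: "'a \<Rightarrow> real \<Rightarrow> real"
  assumes m: "\<And>t. (\<lambda>\<omega>. \<beta> \<omega> t) \<in> borel_measurable M"
    and c: "\<And>\<omega>. \<omega> \<in> space M \<Longrightarrow> continuous_on UNIV (\<beta> \<omega>)"
  shows "(\<lambda>(t, \<omega>). \<beta> \<omega> t) \<in> borel_measurable (borel \<Otimes>\<^sub>M M)"
proof (rule borel_measurable_LIMSEQ_metric)
  define q where "q n t = of_int \<lfloor>real (Suc n) * t\<rfloor> / real (Suc n)" for n :: nat and t :: real
  show "(\<lambda>p. \<beta> (snd p) (q n (fst p))) \<in> borel_measurable (borel \<Otimes>\<^sub>M M)" for n
    unfolding q_def
  proof (rule measurable_compose_countable[where f = "\<lambda>k p. \<beta> (snd p) (of_int k / real (Suc n))"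
        and g = "\<lambda>p. \<lfloor>real (Suc n) * fst p\<rfloor>"])
    show "(\<lambda>p. \<beta> (snd p) (of_int k / real (Suc n))) \<in> borel_measurable (borel \<Otimes>\<^sub>M M)" for k
      by (rule measurable_compose[OF measurable_snd m])
    show "(\<lambda>p. \<lfloor>real (Suc n) * fst p\<rfloor>) \<in> measurable (borel \<Otimes>\<^sub>M M) (count_space UNIV)"
      by measurable
  qed
  fix p :: "real \<times> 'a" assume p: "p \<in> space (borel \<Otimes>\<^sub>M M)"
  obtain t \<omega> where tw: "p = (t, \<omega>)" by (cases p)
  have \<omega>: "\<omega> \<in> space M" using p tw by (auto simp: space_pair_measure)
  have ql: "(\<lambda>n. q n t) \<longlonglongrightarrow> t" unfolding q_def by (rule floor_quotient_approx)
  have "isCont (\<beta> \<omega>) t" using c[OF \<omega>] by (simp add: continuous_on_eq_continuous_at)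
  from isCont_tendsto_compose[OF this ql]
  show "(\<lambda>n. \<beta> (snd p) (q n (fst p))) \<longlonglongrightarrow> (case p of (t, \<omega>) \<Rightarrow> \<beta> \<omega> t)" by (simp add: tw)
qed

theorem theorem2p1:
  fixes T lam :: real and s :: nat
  assumes "T > 0" and "s \<ge> 1" and "lam \<noteq> 0"
  shows "\<forall>\<rho>\<ge>0. \<exists>\<epsilon>>0. \<forall>(M :: 'a measure) B u0.
     std_BM M B \<longrightarrow> L2fun u0 \<longrightarrow> L2_norm u0 = \<rho> \<longrightarrow> Hdot_sq s u0 \<le> ennreal (\<epsilon>\<^sup>2) \<longrightarrow>
     (\<forall>(\<delta>::real) (R::ereal) (N::enat). 0 \<le> \<delta> \<and> \<delta> < 1 \<and> 1 \<le> R \<and> 1 \<le> N \<longrightarrow>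
        (\<exists>u. WZ_mild M B lam \<delta> R N u0 T u \<and> (AE \<omega> in M. C_Hs s T (\<lambda>t. u t \<omega>)) \<and>
           (\<forall>v. WZ_mild M B lam \<delta> R N u0 T v \<and> (AE \<omega> in M. C_Hs s T (\<lambda>t. v t \<omega>)) \<longrightarrow>
              (AE \<omega> in M. \<forall>t\<in>{0..T}. AE x in lborel. x \<in> {0..2*pi} \<longrightarrow> v t \<omega> x = u t \<omega> x)) \<and>
           (AE \<omega> in M. \<forall>t\<in>{0..T}.
              Hs_norm s (u t \<omega>) \<le> 2 * Hs_norm s u0 + 2 * \<epsilon> \<and>
              L2_norm (u t \<omega>) = L2_norm (projN N u0))))"
proof (intro allI impI, goal_cases)
  case (1 \<rho>)
  \<comment> \<open>\<open>L2_norm\<close> lacks the factor 1/(2 pi), so \<open>q\<close> is the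
    square-sum norm of the coefficients. The radius exceeds it by 1, the room left for the nonzero
    modes.\<close>
  define q where "q = \<rho> / sqrt (2 * pi)"
  define r where "r = q + 1"
  \<comment> \<open>The factor by which the squared homogeneous norm can grow on
    \<open>[0, T]\<close> under truncation at \<open>r\<close>; it depends on the data through
    \<rho> alone.\<close>
  define \<kappa> where "\<kappa> = 2 * exp (2 * T * (lam\<^sup>2 * (wl2_tri_const s * r ^ 4)) * T)"
  \<comment> \<open>Chosen so that \<open>sqrt (emb_const * \<kappa>) * e1 \<le> 1\<close>; the
    summand 1 keeps the denominator positive.\<close>
  define e1 where "e1 = 1 / (1 + sqrt (emb_const * \<kappa>))"
  \<comment> \<open>The second constraint gives
    \<open>\<kappa> * \<epsilon>\<^sup>2 \<le> 3 * q\<^sup>2\<close>, hence a Sobolev norm of at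
    most \<open>2 * q\<close>. For zero mass it would force \<open>\<epsilon> = 0\<close>; there all
    coefficients vanish and the first constraint suffices.\<close>
  define \<epsilon> where "\<epsilon> = (if q = 0 then e1 else min e1 (q * sqrt (3 / \<kappa>)))"
  have q0: "0 \<le> q" using 1 by (simp add: q_def)
  have r0: "0 < r" using q0 by (simp add: r_def)
  have k0: "0 < \<kappa>" by (simp add: \<kappa>_def)
  have sq0: "0 \<le> sqrt (emb_const * \<kappa>)" using k0 by simp
  have e10: "0 < e1" unfolding e1_def using add_pos_nonneg[OF zero_less_one sq0] by simp
  have \<epsilon>0: "0 < \<epsilon>" using e10 q0 k0 by (auto simp: \<epsilon>_def)
  have \<epsilon>1: "emb_const * \<kappa> * \<epsilon>\<^sup>2 \<le> 1"
  proof -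
    have "sqrt (emb_const * \<kappa>) * \<epsilon> \<le> sqrt (emb_const * \<kappa>) * e1"
      using sq0 by (intro mult_left_mono) (auto simp: \<epsilon>_def)
    also have "\<dots> \<le> 1" unfolding e1_def using add_pos_nonneg[OF zero_less_one sq0] by (simp add: divide_le_eq_1)
    finally have "(sqrt (emb_const * \<kappa>) * \<epsilon>)\<^sup>2 \<le> 1" using sq0 \<epsilon>0 by (intro power_le_one) auto
    then show ?thesis using k0 by (simp add: power_mult_distrib)
  qed
  have \<epsilon>2: "\<kappa> * \<epsilon>\<^sup>2 \<le> 3 * q\<^sup>2" if "q \<noteq> 0"
  proof -
    have "\<epsilon>\<^sup>2 \<le> (q * sqrt (3 / \<kappa>))\<^sup>2" using that \<epsilon>0 by (intro power_mono) (auto simp: \<epsilon>_def)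
    then show ?thesis using k0 by (simp add: power_mult_distrib field_simps)
  qed
  show ?case
  proof (intro exI[of _ \<epsilon>] conjI \<epsilon>0 allI impI, goal_cases)
    case (1 M B u0 \<delta> R N)
    then have BM: "std_BM M B" and u0: "L2fun u0" "L2_norm u0 = \<rho>" "Hdot_sq s u0 \<le> ennreal (\<epsilon>\<^sup>2)"
      and par: "0 \<le> \<delta> \<and> \<delta> < 1 \<and> 1 \<le> R \<and> 1 \<le> N" by simp_all
    let ?D = "\<lambda>v t \<omega> m. set_lebesgue_integral lborel {0..t}
      (\<lambda>s. if inN N m then exp (- (\<i> * of_real (WZ_B \<delta> R B t \<omega> - WZ_B \<delta> R B s \<omega>) * of_int (m\<^sup>2)))
         * fc (cubic (v s \<omega>)) m else 0)"
    let ?eq = "\<lambda>v t \<omega> m. fc (v t \<omega>) m =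
      (if inN N m then exp (- (\<i> * of_real (WZ_B \<delta> R B t \<omega>) * of_int (m\<^sup>2))) * fc u0 m else 0)
      + \<i> * of_real lam * ?D v t \<omega> m"

    \<comment> \<open>Fourier data of the initial value\<close>
    define c where "c = fc u0"
    define h where "h = enn2real (wl2 s c)"
    define J where "J = inN N"
    define g where "g m = (if J m then c m else 0)" for m
    have ws: "wl2 s c \<le> ennreal (\<epsilon>\<^sup>2)" using u0(3) assms(2) by (simp add: Hdot_sq_eq c_def)
    have wh: "wl2 s c = ennreal h" unfolding h_def using le_less_trans[OF ws ennreal_less_top] by simp
    have "0 \<le> h" by (simp add: h_def)
    moreover have "h \<le> \<epsilon>\<^sup>2" using ws unfolding wh by simp
    ultimately have h: "0 \<le> h" "h \<le> \<epsilon>\<^sup>2" by blast+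
    have c: "integrable CZ c" by (rule integrable_if_wl2[OF assms(2)]) (simp add: wh)
    have w0: "wl2 0 c = ennreal (q\<^sup>2)"
    proof -
      have fin: "wl2 0 c = ennreal (\<integral>m. (cmod (c m))\<^sup>2 \<partial>CZ)"
        unfolding wl2_def using nn_integral_eq_integral[OF integrable_cmod_power2[OF c]] by simp
      have "\<rho> = sqrt (2 * pi * enn2real (wl2 0 c))"
        using L2_norm_fc[OF u0(1)] u0(2) c by (simp add: c_def)
      then have "\<rho>\<^sup>2 = 2 * pi * enn2real (wl2 0 c)" by simp
      then have "enn2real (wl2 0 c) = q\<^sup>2" by (simp add: q_def power_divide)
      then show ?thesis using fin by (metis enn2real_ennreal ennreal_enn2real ennreal_less_top)
    qed
    have gc: "cmod (g m) \<le> cmod (c m)" for m by (simp add: g_def)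
    have g: "integrable CZ g"
      using c by (rule Bochner_Integration.integrable_bound) (auto simp: gc)
    have g0: "wl2 0 g \<le> ennreal (q\<^sup>2)" and gs: "wl2 s g \<le> ennreal h"
      using wl2_mono[of g c, OF gc] w0 wh by metis+
    have supp: "g m = 0" if "\<not> J m" for m using that by (simp add: g_def)
    interpret truncated_equation lam r T J g
      by unfold_locales (use r0 assms g in auto)
    have kh: "2 * h * exp (2 * T * (lam\<^sup>2 * (wl2_tri_const s * r ^ 4)) * T) = \<kappa> * h"
      by (simp add: \<kappa>_def)
    have small: "emb_const * (2 * h * exp (2 * T * (lam\<^sup>2 * (wl2_tri_const s * r ^ 4)) * T)) \<le> 1"
    proof -
      have "emb_const * \<kappa> * h \<le> emb_const * \<kappa> * \<epsilon>\<^sup>2" using h k0 by (intro mult_left_mono) auto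
      then show ?thesis unfolding kh using \<epsilon>1 by (simp add: mult.assoc)
    qed

    \<comment> \<open>The driving path\<close>
    have "AE \<omega> in M. B 0 \<omega> = 0 \<and> continuous_on {0..} (\<lambda>t. B t \<omega>)" using BM by (simp add: std_BM_def)
    then obtain N0 where N0: "{\<omega> \<in> space M. \<not> (B 0 \<omega> = 0 \<and> continuous_on {0..} (\<lambda>t. B t \<omega>))} \<subseteq> N0"
        "emeasure M N0 = 0" "N0 \<in> sets M" by (rule AE_E)
    have AE_N0: "AE \<omega> in M. \<omega> \<notin> N0"
      using N0 by (intro AE_not_in) (auto simp: null_sets_def)
    have Bm: "B t \<in> borel_measurable M" if "0 \<le> t" for t using BM that by (simp add: std_BM_def)
    \<comment> \<open>Paths on the measurable null set \<open>N0\<close> are replaced by 0, so that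
      every path is continuous and the solution is built for every \<omega>; off \<open>N0\<close>
      the original process is recovered at nonnegative times.\<close>
    define \<beta> where "\<beta> \<omega> t = (if \<omega> \<in> N0 then 0 else WZ_B \<delta> R B (max 0 t) \<omega>)" for \<omega> t
    have \<beta>c: "continuous_on UNIV (\<beta> \<omega>)" if "\<omega> \<in> space M" for \<omega>
    proof (cases "\<omega> \<in> N0")
      case True
      then show ?thesis by (simp add: \<beta>_def[abs_def])
    next
      case False
      then have "continuous_on {0..} (\<lambda>t. B t \<omega>)" using N0 that by blast
      then show ?thesis using False continuous_on_WZ_B[of B \<omega> \<delta> R] par by (simp add: \<beta>_def[abs_def])
    qed
    have \<beta>cT: "continuous_on {0..T} (\<beta> \<omega>)" if "\<omega> \<in> space M" for \<omega>
      using \<beta>c[OF that] by (rule continuous_on_subset) simp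
    have \<beta>b: "\<beta> \<omega> \<in> borel_measurable borel" if "\<omega> \<in> space M" for \<omega>
      by (rule borel_measurable_continuous_onI[OF \<beta>c[OF that]])
    have \<beta>m: "(\<lambda>\<omega>. \<beta> \<omega> t) \<in> borel_measurable M" for t
    proof -
      have [measurable]: "N0 \<in> sets M" by fact
      have [measurable]: "(\<lambda>\<omega>. WZ_B \<delta> R B (max 0 t) \<omega>) \<in> borel_measurable M"
        using par by (intro measurable_WZ_B Bm) auto
      show ?thesis unfolding \<beta>_def by measurable
    qed
    have \<beta>pair: "(\<lambda>(t, \<omega>). \<beta> \<omega> t) \<in> borel_measurable (borel \<Otimes>\<^sub>M M)"
      by (rule measurable_pair_continuous[OF \<beta>m \<beta>c])
    have WZ: "WZ_B \<delta> R B t \<omega> = \<beta> \<omega> t" if "\<omega> \<notin> N0" "0 \<le> t" for \<omega> t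
      using that by (simp add: \<beta>_def)

    \<comment> \<open>The solution in the interaction picture, its rotated coefficients and its
      Fourier series\<close>
    define w where "w \<omega> t = sol (\<beta> \<omega>) t" for \<omega> t
    define a where "a \<omega> t = rot (\<beta> \<omega> t) (w \<omega> t)" for \<omega> t
    define u where "u t \<omega> = synth (a \<omega> t)" for t \<omega>
    have wi: "integrable CZ (w \<omega> t)" and wn: "nrm (w \<omega> t) \<le> r"
      if "\<omega> \<in> space M" "t \<in> {0..T}" for \<omega> t
      unfolding w_def
      using integrable_sol[OF \<beta>b[OF that(1)] that(2)]
        sol_nrm_le[OF \<beta>b[OF that(1)] \<beta>cT[OF that(1)] supp assms(2) g0 q0 _ gs h(1) small that(2)]
      by (auto simp: r_def)
    have ai: "integrable CZ (a \<omega> t)" if "\<omega> \<in> space M" "t \<in> {0..T}" for \<omega> t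
      using wi[OF that] by (simp add: a_def)
    have fcu: "fc (u t \<omega>) = a \<omega> t" if "\<omega> \<in> space M" "t \<in> {0..T}" for \<omega> t
      unfolding u_def by (intro ext fc_synth ai that)
    have L2u: "L2fun (u t \<omega>)" if "\<omega> \<in> space M" "t \<in> {0..T}" for \<omega> t
      unfolding u_def by (intro L2fun_synth ai that)

    \<comment> \<open>The mild formulation\<close>
    have mild: "WZ_mild M B lam \<delta> R N u0 T u"
      unfolding WZ_mild_def
    proof (intro conjI ballI allI)
      fix t m assume t: "t \<in> {0..T}"
      have sm: "(\<lambda>\<omega>. sol (\<beta> \<omega>) t m) \<in> borel_measurable M"
        using measurable_compose[OF _ measurable_sol_pair[OF \<beta>pair], of "\<lambda>\<omega>. (t, \<omega>)" M] by simp
      have "(\<lambda>\<omega>. ph (\<beta> \<omega> t) m) \<in> borel_measurable M"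
        by (rule measurable_compose[OF \<beta>m measurable_ph])
      then have "(\<lambda>\<omega>. a \<omega> t m) \<in> borel_measurable M"
        using sm unfolding a_def rot_def w_def by (intro borel_measurable_times)
      then show "(\<lambda>\<omega>. fc (u t \<omega>) m) \<in> borel_measurable M"
        by (subst measurable_cong[where g = "\<lambda>\<omega>. a \<omega> t m"]) (use t in \<open>auto simp: fcu\<close>)
    next
      fix t assume t: "t \<in> {0..T}"
      show "AE \<omega> in M. \<forall>m. ?eq u t \<omega> m"
        using AE_N0 AE_space
      proof eventually_elim
        case (elim \<omega>)
        show ?case
        proof
          fix m
          have "rot (\<beta> \<omega> t) (w \<omega> t) m = ph (\<beta> \<omega> t) m * g m + \<i> * of_real lam * set_lebesgue_integral lborel {0..t}
              (\<lambda>s. if J m then ph (\<beta> \<omega> t - \<beta> \<omega> s) m * cube (rot (\<beta> \<omega> s) (w \<omega> s)) m else 0)"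
          proof (rule mild_iff_interaction_picture[THEN iffD2])
            show "nrm (w \<omega> s) \<le> r" if "s \<in> {0..t}" for s using wn[OF elim(2)] that t by auto
            show "w \<omega> t m = g m + duhamel lam r J (\<beta> \<omega>) (w \<omega>) t m"
              unfolding w_def by (rule sol_eq[OF \<beta>b[OF elim(2)] t])
          qed (rule r0)
          moreover have "set_lebesgue_integral lborel {0..t}
              (\<lambda>s. if J m then ph (\<beta> \<omega> t - \<beta> \<omega> s) m * cube (rot (\<beta> \<omega> s) (w \<omega> s)) m else 0)
            = ?D u t \<omega> m"
          proof (intro set_lebesgue_integral_cong allI impI)
            fix s assume "s \<in> {0..t}"
            then have s: "s \<in> {0..T}" using t by auto
            have "fc (cubic (u s \<omega>)) m = cube (rot (\<beta> \<omega> s) (w \<omega> s)) m"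
              using fc_cubic_synth[OF ai[OF elim(2) s]] by (simp add: u_def a_def)
            then show "(if J m then ph (\<beta> \<omega> t - \<beta> \<omega> s) m * cube (rot (\<beta> \<omega> s) (w \<omega> s)) m else 0)
              = (if inN N m then exp (- (\<i> * of_real (WZ_B \<delta> R B t \<omega> - WZ_B \<delta> R B s \<omega>) * of_int (m\<^sup>2)))
                        * fc (cubic (u s \<omega>)) m else 0)"
              using WZ[OF elim(1)] s t by (simp add: ph_def J_def)
          qed simp
          ultimately show "?eq u t \<omega> m"
            using fcu[OF elim(2) t] WZ[OF elim(1), of t] t by (simp add: a_def g_def ph_def J_def c_def)
        qed
      qed
    qed (rule L2u)

    \<comment> \<open>Continuity in the Sobolev space\<close>
    have CHs: "C_Hs s T (\<lambda>t. u t \<omega>)" if \<omega>: "\<omega> \<in> space M" for \<omega>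
    proof -
      have "dominated_family {0..T} (a \<omega>) (dmn (\<beta> \<omega>))"
        unfolding a_def[abs_def] w_def
        by (rule dominated_family_rot[OF dominated_sol[OF \<beta>b[OF \<omega>] \<beta>cT[OF \<omega>]] \<beta>cT[OF \<omega>]])
      moreover have "wl2 0 (\<lambda>m. complex_of_real (dmn (\<beta> \<omega>) m)) < \<infinity>" "wl2 s (\<lambda>m. complex_of_real (dmn (\<beta> \<omega>) m)) < \<infinity>"
        by (rule wl2_dmn[OF \<beta>b[OF \<omega>] \<beta>cT[OF \<omega>]], rule le_less_trans[OF g0] le_less_trans[OF gs], simp)+
      ultimately show ?thesis unfolding u_def by (rule C_Hs_synth)
    qed

    \<comment> \<open>Uniqueness\<close>
    have unique: "AE \<omega> in M. \<forall>t\<in>{0..T}. AE x in lborel. x \<in> {0..2*pi} \<longrightarrow> v t \<omega> x = u t \<omega> x"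
      if v: "WZ_mild M B lam \<delta> R N u0 T v" "AE \<omega> in M. C_Hs s T (\<lambda>t. v t \<omega>)" for v
    proof -
      \<comment> \<open>\<open>WZ_mild\<close> allows a different null set at each time; over the
        countably many rational times they unite to one.\<close>
      have "AE \<omega> in M. \<forall>t\<in>{0..T} \<inter> \<rat>. \<forall>m. ?eq v t \<omega> m"
        using v(1) unfolding WZ_mild_def
        by (subst AE_ball_countable) (auto intro: countable_rat countable_Int2)
      with v(2) AE_N0 AE_space show ?thesis
      proof eventually_elim
        case (elim \<omega>)
        note vC = C_Hs_fc[OF assms(2) less_imp_le[OF assms(1)] elim(1)]
        obtain K where K: "\<And>t. t \<in> {0..T} \<Longrightarrow> nrm (fc (v t \<omega>)) \<le> K" using vC(4) by blast
        \<comment> \<open>Off the exceptional sets the claim is deterministic and concerns one path;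
          the bound \<open>K\<close> comes from the continuity of \<open>v\<close> and may depend on
          \<omega>.\<close>
        have eq: "fc (v t \<omega>) m = rot (\<beta> \<omega> t) (w \<omega> t) m" if t: "t \<in> {0..T}" for t m
        proof (rule mild_unique_path[where g = g and J = J and lam = lam and r = r and K = K and T = T and y = "\<lambda>t. fc (v t \<omega>)"])
          show "\<beta> \<omega> \<in> borel_measurable borel" "continuous_on {0..T} (\<beta> \<omega>)"
            using \<beta>b \<beta>cT elim(3) by auto
          show "(\<lambda>t. w \<omega> t m) \<in> borel_measurable borel" for m
            unfolding w_def by (rule measurable_sol[OF \<beta>b[OF elim(3)]])
          show "w \<omega> t m = g m + duhamel lam r J (\<beta> \<omega>) (w \<omega>) t m" if "t \<in> {0..T}" for t m
            unfolding w_def by (rule sol_eq[OF \<beta>b[OF elim(3)] that])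
          fix t m assume tq: "t \<in> {0..T}" "t \<in> \<rat>"
          have "set_lebesgue_integral lborel {0..t}
              (\<lambda>s. if J m then ph (\<beta> \<omega> t - \<beta> \<omega> s) m * cube (fc (v s \<omega>)) m else 0)
            = ?D v t \<omega> m"
          proof (intro set_lebesgue_integral_cong allI impI)
            fix s assume "s \<in> {0..t}"
            then have s: "s \<in> {0..T}" using tq by auto
            show "(if J m then ph (\<beta> \<omega> t - \<beta> \<omega> s) m * cube (fc (v s \<omega>)) m else 0)
              = (if inN N m then exp (- (\<i> * of_real (WZ_B \<delta> R B t \<omega> - WZ_B \<delta> R B s \<omega>) * of_int (m\<^sup>2)))
                        * fc (cubic (v s \<omega>)) m else 0)"
              using WZ[OF elim(2)] s tq fc_cubic[OF vC(1)[OF s] vC(2)[OF s]] by (simp add: ph_def J_def)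
          qed simp
          then show "fc (v t \<omega>) m = ph (\<beta> \<omega> t) m * g m + \<i> * of_real lam * set_lebesgue_integral lborel {0..t}
              (\<lambda>s. if J m then ph (\<beta> \<omega> t - \<beta> \<omega> s) m * cube (fc (v s \<omega>)) m else 0)"
            using elim(4) tq WZ[OF elim(2), of t] by (simp add: g_def ph_def J_def c_def)
        qed (use assms g vC K wi[OF elim(3)] wn[OF elim(3)] r0 t in auto)
        show ?case
        proof
          fix t assume t: "t \<in> {0..T}"
          show "AE x in lborel. x \<in> {0..2*pi} \<longrightarrow> v t \<omega> x = u t \<omega> x"
            by (intro L2fun_fc_cong vC(1) L2u elim t) (simp add: eq[OF t] fcu[OF elim(3) t] a_def)
        qed
      qed
    qed

    \<comment> \<open>The Sobolev bound and conservation of the L2 norm\<close>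
    have bounds: "Hs_norm s (u t \<omega>) \<le> 2 * Hs_norm s u0 + 2 * \<epsilon> \<and> L2_norm (u t \<omega>) = L2_norm (projN N u0)"
      if \<omega>: "\<omega> \<in> space M" and t: "t \<in> {0..T}" for \<omega> t
    proof
      have mass: "wl2 0 (a \<omega> t) = wl2 0 g"
        using sol_mass[OF \<beta>b[OF \<omega>] \<beta>cT[OF \<omega>] supp t] by (simp add: a_def w_def)
      have hs: "wl2 s (a \<omega> t) \<le> ennreal (\<kappa> * h)"
        using wl2_sol[OF \<beta>b[OF \<omega>] gs h(1) t] unfolding kh by (simp add: a_def w_def)
      have "Hs_sq s (u t \<omega>) \<le> ennreal (q\<^sup>2) + ennreal (\<kappa> * h)"
        unfolding Hs_sq_eq fcu[OF \<omega> t] mass by (intro add_mono g0 hs)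
      then have "enn2real (Hs_sq s (u t \<omega>)) \<le> q\<^sup>2 + \<kappa> * h"
        using k0 h(1) by (intro enn2real_leI) auto
      then have l: "Hs_norm s (u t \<omega>) \<le> sqrt (q\<^sup>2 + \<kappa> * h)" by (simp add: Hs_norm_def)
      have "Hs_norm s u0 = sqrt (q\<^sup>2 + h)"
        unfolding Hs_norm_def Hs_sq_eq c_def[symmetric] w0 wh using h(1) by (simp flip: ennreal_plus)
      then have u0q: "q \<le> Hs_norm s u0" using h(1) q0 by (simp add: real_le_rsqrt)
      show "Hs_norm s (u t \<omega>) \<le> 2 * Hs_norm s u0 + 2 * \<epsilon>"
      \<comment> \<open>With zero mass all coefficients of \<open>u0\<close> vanish, so the
        homogeneous part is 0 as well. Otherwise the choice of \<epsilon> compares it with the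
        mass.\<close>
      proof (cases "q = 0")
        case True
        have "ennreal (real_of_int \<bar>m\<bar> ^ (2 * 0) * (cmod (c m))\<^sup>2) \<le> wl2 0 c" for m
          unfolding wl2_def by (rule nn_integral_ge_point) simp
        then have "c m = 0" for m using w0 True by simp
        then have "wl2 s c = 0" by (simp add: wl2_def)
        then have "h = 0" by (simp add: h_def)
        then show ?thesis using l True u0q \<epsilon>0 by simp
      next
        case False
        have "\<kappa> * h \<le> \<kappa> * \<epsilon>\<^sup>2" using h k0 by (intro mult_left_mono) auto
        \<comment> \<open>Here \<open>1 + 3 = 4\<close>: this is the origin of the constant 3 in the
          choice of \<epsilon>, and the factor 2 in the bound is already reached by the mass part of
          the initial norm.\<close>
        then have "q\<^sup>2 + \<kappa> * h \<le> (2 * q)\<^sup>2" using \<epsilon>2[OF False] by (simp add: power_mult_distrib)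
        then have "sqrt (q\<^sup>2 + \<kappa> * h) \<le> 2 * q" using q0 by (intro real_le_lsqrt) auto
        then show ?thesis using l u0q \<epsilon>0 by linarith
      qed
      show "L2_norm (u t \<omega>) = L2_norm (projN N u0)"
      proof -
        have "L2_norm (u t \<omega>) = sqrt (2 * pi * enn2real (wl2 0 g))"
          unfolding u_def using L2_norm_synth[OF ai[OF \<omega> t]] mass by simp
        also have "g = (\<lambda>m. if inN N m then fc u0 m else 0)" by (auto simp: g_def J_def c_def)
        finally show ?thesis using L2_norm_projN[OF u0(1), of N] c by (simp add: c_def)
      qed
    qed

    show ?case
    proof (rule exI[of _ u], intro conjI)
      show "WZ_mild M B lam \<delta> R N u0 T u" by (rule mild)
      show "AE \<omega> in M. C_Hs s T (\<lambda>t. u t \<omega>)" by (rule AE_I2) (rule CHs)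
      show "\<forall>v. WZ_mild M B lam \<delta> R N u0 T v \<and> (AE \<omega> in M. C_Hs s T (\<lambda>t. v t \<omega>)) \<longrightarrow>
              (AE \<omega> in M. \<forall>t\<in>{0..T}. AE x in lborel. x \<in> {0..2*pi} \<longrightarrow> v t \<omega> x = u t \<omega> x)"
        by (intro allI impI, erule conjE) (rule unique)
      show "AE \<omega> in M. \<forall>t\<in>{0..T}. Hs_norm s (u t \<omega>) \<le> 2 * Hs_norm s u0 + 2 * \<epsilon> \<and>
              L2_norm (u t \<omega>) = L2_norm (projN N u0)"
        by (rule AE_I2, rule ballI) (rule bounds)
    qed
  qed
qed

end
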